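(* Let $n-1<d\le n$ and let $S\subset\mathbb{R}^n$ be a $d$-set. Let $\alpha>0$ and $1\le p,q<\infty$. For an integer $k>\alpha$, a number $1\le u\le p$ and $f\in L^p(S)$ put $$N_{k,u}(f):=\|f\|_{L^p(S)}+\bigg(\int_0^1\bigg(\frac{\|\mathcal{E}_k(f,Q(\cdot,\tau))_{L^u(S)}\|_{L^p(S)}}{\tau^{\alpha}}\bigg)^{q}\,\frac{d\tau}{\tau}\bigg)^{1/q}.$$ Then the Besov space $B^{\alpha}_{pq}(S)=\{f\in L^p(S): N_{k,u}(f)<\infty\}$ does not depend on the choice of the integer $k>\alpha$ and of $1\le u\le p$. Furthermore, the norms corresponding to any two pairs of such parameters are equivalent: for all integers $k,k'>\alpha$ and all $u,u'\in[1,p]$ there is a constant $C>0$, independent of $f$, such that $C^{-1}N_{k',u'}(f)\le N_{k,u}(f)\le C\,N_{k',u'}(f)$ for every $f\in L^p(S)$.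
   Context: $Q(x,r)=\{y\in\mathbb{R}^n:\|y-x\|_\infty\le r\}$ is the closed cube with center $x$ and side length $2r$. $\mathcal{H}^d$ is the $d$-dimensional Hausdorff measure. For $0<d\le n$, a (nonempty) closed set $S\subset\mathbb{R}^n$ is a $d$-set if there are constants $c_1,c_2>0$ such that $c_1r^d\le\mathcal{H}^d(Q(w,r)\cap S)\le c_2r^d$ for all $w\in S$ and $0<r\le1$. $L^p(S)$ is the $L^p$-space on $S$ with respect to the measure $\mathcal{H}^d|_S$. $\mathcal{P}_m$ ($m\ge0$) is the space of polynomials on $\mathbb{R}^n$ of degree at most $m$, and $\mathcal{P}_{-1}=\{0\}$. For a cube $Q$ centered at a point of $S$ and $1\le u<\infty$, the normalized local best approximation is $$\mathcal{E}_k(f,Q)_{L^u(S)}:=\inf_{P\in\mathcal{P}_{k-1}}\bigg(\frac{1}{\mathcal{H}^d(Q\cap S)}\int_{Q\cap S}|f-P|^u\,d\mathcal{H}^d\bigg)^{1/u}.$$ The expression $\|\mathcal{E}_k(f,Q(\cdot,\tau))_{L^u(S)}\|_{L^p(S)}$ is the $L^p(S)$-norm of the function $x\mapsto\mathcal{E}_k(f,Q(x,\tau))_{L^u(S)}$, $x\in S$. *)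

theory Defs
  imports "HOL-Analysis.Analysis"
begin

section \<open>Hausdorff measure\<close>

text \<open>
  The usual construction with Euclidean diameters, without normalising constant. It is meant for
  \<open>d > 0\<close> only (because of \<open>0 powr 0 = 0\<close>). The covering sets are required to be
  bounded since \<^const>\<open>diameter\<close> is meaningless on unbounded sets.
\<close>

definition hausdorff_content :: "real \<Rightarrow> real \<Rightarrow> 'a::metric_space set \<Rightarrow> ennreal" where
  "hausdorff_content d \<delta> A =
     (INF U \<in> {U :: nat \<Rightarrow> 'a set. (\<forall>i. bounded (U i) \<and> diameter (U i) \<le> \<delta>) \<and> A \<subseteq> (\<Union>i. U i)}.
        \<Sum>i. ennreal (diameter (U i) powr d))"

definition hausdorff_outer :: "real \<Rightarrow> 'a::metric_space set \<Rightarrow> ennreal" where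
  "hausdorff_outer d A = (SUP \<delta>\<in>{0<..}. hausdorff_content d \<delta> A)"

text \<open>The measure lives on the sigma-algebra of all Caratheodory-measurable sets.\<close>

definition hausdorff_measure :: "real \<Rightarrow> 'a::metric_space measure" where
  "hausdorff_measure d =
     measure_of UNIV (lambda_system UNIV UNIV (hausdorff_outer d)) (hausdorff_outer d)"

lemma hausdorff_content_subadditive:
  "hausdorff_content d \<delta> (\<Union>i. A i) \<le> (\<Sum>i. hausdorff_content d \<delta> (A i))"
proof (rule ennreal_le_epsilon)
  fix e :: real
  assume fin: "(\<Sum>i. hausdorff_content d \<delta> (A i)) < top" and e: "0 < e"
  let ?cov = "\<lambda>U A. (\<forall>i::nat. bounded (U i) \<and> diameter (U i) \<le> \<delta>) \<and> A \<subseteq> (\<Union>i. U i)"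
  have "\<exists>U. ?cov U (A n) \<and> (\<Sum>i. ennreal (diameter (U i) powr d))
          \<le> hausdorff_content d \<delta> (A n) + e * (1/2)^Suc n" for n
  proof -
    have "hausdorff_content d \<delta> (A n) < hausdorff_content d \<delta> (A n) + e * (1/2)^Suc n"
      using fin e by (auto simp add: less_top dest!: ennreal_suminf_lessD)
    then have "(INF U \<in> {U. ?cov U (A n)}. \<Sum>i. ennreal (diameter (U i) powr d))
                 < hausdorff_content d \<delta> (A n) + e * (1/2)^Suc n"
      by (simp only: hausdorff_content_def)
    then show ?thesis
      by (auto simp: INF_less_iff intro: less_imp_le)
  qed
  then obtain B where B: "\<And>n. ?cov (B n) (A n)"
    and Ble: "\<And>n. (\<Sum>i. ennreal (diameter (B n i) powr d))
                 \<le> hausdorff_content d \<delta> (A n) + e * (1/2)^Suc n"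
    by metis
  define C where "C = case_prod B o prod_decode"
  have "(\<Union>i. A i) \<subseteq> (\<Union>i. C i)"
  proof safe
    fix x n assume "x \<in> A n"
    then obtain i where "x \<in> B n i" using B by blast
    then show "x \<in> (\<Union>i. C i)"
      by (auto simp: C_def intro!: exI[of _ "prod_encode (n, i)"])
  qed
  moreover have "\<forall>i. bounded (C i) \<and> diameter (C i) \<le> \<delta>"
    using B by (simp add: C_def case_prod_unfold)
  ultimately have "?cov C (\<Union>i. A i)"
    by simp
  then have "hausdorff_content d \<delta> (\<Union>i. A i) \<le> (\<Sum>i. ennreal (diameter (C i) powr d))"
    unfolding hausdorff_content_def by (intro INF_lower) simp
  also have "\<dots> = (\<Sum>n. \<Sum>i. ennreal (diameter (B n i) powr d))"
    using suminf_ennreal_2dimen[OF refl, of "\<lambda>(n, i). ennreal (diameter (B n i) powr d)"]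
    by (simp add: C_def comp_def case_prod_unfold)
  also have "\<dots> \<le> (\<Sum>n. hausdorff_content d \<delta> (A n) + e * (1/2) ^ Suc n)"
    by (intro suminf_le allI Ble) auto
  also have "\<dots> = (\<Sum>n. hausdorff_content d \<delta> (A n)) + (\<Sum>n. ennreal e * ennreal ((1/2) ^ Suc n))"
    using \<open>0 < e\<close> by (subst suminf_add[symmetric])
      (auto simp del: ennreal_suminf_cmult simp add: ennreal_mult[symmetric])
  also have "\<dots> = (\<Sum>n. hausdorff_content d \<delta> (A n)) + e"
    unfolding ennreal_suminf_cmult
    by (subst suminf_ennreal_eq[OF zero_le_power power_half_series]) auto
  finally show "hausdorff_content d \<delta> (\<Union>i. A i)
      \<le> (\<Sum>n. hausdorff_content d \<delta> (A n)) + e" .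
qed

lemma outer_measure_space_hausdorff: "outer_measure_space UNIV (hausdorff_outer d)"
  unfolding outer_measure_space_def
proof (intro conjI)
  have "hausdorff_content d \<delta> ({} :: 'a set) = 0" if "0 < \<delta>" for \<delta>
  proof -
    have "hausdorff_content d \<delta> ({} :: 'a set) \<le> (\<Sum>i::nat. ennreal (diameter ({} :: 'a set) powr d))"
      unfolding hausdorff_content_def using that by (intro INF_lower) auto
    then show ?thesis by simp
  qed
  then show "positive UNIV (hausdorff_outer d :: 'a set \<Rightarrow> _)"
    by (simp add: positive_def hausdorff_outer_def)
  show "increasing UNIV (hausdorff_outer d :: 'a set \<Rightarrow> _)"
    unfolding increasing_def hausdorff_outer_def hausdorff_content_def
    by (intro ballI impI SUP_mono' INF_superset_mono Collect_mono) blast+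
  have "hausdorff_content d \<delta> (\<Union>i. A i) \<le> (\<Sum>i. hausdorff_outer d (A i))"
    if "0 < \<delta>" for \<delta> and A :: "nat \<Rightarrow> 'a set"
  proof (rule order_trans[OF hausdorff_content_subadditive suminf_le])
    show "hausdorff_content d \<delta> (A n) \<le> hausdorff_outer d (A n)" for n
      unfolding hausdorff_outer_def using that by (intro SUP_upper) auto
  qed auto
  then have "hausdorff_outer d (\<Union>i. A i) \<le> (\<Sum>i. hausdorff_outer d (A i))"
    for A :: "nat \<Rightarrow> 'a set"
    unfolding hausdorff_outer_def[of d "\<Union>i. A i"] by (intro SUP_least) simp
  then show "countably_subadditive UNIV (hausdorff_outer d :: 'a set \<Rightarrow> _)"
    by (simp add: countably_subadditive_def)
qed

lemma
  shows space_hausdorff_measure [simp]: "space (hausdorff_measure d) = UNIV"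
    and sets_hausdorff_measure:
      "sets (hausdorff_measure d) = lambda_system UNIV UNIV (hausdorff_outer d)"
    and emeasure_hausdorff_measure:
      "A \<in> sets (hausdorff_measure d) \<Longrightarrow> emeasure (hausdorff_measure d) A = hausdorff_outer d A"
proof -
  have "measure_space UNIV (lambda_system UNIV UNIV (hausdorff_outer d)) (hausdorff_outer d)"
    by (rule sigma_algebra.caratheodory_lemma[OF sigma_algebra_Pow[of UNIV], unfolded Pow_UNIV,
          OF outer_measure_space_hausdorff])
  then have sa: "sigma_algebra UNIV (lambda_system UNIV UNIV (hausdorff_outer d))"
    and pos: "positive (lambda_system UNIV UNIV (hausdorff_outer d)) (hausdorff_outer d)"
    and ca: "countably_additive (lambda_system UNIV UNIV (hausdorff_outer d)) (hausdorff_outer d)"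
    by (auto simp: measure_space_def)
  show "space (hausdorff_measure d) = UNIV"
    by (simp add: hausdorff_measure_def space_measure_of_conv)
  show sets: "sets (hausdorff_measure d) = lambda_system UNIV UNIV (hausdorff_outer d)"
    by (simp add: hausdorff_measure_def sigma_algebra.sets_measure_of_eq[OF sa])
  show "emeasure (hausdorff_measure d) A = hausdorff_outer d A"
    if "A \<in> sets (hausdorff_measure d)"
    unfolding hausdorff_measure_def
    using that by (intro emeasure_measure_of_sigma[OF sa pos ca]) (simp only: sets)
qed


section \<open>Cubes, \<open>d\<close>-sets and polynomials\<close>

definition cube :: "'a::euclidean_space \<Rightarrow> real \<Rightarrow> 'a set" where
  "cube x r = {y. infnorm (y - x) \<le> r}"

definition d_set :: "real \<Rightarrow> 'a::euclidean_space set \<Rightarrow> bool" where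
  "d_set d S \<longleftrightarrow> closed S \<and> S \<noteq> {} \<and>
     (\<exists>c1>0. \<exists>c2>0. \<forall>w\<in>S. \<forall>r::real. 0 < r \<and> r \<le> 1 \<longrightarrow>
        ennreal (c1 * r powr d) \<le> emeasure (hausdorff_measure d) (cube w r \<inter> S) \<and>
        emeasure (hausdorff_measure d) (cube w r \<inter> S) \<le> ennreal (c2 * r powr d))"

text \<open>
  Real polynomial functions of total degree at most \<open>m\<close>; the functions \<open>a\<close> are multi-indices.
  For \<open>m = -1\<close> the sum is empty and only the zero function remains.
\<close>

definition polys :: "int \<Rightarrow> (real^'n::finite \<Rightarrow> real) set" where
  "polys m = {P. \<exists>c :: ('n \<Rightarrow> nat) \<Rightarrow> real.
     P = (\<lambda>x. \<Sum>a \<in> {a. int (\<Sum>i\<in>UNIV. a i) \<le> m}. c a * (\<Prod>i\<in>UNIV. (x $ i) ^ a i))}"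


section \<open>Besov spaces on \<open>d\<close>-sets\<close>

text \<open>
  All norms take values in \<^typ>\<open>ennreal\<close>, so that divergent integrals are \<open>\<infinity>\<close>.
  Powers of extended nonnegative reals are used for positive exponents only.
\<close>

definition ennreal_powr :: "ennreal \<Rightarrow> real \<Rightarrow> ennreal" (infixr "epowr" 80) where
  "x epowr a = (if x = \<infinity> then \<infinity> else ennreal (enn2real x powr a))"

definition Lp_norm :: "'a measure \<Rightarrow> real \<Rightarrow> ('a \<Rightarrow> ennreal) \<Rightarrow> ennreal" where
  "Lp_norm M p g = (\<integral>\<^sup>+x. g x epowr p \<partial>M) epowr (1 / p)"

text \<open>
  The functions representing elements of \<open>L\<^sup>p(S)\<close>; they are total on the ambient space, but their
  values outside \<open>S\<close> are irrelevant. Functions that agree almost everywhere are not identified.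
\<close>

definition Lp_on :: "real \<Rightarrow> 'a::euclidean_space set \<Rightarrow> real \<Rightarrow> ('a \<Rightarrow> real) set" where
  "Lp_on d S p = {f \<in> borel_measurable (restrict_space (hausdorff_measure d) S).
     Lp_norm (restrict_space (hausdorff_measure d) S) p (\<lambda>x. ennreal \<bar>f x\<bar>) < \<infinity>}"

definition best_approx ::
  "real \<Rightarrow> (real^'n::finite) set \<Rightarrow> int \<Rightarrow> real \<Rightarrow> (real^'n \<Rightarrow> real) \<Rightarrow> (real^'n) set \<Rightarrow> ennreal" where
  "best_approx d S k u f Q =
     (INF P \<in> polys (k - 1).
        (1 / emeasure (hausdorff_measure d) (Q \<inter> S) *
           (\<integral>\<^sup>+y\<in>Q \<inter> S. ennreal (\<bar>f y - P y\<bar> powr u) \<partial>hausdorff_measure d)) epowr (1 / u))"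

definition besov_norm ::
  "real \<Rightarrow> (real^'n::finite) set \<Rightarrow> real \<Rightarrow> real \<Rightarrow> real \<Rightarrow> int \<Rightarrow> real \<Rightarrow> (real^'n \<Rightarrow> real) \<Rightarrow> ennreal" where
  "besov_norm d S \<alpha> p q k u f =
     Lp_norm (restrict_space (hausdorff_measure d) S) p (\<lambda>x. ennreal \<bar>f x\<bar>) +
     (\<integral>\<^sup>+\<tau>\<in>{0<..1}.
        (Lp_norm (restrict_space (hausdorff_measure d) S) p (\<lambda>x. best_approx d S k u f (cube x \<tau>))
           / ennreal (\<tau> powr \<alpha>)) epowr q / ennreal \<tau> \<partial>lborel) epowr (1 / q)"

definition besov_space ::
  "real \<Rightarrow> (real^'n::finite) set \<Rightarrow> real \<Rightarrow> real \<Rightarrow> real \<Rightarrow> int \<Rightarrow> real \<Rightarrow> (real^'n \<Rightarrow> real) set" where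
  "besov_space d S \<alpha> p q k u = {f \<in> Lp_on d S p. besov_norm d S \<alpha> p q k u f < \<infinity>}"

end

(*
The norms increase with u and decrease with k, so everything reduces to bounding N_{k,p} by
N_{K,1} for k <= K. Let P_{x,t} be a near-minimiser of degree K - 1 for f in L^1 on Q(x,t).

Because d > n - 1, a d-set cannot concentrate near a hyperplane; hence the coefficients of a
polynomial, in coordinates adapted to a cube centred on S, are controlled by its average over
S inside the cube (a Remez-type inequality, by induction on the degree). So near-minimisers on
comparable cubes differ by at most a multiple of the approximation error E_{K,1}.

Telescoping P_{y,t/2^j} down to the Lebesgue point y gives
  |f(y) - P_{y,t}(y)| <= C sum_j E_{K,1}(f, Q(y, t/2^j))   for almost every y,
which raises the exponent from 1 to p. Telescoping P_{x,2^i t} up to scale one, and truncating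
the Taylor expansions at x of the differences, lowers the degree at the cost of
sum_i 2^{-ik} E_{K,1}(f, Q(x, 2^i t)). Minkowski's inequality in L^p and Hardy's inequality for
dyadic sums in L^q(dt/t) conclude, because 0 < alpha < k.

Since f is only Caratheodory measurable, it is first replaced by a Borel function.
*)
theory Submission
  imports Defs
begin

section \<open>Powers of extended nonnegative reals and Minkowski's inequality\<close>

text \<open>Regularity of \<open>S\<close> is assumed only for radii up to 1, so the upward chain of
  scales has to stop at some \<open>2 ^ J * t\<close> in (1/2, 1]. What is left there is bounded by
  an average of \<open>f\<close> itself with a weight of order \<open>t ^ b\<close>, where
  \<open>b\<close> is the smaller order \<open>k\<close>; this is the third term of
  \<open>dyadic_sum\<close>. Its first sum comes from raising the exponent, the second from lowering
  the degree. Measurability shapes the statements. Near-minimisers are chosen at each point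
  separately, never as measurable functions of the point, so they are eliminated before any
  integration. For exponent 1 the best approximation is measurable because countably many rational
  polynomials suffice; for exponent \<open>p\<close> only a Borel majorant is constructed, and on
  such functions the integral is used through its monotonicity alone. The Remez induction closes
  because on a cube of relative radius \<open>\<rho>\<close> the linear part of a polynomial scales
  like \<open>\<rho>\<close> and the remainder like its square, so that a small
  \<open>\<rho>\<close> lets the remainder be absorbed.\<close>

abbreviation dyadic_sum :: "nat \<Rightarrow> (real \<Rightarrow> ennreal) \<Rightarrow> ennreal \<Rightarrow> real \<Rightarrow> ennreal" where
  "dyadic_sum b g F t \<equiv> (\<Sum>j. g (t / 2 ^ j)) + (\<Sum>i. ennreal (((1/2) ^ i) ^ b) * g (2 ^ i * t)) + ennreal (t ^ b) * F"

lemma ennreal_double_add: "2 * a + a = 3 * (a :: ennreal)"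
proof -
  have "(2 + 1) * a = 2 * a + a" by (simp only: distrib_right mult_1)
  then show ?thesis by simp
qed

lemma ennreal_inverse_antimono: "x \<le> y \<Longrightarrow> inverse y \<le> inverse (x::ennreal)"
  by (cases x; cases y; cases "x = 0")
    (auto simp: inverse_ennreal less_le top_unique intro!: ennreal_leI le_imp_inverse_le)

lemma divide_mono_ennreal: "a \<le> b \<Longrightarrow> c \<le> e \<Longrightarrow> a / e \<le> b / (c::ennreal)"
  unfolding divide_ennreal_def by (intro mult_mono ennreal_inverse_antimono) auto

lemma ennreal_tendsto_0_I:
  fixes u :: "nat \<Rightarrow> ennreal"
  assumes "\<And>e::real. 0 < e \<Longrightarrow> \<forall>\<^sub>F i in sequentially. u i \<le> ennreal e"
  shows "u \<longlonglongrightarrow> 0"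
proof (rule order_tendstoI)
  fix a :: ennreal assume "0 < a"
  then obtain e where e: "0 < e" "e < a" using dense by blast
  then obtain r where r: "e = ennreal r" "0 < r" by (cases e) (auto simp: top.extremum_strict)
  then show "\<forall>\<^sub>F i in sequentially. u i < a"
    using assms[of r] e by (auto elim!: eventually_mono)
qed simp

lemma epowr_ennreal [simp]: "0 \<le> x \<Longrightarrow> ennreal x epowr a = ennreal (x powr a)"
  by (simp add: ennreal_powr_def)

lemma epowr_zero [simp]: "0 epowr a = 0"
  by (simp add: ennreal_powr_def)

lemma epowr_top [simp]: "top epowr a = top"
  by (simp add: ennreal_powr_def)

lemma epowr_one [simp]: "x epowr 1 = x"
  by (cases x) simp_all

lemma epowr_eq_top_iff [simp]: "x epowr a = top \<longleftrightarrow> x = top"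
  by (cases x) simp_all

lemma epowr_less_top_iff [simp]: "x epowr a < top \<longleftrightarrow> x < top"
  by (simp add: less_top[symmetric])

lemma epowr_mono: "0 < a \<Longrightarrow> x \<le> y \<Longrightarrow> x epowr a \<le> y epowr a"
  by (cases x; cases y) (auto intro!: ennreal_leI powr_mono2 simp: top_unique)

lemma epowr_mult: "(x * y) epowr a = x epowr a * y epowr a"
proof (cases "x = 0 \<or> y = 0")
  case False
  then show ?thesis
    by (cases x; cases y)
      (auto simp: ennreal_mult[symmetric] powr_mult ennreal_mult_top ennreal_top_mult)
qed auto

lemma epowr_epowr: "(x epowr a) epowr b = x epowr (a * b)"
  by (cases x) (simp_all add: powr_powr)

lemma epowr_inverse [simp]:
  assumes "0 < a" shows "(x epowr a) epowr (1 / a) = x" "(x epowr (1 / a)) epowr a = x"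
  using assms by (simp_all add: epowr_epowr)

lemma epowr_le_iff: "0 < a \<Longrightarrow> x epowr a \<le> y \<longleftrightarrow> x \<le> y epowr (1 / a)"
  by (metis divide_pos_pos epowr_inverse epowr_mono zero_less_one)

text \<open>Bounding the sum by twice the maximum is crude, but it works for every
  \<open>a > 0\<close>; \<open>best_Lp_le\<close> applies it with \<open>p\<close> as well as with
  \<open>1 / p\<close>.\<close>

lemma epowr_add_le:
  assumes "0 < a" shows "(x + y) epowr a \<le> ennreal (2 powr a) * (x epowr a + y epowr a)"
proof -
  have "(x + y) epowr a \<le> (2 * max x y) epowr a"
    using assms by (intro epowr_mono) (auto simp: mult_2 intro: add_mono)
  also have "\<dots> = ennreal (2 powr a) * max x y epowr a"
    using epowr_ennreal[of 2 a] by (simp add: epowr_mult)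
  also have "\<dots> \<le> ennreal (2 powr a) * (x epowr a + y epowr a)"
    by (intro mult_left_mono) (auto simp: max_def)
  finally show ?thesis .
qed

lemma borel_measurable_epowr [measurable (raw)]:
  assumes [measurable]: "f \<in> borel_measurable M"
  shows "(\<lambda>x. f x epowr a) \<in> borel_measurable M"
  unfolding ennreal_powr_def by measurable

section \<open>Jensen's inequality from tangent lines, for integrals and for series\<close>

lemma powr_tangent:
  fixes p s c :: real
  assumes "1 \<le> p" "0 \<le> s" "0 < c"
  shows "p * c powr (p - 1) * s \<le> s powr p + (p - 1) * c powr p"
proof (cases "s = 0")
  case False
  have cv: "convex_on {0<..} (\<lambda>x::real. x powr p)"
    using assms by (intro powr_convex)
  have "p * c powr (p - 1) * (s - c) \<le> s powr p - c powr p"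
  proof (rule convex_on_imp_above_tangent[where A="{0<..}"])
    show "((\<lambda>x. x powr p) has_field_derivative p * c powr (p - 1)) (at c within {0<..})"
      using assms by (auto intro!: derivative_eq_intros)
  qed (use assms False cv in \<open>auto simp: interior_open\<close>)
  moreover have "c powr (p - 1) * c = c powr p"
    using assms by (simp add: powr_diff)
  then have "p * c powr (p - 1) * (s - c) = p * c powr (p - 1) * s - p * c powr p"
    by (simp add: right_diff_distrib mult.assoc)
  ultimately show ?thesis by (simp add: left_diff_distrib)
qed (use assms in auto)

lemma epowr_tangent:
  assumes "1 \<le> p" "0 < c"
  shows "ennreal (p * c powr (p - 1)) * x \<le> x epowr p + ennreal ((p - 1) * c powr p)"
proof (cases x)
  case (real r)
  have "ennreal (p * c powr (p - 1) * r) \<le> ennreal (r powr p + (p - 1) * c powr p)"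
    using real assms by (intro ennreal_leI powr_tangent) auto
  then show ?thesis using real assms by (simp add: ennreal_mult' ennreal_plus)
qed simp

text \<open>Convexity enters only through the tangent inequality, which is integrated and then used
  at the best point of tangency. The measure is not normalised, so that the same lemma serves
  averages over cubes and weighted counting measures.\<close>

lemma nn_integral_Jensen:
  assumes [measurable]: "F \<in> borel_measurable N" and p: "1 \<le> p"
    and fin: "emeasure N (space N) \<noteq> \<infinity>"
  shows "(\<integral>\<^sup>+x. F x \<partial>N) epowr p \<le> emeasure N (space N) epowr (p - 1) * (\<integral>\<^sup>+x. F x epowr p \<partial>N)"
proof -
  let ?I = "\<integral>\<^sup>+x. F x \<partial>N" and ?J = "\<integral>\<^sup>+x. F x epowr p \<partial>N"
  obtain m where m: "emeasure N (space N) = ennreal m" "0 \<le> m"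
    using fin by (cases "emeasure N (space N)") auto
  have young: "ennreal (p * c powr (p - 1)) * ?I \<le> ?J + ennreal ((p - 1) * c powr p * m)"
    if c: "0 < c" for c
  proof -
    have "ennreal (p * c powr (p - 1)) * ?I = (\<integral>\<^sup>+x. ennreal (p * c powr (p - 1)) * F x \<partial>N)"
      by (simp add: nn_integral_cmult)
    also have "\<dots> \<le> (\<integral>\<^sup>+x. F x epowr p + ennreal ((p - 1) * c powr p) \<partial>N)"
      by (intro nn_integral_mono epowr_tangent p c)
    also have "\<dots> = ?J + ennreal ((p - 1) * c powr p * m)"
      using p m by (simp add: nn_integral_add ennreal_mult')
    finally show ?thesis .
  qed
  show ?thesis
  proof (cases "m = 0")
    case True
    then have "?I = 0" using m by (intro nn_integral_0_iff_AE[THEN iffD2] AE_I[where N="space N"]) auto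
    then show ?thesis by simp
  next
    case False
    then have m0: "0 < m" using m by simp
    show ?thesis
    proof (cases ?I)
      case top
      then have "?J = \<infinity>" using young[of 1] p by (auto simp: ennreal_mult_top top_unique)
      then show ?thesis using m m0 by (simp add: ennreal_mult_top)
    next
      case (real i)
      show ?thesis
      proof (cases "i = 0")
        case True
        then show ?thesis using real by simp
      next
        case False
        then have i0: "0 < i" using real by simp
        \<comment> \<open>Tangency at the mean value of \<open>F\<close> is optimal: the tangent
          term then exceeds the correction \<open>(p - 1) * c powr p * m\<close> by exactly
          \<open>c powr p * m\<close>.\<close>
        define c where "c = i / m"
        have c: "0 < c" using i0 m0 by (simp add: c_def)
        have eq: "p * c powr (p - 1) * i = c powr p * m + (p - 1) * c powr p * m"
        proof -
          have "c powr (p - 1) * i = c powr p * m"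
            using c m0 i0 by (simp add: powr_diff c_def)
          then show ?thesis by (simp add: algebra_simps)
        qed
        have "ennreal (c powr p * m) + ennreal ((p - 1) * c powr p * m)
                \<le> ?J + ennreal ((p - 1) * c powr p * m)"
          using young[OF c] real p c m0 eq
          by (simp add: ennreal_mult'[symmetric] ennreal_plus[symmetric] del: ennreal_plus)
        then have J: "ennreal (c powr p * m) \<le> ?J"
          by (subst (asm) ennreal_add_left_cancel_le[symmetric] | simp add: add.commute)+
        have "i powr p = m powr (p - 1) * (c powr p * m)"
          using i0 m0 by (simp add: c_def powr_divide powr_diff)
        then have "?I epowr p = emeasure N (space N) epowr (p - 1) * ennreal (c powr p * m)"
          using real m by (simp add: ennreal_mult'[symmetric])
        also have "\<dots> \<le> emeasure N (space N) epowr (p - 1) * ?J"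
          by (intro mult_left_mono J) simp
        finally show ?thesis .
      qed
    qed
  qed
qed

text \<open>This is Jensen's inequality for the functions \<open>F j / w j\<close> and the counting
  measure with density \<open>w\<close>.\<close>

lemma suminf_Jensen:
  fixes F :: "nat \<Rightarrow> ennreal" and w :: "nat \<Rightarrow> real"
  assumes w: "\<And>j. 0 < w j" "summable w" and p: "1 \<le> p"
  shows "(\<Sum>j. F j) epowr p
    \<le> ennreal (suminf w powr (p - 1)) * (\<Sum>j. ennreal (w j powr (1 - p)) * F j epowr p)"
proof -
  define N where "N = density (count_space (UNIV::nat set)) (\<lambda>j. ennreal (w j))"
  have int: "(\<integral>\<^sup>+j. g j \<partial>N) = (\<Sum>j. ennreal (w j) * g j)" for g
    by (simp add: N_def nn_integral_density nn_integral_count_space_nat)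
  have sp: "emeasure N (space N) = ennreal (suminf w)"
    using int[of "\<lambda>_. 1"] w by (simp add: suminf_ennreal_eq summable_sums less_imp_le)
  have 1: "ennreal (w j) * (F j * ennreal (1 / w j)) = F j" for j
    using w(1)[of j] by (subst mult.left_commute) (simp add: ennreal_mult'[symmetric])
  have 2: "ennreal (w j) * (F j * ennreal (1 / w j)) epowr p = ennreal (w j powr (1 - p)) * F j epowr p" for j
  proof -
    have "w j * (1 / w j) powr p = w j powr (1 - p)"
      using w(1)[of j] by (simp add: powr_diff powr_divide)
    then show ?thesis
      using w(1)[of j]
      by (simp add: epowr_mult mult.left_commute[of "ennreal (w j)"] ennreal_mult'[symmetric] mult.commute)
  qed
  have "(\<integral>\<^sup>+j. F j * ennreal (1 / w j) \<partial>N) epowr p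
      \<le> emeasure N (space N) epowr (p - 1) * (\<integral>\<^sup>+j. (F j * ennreal (1 / w j)) epowr p \<partial>N)"
    using p sp by (intro nn_integral_Jensen) (auto simp: N_def)
  then show ?thesis
    unfolding int sp using w by (simp add: 1 2 suminf_nonneg less_imp_le)
qed

text \<open>No measurability is assumed: the nonnegative integral is monotone on arbitrary
  functions. This is what makes best approximations with exponents other than 1 tractable.\<close>

lemma Lp_norm_mono_AE:
  assumes "0 < p" "AE x in M. f x \<le> g x"
  shows "Lp_norm M p f \<le> Lp_norm M p g"
  unfolding Lp_norm_def using assms
  by (intro epowr_mono nn_integral_mono_AE) (auto intro: epowr_mono)

lemma Lp_norm_mono:
  assumes "0 < p" "\<And>x. x \<in> space M \<Longrightarrow> f x \<le> g x"
  shows "Lp_norm M p f \<le> Lp_norm M p g"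
  using assms by (intro Lp_norm_mono_AE AE_I2)

lemma Lp_norm_cmult:
  assumes "0 < p" "f \<in> borel_measurable M"
  shows "Lp_norm M p (\<lambda>x. c * f x) = c * Lp_norm M p f"
  using assms by (simp add: Lp_norm_def epowr_mult nn_integral_cmult)

text \<open>Minkowski's inequality follows from Jensen's inequality for series with the weights
  \<open>\<parallel>F\<^sub>j\<parallel> + e / 2\<^sup>j\<close>.\<close>

lemma Lp_norm_suminf:
  assumes [measurable]: "\<And>j. F j \<in> borel_measurable M" and p: "1 \<le> p"
  shows "Lp_norm M p (\<lambda>x. \<Sum>j. F j x) \<le> (\<Sum>j. Lp_norm M p (F j))"
proof (rule ennreal_le_epsilon)
  fix e :: real assume fin: "(\<Sum>j. Lp_norm M p (F j)) < top" and e: "0 < e"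
  define a where "a j = enn2real (Lp_norm M p (F j))" for j
  have a: "Lp_norm M p (F j) = ennreal (a j)" for j
    using ennreal_suminf_lessD[OF fin, of j] by (simp add: a_def less_top)
  have a0: "0 \<le> a j" for j by (simp add: a_def)
  have suma: "summable a"
    using fin by (intro summable_suminf_not_top) (auto simp: a a0)
  \<comment> \<open>The summand with \<open>e\<close> keeps the weight positive when
    \<open>a j = 0\<close>; over all \<open>j\<close> these summands add up to exactly
    \<open>e\<close>.\<close>
  define w where "w j = a j + e * (1/2) ^ Suc j" for j
  have w0: "0 < w j" for j using a0[of j] e by (simp add: w_def add_nonneg_pos)
  have sumw: "w sums (suminf a + e * 1)"
    unfolding w_def by (intro sums_add sums_mult power_half_series summable_sums suma)
  define W where "W = suminf a + e"
  have W: "suminf w = W" "summable w" using sumw by (auto simp: W_def sums_iff)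
  have W0: "0 < W" unfolding W_def using e by (intro add_nonneg_pos suminf_nonneg suma a0) auto
  have Fp: "(\<integral>\<^sup>+x. F j x epowr p \<partial>M) = ennreal (a j powr p)" for j
  proof -
    have "(\<integral>\<^sup>+x. F j x epowr p \<partial>M) = Lp_norm M p (F j) epowr p"
      using p by (simp add: Lp_norm_def)
    then show ?thesis by (simp add: a a0)
  qed
  have "(\<integral>\<^sup>+x. (\<Sum>j. F j x) epowr p \<partial>M)
      \<le> (\<integral>\<^sup>+x. ennreal (W powr (p - 1)) * (\<Sum>j. ennreal (w j powr (1 - p)) * F j x epowr p) \<partial>M)"
    using suminf_Jensen[OF w0 W(2) p] W(1) by (intro nn_integral_mono) simp
  also have "\<dots> = ennreal (W powr (p - 1)) * (\<Sum>j. ennreal (w j powr (1 - p)) * ennreal (a j powr p))"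
    by (simp add: nn_integral_cmult nn_integral_suminf Fp del: ennreal_suminf_cmult)
  also have "\<dots> \<le> ennreal (W powr (p - 1)) * (\<Sum>j. ennreal (w j))"
  proof (intro mult_left_mono suminf_le allI)
    fix j
    have "w j powr (1 - p) * a j powr p \<le> w j powr (1 - p) * w j powr p"
      using p a0 e by (intro mult_left_mono powr_mono2) (auto simp: w_def)
    also have "\<dots> = w j" using w0[of j] by (simp add: powr_add[symmetric])
    finally show "ennreal (w j powr (1 - p)) * ennreal (a j powr p) \<le> ennreal (w j)"
      by (simp add: ennreal_mult'[symmetric] ennreal_leI)
  qed auto
  also have "(\<Sum>j. ennreal (w j)) = ennreal W"
    by (intro suminf_ennreal_eq less_imp_le w0) (use W in \<open>simp add: sums_iff\<close>)
  also have "ennreal (W powr (p - 1)) * ennreal W = ennreal W epowr p"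
    using W0 by (simp add: ennreal_mult'[symmetric] powr_diff)
  finally have "Lp_norm M p (\<lambda>x. \<Sum>j. F j x) \<le> (ennreal W epowr p) epowr (1 / p)"
    unfolding Lp_norm_def using p by (intro epowr_mono) auto
  also have "\<dots> = ennreal W" using p by simp
  also have "\<dots> = (\<Sum>j. Lp_norm M p (F j)) + ennreal e"
    using suma a0 e by (simp add: W_def a suminf_ennreal2 suminf_nonneg)
  finally show "Lp_norm M p (\<lambda>x. \<Sum>j. F j x) \<le> (\<Sum>j. Lp_norm M p (F j)) + ennreal e" .
qed

lemma Lp_norm_add:
  assumes "f \<in> borel_measurable M" "g \<in> borel_measurable M" and p: "1 \<le> p"
  shows "Lp_norm M p (\<lambda>x. f x + g x) \<le> Lp_norm M p f + Lp_norm M p g"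
proof -
  define F where "F = (\<lambda>j::nat. if j = 0 then f else if j = 1 then g else (\<lambda>_. 0))"
  have s: "(\<Sum>j. h (F j)) = h f + h g" if "h (\<lambda>_. 0) = 0" for h :: "_ \<Rightarrow> ennreal"
    using that by (subst suminf_finite[of "{0, 1::nat}"]) (auto simp: F_def)
  have "Lp_norm M p (\<lambda>x. \<Sum>j. F j x) \<le> (\<Sum>j. Lp_norm M p (F j))"
    using assms by (intro Lp_norm_suminf) (auto simp: F_def)
  then show ?thesis
    using s[of "Lp_norm M p"] s[of "\<lambda>f. f x" for x] by (simp add: Lp_norm_def)
qed

section \<open>Borel regularity of Hausdorff measure\<close>

lemma hausdorff_outer_mono: "A \<subseteq> B \<Longrightarrow> hausdorff_outer d A \<le> hausdorff_outer d B"
  using outer_measure_space_hausdorff[of d]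
  by (auto simp: outer_measure_space_def increasing_def)

lemma hausdorff_outer_empty [simp]: "hausdorff_outer d {} = 0"
  using outer_measure_space_hausdorff[of d] by (auto simp: outer_measure_space_def positive_def)

lemma hausdorff_content_anti_mono:
  "\<delta> \<le> \<delta>' \<Longrightarrow> hausdorff_content d \<delta>' A \<le> hausdorff_content d \<delta> A"
  unfolding hausdorff_content_def by (intro INF_superset_mono) (auto intro: order_trans)

lemma hausdorff_content_le_outer: "0 < \<delta> \<Longrightarrow> hausdorff_content d \<delta> A \<le> hausdorff_outer d A"
  unfolding hausdorff_outer_def by (intro SUP_upper) simp

lemma hausdorff_outer_UN: "hausdorff_outer d (\<Union>i. A i) \<le> (\<Sum>i. hausdorff_outer d (A i))"
  unfolding hausdorff_outer_def[of d "\<Union>i. A i"]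
proof (intro SUP_least order_trans[OF hausdorff_content_subadditive suminf_le])
  show "hausdorff_content d \<delta> (A i) \<le> hausdorff_outer d (A i)" if "\<delta> \<in> {0<..}" for \<delta> i
    using that by (intro hausdorff_content_le_outer) simp
qed auto

lemma hausdorff_outer_Un: "hausdorff_outer d (A \<union> B) \<le> hausdorff_outer d A + hausdorff_outer d B"
proof -
  let ?F = "\<lambda>i::nat. if i = 0 then A else if i = 1 then B else {}"
  have "(\<Sum>i. hausdorff_outer d (?F i)) = (\<Sum>i\<in>{0, 1::nat}. hausdorff_outer d (?F i))"
    by (intro suminf_finite) auto
  moreover have "A \<union> B = (\<Union>i. ?F i)"
    by (auto split: if_splits intro: exI[of _ "Suc 0"])
  ultimately show ?thesis using hausdorff_outer_UN[of d ?F] by simp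
qed

text \<open>A set of diameter at most \<open>e / 2\<close> cannot meet both \<open>A\<close> and
  \<open>B\<close>, so every fine cover of the union splits into a cover of \<open>A\<close> and a
  cover of \<open>B\<close> without a common member.\<close>

lemma hausdorff_content_separated:
  fixes A B :: "'a::metric_space set"
  assumes e: "0 < e" "\<And>x y. x \<in> A \<Longrightarrow> y \<in> B \<Longrightarrow> e \<le> dist x y" and \<delta>: "0 < \<delta>"
  shows "hausdorff_content d \<delta> A + hausdorff_content d \<delta> B \<le> hausdorff_content d (min \<delta> (e / 2)) (A \<union> B)"
  unfolding hausdorff_content_def[of d "min \<delta> (e / 2)"]
proof (rule INF_greatest)
  fix U :: "nat \<Rightarrow> 'a set"
  assume "U \<in> {U. (\<forall>i. bounded (U i) \<and> diameter (U i) \<le> min \<delta> (e / 2)) \<and> A \<union> B \<subseteq> (\<Union>i. U i)}"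
  then have U: "\<And>i. bounded (U i)" "\<And>i. diameter (U i) \<le> \<delta>" "\<And>i. diameter (U i) \<le> e / 2"
      "A \<union> B \<subseteq> (\<Union>i. U i)"
    by auto
  \<comment> \<open>Members that miss \<open>X\<close> become empty instead of being dropped, which
    keeps the indexing; the empty set contributes nothing because
    \<open>0 powr d = 0\<close>.\<close>
  define V where "V X i = (if U i \<inter> X = {} then {} else U i)" for X i
  have le: "hausdorff_content d \<delta> X \<le> (\<Sum>i. ennreal (diameter (V X i) powr d))"
    if X: "X \<subseteq> A \<union> B" for X
    unfolding hausdorff_content_def
  proof (intro INF_lower CollectI conjI allI)
    show "X \<subseteq> (\<Union>i. V X i)"
    proof
      fix x assume "x \<in> X"
      then obtain i where "x \<in> U i" using U(4) X by blast
      then have "x \<in> V X i" using \<open>x \<in> X\<close> by (auto simp: V_def)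
      then show "x \<in> (\<Union>i. V X i)" by blast
    qed
  qed (use U \<delta> in \<open>auto simp: V_def\<close>)
  have disj: "U i \<inter> A = {} \<or> U i \<inter> B = {}" for i
  proof (rule ccontr)
    assume "\<not> ?thesis"
    then obtain x y where "x \<in> A" "y \<in> B" "x \<in> U i" "y \<in> U i" by blast
    then show False
      using e diameter_bounded_bound[OF U(1), of x i y] U(3)[of i] by (smt (verit) field_sum_of_halves)
  qed
  have "hausdorff_content d \<delta> A + hausdorff_content d \<delta> B
      \<le> (\<Sum>i. ennreal (diameter (V A i) powr d)) + (\<Sum>i. ennreal (diameter (V B i) powr d))"
    by (intro add_mono le) auto
  also have "\<dots> = (\<Sum>i. ennreal (diameter (V A i) powr d) + ennreal (diameter (V B i) powr d))"
    by (intro suminf_add) auto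
  also have "\<dots> \<le> (\<Sum>i. ennreal (diameter (U i) powr d))"
    using disj by (intro suminf_le) (auto simp: V_def)
  finally show "hausdorff_content d \<delta> A + hausdorff_content d \<delta> B
      \<le> (\<Sum>i. ennreal (diameter (U i) powr d))" .
qed

lemma hausdorff_outer_separated:
  fixes A B :: "'a::metric_space set"
  assumes e: "0 < e" "\<And>x y. x \<in> A \<Longrightarrow> y \<in> B \<Longrightarrow> e \<le> dist x y"
  shows "hausdorff_outer d A + hausdorff_outer d B \<le> hausdorff_outer d (A \<union> B)"
proof -
  have *: "hausdorff_content d \<delta> A + hausdorff_content d \<delta>' B \<le> hausdorff_outer d (A \<union> B)"
    if "0 < \<delta>" "0 < \<delta>'" for \<delta> \<delta>'
  proof -
    have "hausdorff_content d \<delta> A + hausdorff_content d \<delta>' B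
        \<le> hausdorff_content d (min \<delta> \<delta>') A + hausdorff_content d (min \<delta> \<delta>') B"
      by (intro add_mono hausdorff_content_anti_mono) auto
    also have "\<dots> \<le> hausdorff_content d (min (min \<delta> \<delta>') (e / 2)) (A \<union> B)"
      using that e by (intro hausdorff_content_separated) auto
    also have "\<dots> \<le> hausdorff_outer d (A \<union> B)"
      using that e by (intro hausdorff_content_le_outer) auto
    finally show ?thesis .
  qed
  have "hausdorff_content d \<delta> A + hausdorff_outer d B \<le> hausdorff_outer d (A \<union> B)" if "0 < \<delta>" for \<delta>
    unfolding hausdorff_outer_def[of d B]
    using that by (subst ennreal_SUP_add_right) (auto intro!: SUP_least *)
  then show ?thesis
    unfolding hausdorff_outer_def[of d A]
    by (subst ennreal_SUP_add_left[symmetric]) (auto intro!: SUP_least)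
qed

text \<open>The gap may depend on \<open>n\<close>: the sets are added one at a time, each at a
  positive distance from the finitely many before it.\<close>

lemma hausdorff_outer_UN_separated:
  fixes R :: "nat \<Rightarrow> 'a::metric_space set"
  assumes "\<And>n. \<exists>e>0. \<forall>k<n. \<forall>x\<in>R k. \<forall>y\<in>R n. e \<le> dist x y"
  shows "(\<Sum>k<n. hausdorff_outer d (R k)) \<le> hausdorff_outer d (\<Union>k<n. R k)"
proof (induction n)
  case (Suc n)
  obtain e where e: "e > 0" "\<forall>k<n. \<forall>x\<in>R k. \<forall>y\<in>R n. e \<le> dist x y" using assms by blast
  have "(\<Sum>k<Suc n. hausdorff_outer d (R k)) \<le> hausdorff_outer d (\<Union>k<n. R k) + hausdorff_outer d (R n)"
    using Suc by (simp add: add_right_mono)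
  also have "\<dots> \<le> hausdorff_outer d ((\<Union>k<n. R k) \<union> R n)"
    using e by (intro hausdorff_outer_separated) auto
  also have "(\<Union>k<n. R k) \<union> R n = (\<Union>k<Suc n. R k)" by (auto simp: less_Suc_eq)
  finally show ?case .
qed simp

text \<open>Caratheodory's argument: the parts of \<open>A\<close> at distance between \<open>1 / (n + 2)\<close> and \<open>1 / (n + 1)\<close>
  from the closed set have summable outer measures, because every other one is separated.\<close>

lemma hausdorff_outer_closed:
  fixes C :: "'a::metric_space set"
  assumes "closed C"
  shows "hausdorff_outer d (A \<inter> C) + hausdorff_outer d (A - C) \<le> hausdorff_outer d A"
proof (cases "C = {} \<or> hausdorff_outer d A = \<infinity>")
  case False
  then have C: "C \<noteq> {}" and fin: "hausdorff_outer d A \<noteq> \<infinity>" by auto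
  let ?H = "hausdorff_outer d :: 'a set \<Rightarrow> ennreal"
  define D where "D n = {x \<in> A. 1 / real (Suc n) \<le> infdist x C}" for n
  define R where "R n = {x \<in> A. 1 / real (Suc (Suc n)) \<le> infdist x C \<and> infdist x C < 1 / real (Suc n)}" for n
  have infdist_gap: "a - b \<le> dist x y" if "a \<le> infdist x C" "infdist y C \<le> b" for a b x y
    using infdist_triangle[of x C y] that by linarith
  \<comment> \<open>Between two rings whose indices have the same parity a whole ring is skipped,
    and this gives the gap. The shift by 1/2 keeps the denominator positive when
    \<open>n = 0\<close> and \<open>i = 0\<close>: there the separation is vacuous, but the gap
    still has to be a positive number.\<close>
  have sepR: "\<exists>e>0. \<forall>k<n. \<forall>x\<in>R (2 * k + i). \<forall>y\<in>R (2 * n + i). e \<le> dist x y" for n i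
  proof (intro exI conjI allI impI ballI)
    show "0 < 1 / (real (2 * n + i) + 1/2) - 1 / real (2 * n + i + 1)"
      unfolding diff_gt_0_iff_gt by (intro divide_strict_left_mono mult_pos_pos) auto
    fix k x y assume k: "k < n" and x: "x \<in> R (2 * k + i)" and y: "y \<in> R (2 * n + i)"
    have "1 / (real (2 * n + i) + 1/2) \<le> 1 / real (Suc (Suc (2 * k + i)))"
      using k by (intro divide_left_mono) auto
    also have "\<dots> \<le> infdist x C" using x by (simp add: R_def)
    finally have "1 / (real (2 * n + i) + 1/2) \<le> infdist x C" .
    moreover have "infdist y C \<le> 1 / real (2 * n + i + 1)" using y by (simp add: R_def less_imp_le)
    ultimately show "1 / (real (2 * n + i) + 1/2) - 1 / real (2 * n + i + 1) \<le> dist x y"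
      by (rule infdist_gap)
  qed
  have half: "(\<Sum>k<n. ?H (R (2 * k + i))) \<le> ?H A" for n i
  proof -
    have "(\<Sum>k<n. ?H (R (2 * k + i))) \<le> ?H (\<Union>k<n. R (2 * k + i))"
      by (rule hausdorff_outer_UN_separated[OF sepR])
    also have "\<dots> \<le> ?H A" by (intro hausdorff_outer_mono) (auto simp: R_def)
    finally show ?thesis .
  qed
  have eo: "(\<Sum>k<2 * n. f k) = (\<Sum>k<n. f (2 * k + 0)) + (\<Sum>k<n. f (2 * k + 1))" for f :: "nat \<Rightarrow> ennreal" and n
    by (induction n) (simp_all add: algebra_simps)
  have "(\<Sum>k. ?H (R k)) \<le> ?H A + ?H A"
  proof (rule suminf_le_const)
    fix n
    have "(\<Sum>k<n. ?H (R k)) \<le> (\<Sum>k<2 * n. ?H (R k))" by (intro sum_mono2) auto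
    also have "\<dots> \<le> ?H A + ?H A" unfolding eo by (intro add_mono half)
    finally show "(\<Sum>k<n. ?H (R k)) \<le> ?H A + ?H A" .
  qed simp
  then have sfin: "(\<Sum>k. ?H (R k)) < top"
    using fin by (simp add: less_top[symmetric] top_unique) (metis ennreal_add_eq_top neq_top_trans)
  define r where "r k = enn2real (?H (R k))" for k
  have r: "?H (R k) = ennreal (r k)" for k
    using ennreal_suminf_lessD[OF sfin, of k] by (simp add: r_def)
  have r0: "0 \<le> r k" for k by (simp add: r_def)
  have sumr: "summable r" using sfin by (intro summable_suminf_not_top) (auto simp: r r0)
  show ?thesis
  proof (rule ennreal_le_epsilon)
    fix \<epsilon> :: real assume "0 < \<epsilon>"
    then obtain n where n: "norm (\<Sum>i. r (i + n)) < \<epsilon>"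
      using suminf_exist_split[OF _ sumr, of \<epsilon>] by auto
    \<comment> \<open>A point outside the closed set has positive distance from it; if that distance
      is too small for \<open>D n\<close>, the point falls into a ring of index at least
      \<open>n\<close>, and the tail of the ring measures is below
      \<open>\<epsilon>\<close>.\<close>
    have "A - C \<subseteq> D n \<union> (\<Union>i. R (i + n))"
    proof
      fix x assume x: "x \<in> A - C"
      then have pos: "0 < infdist x C"
        using assms C infdist_nonneg[of x C] in_closed_iff_infdist_zero[of C x] by auto
      show "x \<in> D n \<union> (\<Union>i. R (i + n))"
      proof (cases "x \<in> D n")
        case False
        then have lt: "infdist x C < 1 / real (Suc n)" using x by (auto simp: D_def)
        define m where "m = (LEAST m. 1 / real (Suc m) \<le> infdist x C)"
        obtain m0 where "inverse (real (Suc m0)) < infdist x C" using reals_Archimedean[OF pos] by (rule exE)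
        then have m: "1 / real (Suc m) \<le> infdist x C"
          using LeastI[of "\<lambda>m. 1 / real (Suc m) \<le> infdist x C" m0]
          unfolding m_def inverse_eq_divide by auto
        have "n < m"
        proof (rule ccontr)
          assume "\<not> n < m"
          then have "1 / real (Suc n) \<le> 1 / real (Suc m)" by (intro divide_left_mono) auto
          then show False using m lt by linarith
        qed
        then obtain l where l: "m = Suc l" "n \<le> l" by (cases m) auto
        then have "\<not> 1 / real (Suc l) \<le> infdist x C"
          using not_less_Least[of l "\<lambda>m. 1 / real (Suc m) \<le> infdist x C"] by (simp add: m_def)
        then have "x \<in> R ((l - n) + n)" using x m l by (auto simp: R_def)
        then show ?thesis by blast
      qed simp
    qed
    then have "?H (A - C) \<le> ?H (D n \<union> (\<Union>i. R (i + n)))" by (rule hausdorff_outer_mono)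
    also have "\<dots> \<le> ?H (D n) + ?H (\<Union>i. R (i + n))" by (rule hausdorff_outer_Un)
    also have "\<dots> \<le> ?H (D n) + (\<Sum>i. ?H (R (i + n)))" by (intro add_left_mono hausdorff_outer_UN)
    also have "(\<Sum>i. ?H (R (i + n))) = ennreal (\<Sum>i. r (i + n))"
      unfolding r using sumr by (intro suminf_ennreal2 r0) (simp add: summable_iff_shift)
    also have "\<dots> \<le> ennreal \<epsilon>" using n by (intro ennreal_leI) auto
    finally have 1: "?H (A - C) \<le> ?H (D n) + ennreal \<epsilon>" by (simp add: add_left_mono)
    have "?H (A \<inter> C) + ?H (D n) \<le> ?H ((A \<inter> C) \<union> D n)"
    proof (rule hausdorff_outer_separated[where e="1 / real (Suc n)"])
      fix x y assume "x \<in> A \<inter> C" "y \<in> D n"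
      then show "1 / real (Suc n) \<le> dist x y"
        using infdist_gap[of "1 / real (Suc n)" y x 0] by (auto simp: D_def dist_commute)
    qed simp
    also have "\<dots> \<le> ?H A" by (intro hausdorff_outer_mono) (auto simp: D_def)
    finally have 2: "?H (A \<inter> C) + ?H (D n) \<le> ?H A" .
    have "?H (A \<inter> C) + ?H (A - C) \<le> ?H (A \<inter> C) + ?H (D n) + ennreal \<epsilon>"
      using add_left_mono[OF 1, of "?H (A \<inter> C)"] by (simp add: add.assoc)
    also have "\<dots> \<le> ?H A + ennreal \<epsilon>" using 2 by (intro add_right_mono)
    finally show "?H (A \<inter> C) + ?H (A - C) \<le> ?H A + ennreal \<epsilon>" .
  qed
qed (auto simp: top_unique)

lemma sets_borel_le_hausdorff: "sets borel \<subseteq> sets (hausdorff_measure d :: 'a::metric_space measure)"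
proof -
  have "C \<in> sets (hausdorff_measure d)" if "closed C" for C :: "'a set"
    unfolding sets_hausdorff_measure
  proof (subst algebra.lambda_system_eq[OF algebra_Pow[of UNIV], unfolded Pow_UNIV], safe)
    fix A :: "'a set"
    show "hausdorff_outer d (A \<inter> C) + hausdorff_outer d (A - C) = hausdorff_outer d A"
      using hausdorff_outer_closed[OF that, of d A] hausdorff_outer_Un[of d "A \<inter> C" "A - C"]
      by (simp add: Int_Diff_Un)
  qed auto
  then show ?thesis
    unfolding borel_eq_closed
    using sets.sigma_sets_subset[of "{S. closed S}" "hausdorff_measure d :: 'a measure"]
    by (simp add: subset_eq)
qed

text \<open>Passing to closures does not change diameters, so near-optimal covers may be taken
  closed. Intersecting their unions over the scales \<open>1 / Suc m\<close> gives a Borel set that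
  inherits all of these covers.\<close>

lemma hausdorff_borel_hull:
  fixes A :: "'a::metric_space set"
  shows "\<exists>B\<in>sets borel. A \<subseteq> B \<and> hausdorff_outer d B \<le> hausdorff_outer d A"
proof (cases "hausdorff_outer d A = \<infinity>")
  case True
  then show ?thesis by (intro bexI[of _ UNIV]) auto
next
  case False
  let ?\<delta> = "\<lambda>m::nat. 1 / real (Suc m)"
  have "\<exists>U. (\<forall>i::nat. bounded (U i) \<and> diameter (U i) \<le> ?\<delta> m) \<and> A \<subseteq> (\<Union>i. U i)
      \<and> (\<Sum>i. ennreal (diameter (U i) powr d)) < hausdorff_outer d A + ennreal (?\<delta> m)" for m
  proof -
    have "hausdorff_content d (?\<delta> m) A < hausdorff_outer d A + ennreal (?\<delta> m)"
    proof (rule le_less_trans[OF hausdorff_content_le_outer])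
      show "hausdorff_outer d A < hausdorff_outer d A + ennreal (?\<delta> m)"
        using False ennreal_add_left_cancel_less[of "hausdorff_outer d A" 0 "ennreal (?\<delta> m)"]
        by simp
    qed simp
    then show ?thesis
      unfolding hausdorff_content_def INF_less_iff by auto
  qed
  then obtain U where U: "\<And>m i. bounded (U m i)" "\<And>m i. diameter (U m i) \<le> ?\<delta> m"
      "\<And>m. A \<subseteq> (\<Union>i::nat. U m i)"
      "\<And>m. (\<Sum>i. ennreal (diameter (U m i) powr d)) < hausdorff_outer d A + ennreal (?\<delta> m)"
    by metis
  define B where "B = (\<Inter>m. \<Union>i. closure (U m i))"
  have "A \<subseteq> B" unfolding B_def using U(3) closure_subset by blast
  moreover have "B \<in> sets borel" unfolding B_def by (intro sets.countable_INT sets.countable_UN) auto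
  moreover have cB: "hausdorff_content d (?\<delta> m) B \<le> hausdorff_outer d A + ennreal (?\<delta> m)" for m
  proof -
    have "hausdorff_content d (?\<delta> m) B \<le> (\<Sum>i. ennreal (diameter (closure (U m i)) powr d))"
      unfolding hausdorff_content_def using U(1,2)
      by (intro INF_lower) (auto simp: B_def diameter_closure)
    then show ?thesis using U(4)[of m] U(1) by (simp add: diameter_closure)
  qed
  have "hausdorff_outer d B \<le> hausdorff_outer d A"
    unfolding hausdorff_outer_def[of d B]
  proof (rule SUP_least, rule ennreal_le_epsilon)
    fix \<delta> e :: real assume "\<delta> \<in> {0<..}" "0 < e"
    then have "0 < min \<delta> e" by simp
    from reals_Archimedean[OF this] obtain m where "inverse (real (Suc m)) < min \<delta> e" ..
    then have m: "?\<delta> m < min \<delta> e" by (simp only: inverse_eq_divide)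
    have "hausdorff_content d \<delta> B \<le> hausdorff_content d (?\<delta> m) B"
      using m by (intro hausdorff_content_anti_mono) linarith
    also have "\<dots> \<le> hausdorff_outer d A + ennreal (?\<delta> m)" by (rule cB)
    also have "\<dots> \<le> hausdorff_outer d A + ennreal e"
      using m by (intro add_left_mono ennreal_leI) linarith
    finally show "hausdorff_content d \<delta> B \<le> hausdorff_outer d A + ennreal e" .
  qed
  ultimately show ?thesis by (intro bexI[of _ B] conjI)
qed

section \<open>Polynomials in coordinates adapted to a cube\<close>

lemma mem_cube_iff: "y \<in> cube x r \<longleftrightarrow> (\<forall>i. \<bar>y $ i - x $ i\<bar> \<le> r)" for x y :: "real^'n::finite"
proof -
  have "infnorm (y - x) \<le> r \<longleftrightarrow> (\<forall>b\<in>Basis. \<bar>(y - x) \<bullet> b\<bar> \<le> r)"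
    unfolding infnorm_Max by (subst Max_le_iff) auto
  then show ?thesis
    by (auto simp: cube_def Basis_vec_def inner_axis)
qed

lemma closed_cube: "closed (cube x r)" for x :: "real^'n::finite"
proof -
  have "cube x r = (\<Inter>i. {y. \<bar>y $ i - x $ i\<bar> \<le> r})"
    by (auto simp: mem_cube_iff)
  then show ?thesis
    by (auto intro!: closed_Collect_le continuous_intros)
qed

lemma cube_borel [measurable]: "cube x r \<in> sets borel" for x :: "real^'n::finite"
  using closed_cube by (rule borel_closed)

lemma cube_self: "0 \<le> r \<Longrightarrow> x \<in> cube x r" for x :: "real^'n::finite"
  by (simp add: mem_cube_iff)

lemma cube_commute: "y \<in> cube x r \<longleftrightarrow> x \<in> cube y r" for x :: "real^'n::finite"
  by (simp add: mem_cube_iff abs_minus_commute)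

lemma cube_subset:
  fixes x y :: "real^'n::finite"
  assumes "y \<in> cube x a" "a + s \<le> r"
  shows "cube y s \<subseteq> cube x r"
proof
  fix z assume "z \<in> cube y s"
  then have "\<bar>z $ i - x $ i\<bar> \<le> r" for i
    using assms by (auto simp: mem_cube_iff dest!: spec[of _ i])
  then show "z \<in> cube x r" by (simp add: mem_cube_iff)
qed

definition monom_fun :: "('n \<Rightarrow> nat) \<Rightarrow> real^'n::finite \<Rightarrow> real" where
  "monom_fun a z = (\<Prod>i\<in>UNIV. (z $ i) ^ a i)"

definition midx :: "nat \<Rightarrow> ('n::finite \<Rightarrow> nat) set" where
  "midx m = {a. (\<Sum>i\<in>UNIV. a i) \<le> m}"

text \<open>Natural degrees suffice for the main estimates: \<open>k > \<alpha> > 0\<close> makes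
  \<open>k - 1\<close> nonnegative.\<close>

definition poly_eval :: "nat \<Rightarrow> (('n \<Rightarrow> nat) \<Rightarrow> real) \<Rightarrow> real^'n::finite \<Rightarrow> real" where
  "poly_eval m c z = (\<Sum>a\<in>midx m. c a * monom_fun a z)"

text \<open>The finite-dimensional norm through which suprema, averages and Taylor remainders of
  polynomials are compared; it is meant for coefficients in the coordinates
  \<open>rescale x r\<close> of a cube.\<close>

definition coeff_norm :: "nat \<Rightarrow> (('n::finite \<Rightarrow> nat) \<Rightarrow> real) \<Rightarrow> real" where
  "coeff_norm m c = (\<Sum>a\<in>midx m. \<bar>c a\<bar>)"

lemma finite_midx [simp]: "finite (midx m :: ('n::finite \<Rightarrow> nat) set)"
proof (rule finite_subset)
  show "midx m \<subseteq> PiE UNIV (\<lambda>_::'n. {..m})"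
    by (auto simp: midx_def PiE_def extensional_def) (metis finite member_le_sum order_trans UNIV_I zero_le)
qed (auto intro: finite_PiE)

lemma polys_eq_range: "polys (int m) = range (poly_eval m)"
  unfolding polys_def poly_eval_def midx_def monom_fun_def by (auto simp flip: of_nat_sum)

lemma coeff_norm_nonneg: "0 \<le> coeff_norm m c"
  unfolding coeff_norm_def by (intro sum_nonneg) auto

lemma monom_fun_mult: "monom_fun a z * monom_fun b z = monom_fun (\<lambda>i. a i + b i) z"
  by (simp add: monom_fun_def power_add prod.distrib)

lemma abs_monom_fun_le:
  assumes "\<And>i. \<bar>z $ i\<bar> \<le> t" "0 \<le> t" shows "\<bar>monom_fun a z\<bar> \<le> t ^ (\<Sum>i\<in>UNIV. a i)"
  unfolding monom_fun_def abs_prod power_abs power_sum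
  using assms by (intro prod_mono) (auto intro: power_mono)

lemma polys_mono: "k \<le> k' \<Longrightarrow> polys k \<subseteq> polys k'"
proof
  fix P :: "real^'n \<Rightarrow> real" assume k: "k \<le> k'" and "P \<in> polys k"
  then obtain c :: "('n \<Rightarrow> nat) \<Rightarrow> real" where P: "P = (\<lambda>x. \<Sum>a\<in>{a. int (\<Sum>i\<in>UNIV. a i) \<le> k}. c a * (\<Prod>i\<in>UNIV. (x $ i) ^ a i))"
    unfolding polys_def by auto
  have fin: "finite {a :: 'n \<Rightarrow> nat. int (\<Sum>i\<in>UNIV. a i) \<le> k'}"
    by (rule finite_subset[OF _ finite_midx[of "nat k'"]]) (unfold midx_def, intro Collect_mono impI, linarith)
  have "P = (\<lambda>x. \<Sum>a\<in>{a. int (\<Sum>i\<in>UNIV. a i) \<le> k'}.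
      (if int (\<Sum>i\<in>UNIV. a i) \<le> k then c a else 0) * (\<Prod>i\<in>UNIV. (x $ i) ^ a i))"
    unfolding P using k by (intro ext sum.mono_neutral_cong_left fin) auto
  then show "P \<in> polys k'" unfolding polys_def by (intro CollectI exI)
qed

lemma zero_in_polys: "(\<lambda>_. 0) \<in> polys k"
  unfolding polys_def by (auto intro!: exI[of _ "\<lambda>_. 0"])

lemma polys_add:
  assumes "P \<in> polys k" "Q \<in> polys k" shows "(\<lambda>x. P x + Q x) \<in> polys k"
proof -
  obtain c c' where "P = (\<lambda>x. \<Sum>a\<in>{a. int (\<Sum>i\<in>UNIV. a i) \<le> k}. c a * (\<Prod>i\<in>UNIV. (x $ i) ^ a i))"
    "Q = (\<lambda>x. \<Sum>a\<in>{a. int (\<Sum>i\<in>UNIV. a i) \<le> k}. c' a * (\<Prod>i\<in>UNIV. (x $ i) ^ a i))"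
    using assms unfolding polys_def by auto
  then show ?thesis unfolding polys_def
    by (auto intro!: exI[of _ "\<lambda>a. c a + c' a"] simp: sum.distrib distrib_right)
qed

lemma polys_cmult:
  assumes "P \<in> polys k" shows "(\<lambda>x. s * P x) \<in> polys k"
proof -
  obtain c where "P = (\<lambda>x. \<Sum>a\<in>{a. int (\<Sum>i\<in>UNIV. a i) \<le> k}. c a * (\<Prod>i\<in>UNIV. (x $ i) ^ a i))"
    using assms unfolding polys_def by auto
  then show ?thesis unfolding polys_def
    by (auto intro!: exI[of _ "\<lambda>a. s * c a"] simp: sum_distrib_left mult.assoc)
qed

lemma polys_diff: "P \<in> polys k \<Longrightarrow> Q \<in> polys k \<Longrightarrow> (\<lambda>x. P x - Q x) \<in> polys k"
  using polys_add[of P k "\<lambda>x. -1 * Q x"] polys_cmult[of Q k "-1"] by simp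

lemma polys_sum: "(\<And>i. i \<in> I \<Longrightarrow> P i \<in> polys k) \<Longrightarrow> (\<lambda>x. \<Sum>i\<in>I. P i x) \<in> polys k"
  by (induction I rule: infinite_finite_induct) (auto intro: zero_in_polys polys_add)

lemma monom_fun_in_polys:
  assumes "(\<Sum>i\<in>UNIV. a i) \<le> m" shows "monom_fun a \<in> polys (int m)"
proof -
  have "monom_fun a = poly_eval m (\<lambda>b. if b = a then 1 else 0)"
  proof
    have "a \<in> midx m" using assms by (simp add: midx_def)
    then show "monom_fun a z = poly_eval m (\<lambda>b. if b = a then 1 else 0) z" for z
      by (simp add: poly_eval_def if_distrib[of "\<lambda>c. c * _"] cong: if_cong)
  qed
  then show ?thesis by (simp add: polys_eq_range)
qed

lemma polys_mult:
  fixes P Q :: "real^'n::finite \<Rightarrow> real"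
  assumes "P \<in> polys (int m)" "Q \<in> polys (int m')"
  shows "(\<lambda>x. P x * Q x) \<in> polys (int (m + m'))"
proof -
  obtain c c' where P: "P = poly_eval m c" "Q = poly_eval m' c'"
    using assms by (auto simp: polys_eq_range)
  have "(\<lambda>x. P x * Q x) = (\<lambda>x. \<Sum>a\<in>midx m. \<Sum>b\<in>midx m'. c a * c' b * monom_fun (\<lambda>i. a i + b i) x)"
    unfolding P poly_eval_def sum_product
    by (simp add: monom_fun_mult[symmetric] mult_ac)
  also have "\<dots> \<in> polys (int (m + m'))"
    by (intro polys_sum polys_cmult monom_fun_in_polys) (auto simp: midx_def sum.distrib intro: add_mono)
  finally show ?thesis .
qed

lemma const_in_polys: "(\<lambda>_. b) \<in> polys (int m)"
  using polys_cmult[OF monom_fun_in_polys[of "\<lambda>_. 0" m], of b] by (simp add: monom_fun_def)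

text \<open>Substituting affine functions for the coordinates does not raise the degree, since each
  monomial becomes a product of affine factors. Hence coefficients may be taken in the coordinates
  of any cube.\<close>

lemma polys_affine:
  fixes P :: "real^'n::finite \<Rightarrow> real"
  assumes "P \<in> polys (int m)"
  shows "(\<lambda>z. P (b + s *\<^sub>R z)) \<in> polys (int m)"
proof -
  have lin: "(\<lambda>z. b $ i + s * z $ i) \<in> polys (int 1)" for i
  proof -
    have "(\<lambda>z. z $ i) = monom_fun (\<lambda>j. if j = i then 1 else 0)"
      by (auto simp: monom_fun_def fun_eq_iff if_distrib[of "power _"] prod.delta cong: if_cong)
    then have "(\<lambda>z. z $ i) \<in> polys (int 1)"
      using monom_fun_in_polys[of "\<lambda>j. if j = i then 1 else 0" 1] by simp
    from polys_add[OF const_in_polys polys_cmult[OF this]] show ?thesis .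
  qed
  have pow: "(\<lambda>z. (b $ i + s * z $ i) ^ k) \<in> polys (int k)" for i k
    by (induction k) (use const_in_polys[of 1 0] polys_mult[OF lin] in auto)
  have "(\<lambda>z. \<Prod>i\<in>I. (b $ i + s * z $ i) ^ a i) \<in> polys (int (\<Sum>i\<in>I. a i))" if "finite I" for a I
    using that
  proof (induction I)
    case (insert k I)
    then show ?case using polys_mult[OF pow[of k "a k"] insert.IH] by simp
  qed (use const_in_polys[of 1 0] in simp)
  then have mon: "(\<lambda>z. monom_fun a (b + s *\<^sub>R z)) \<in> polys (int m)" if "a \<in> midx m" for a
    using that polys_mono[of "int (\<Sum>i\<in>UNIV. a i)" "int m"]
    by (auto simp: monom_fun_def midx_def simp flip: of_nat_sum)
  obtain c where c: "P = poly_eval m c" using assms by (auto simp: polys_eq_range)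
  show ?thesis unfolding c poly_eval_def
    by (rule polys_sum, rule polys_cmult, rule mon)
qed

text \<open>Normalised coordinates in which \<open>cube x r\<close> is the unit cube, so that
  constants do not depend on the cube.\<close>

definition rescale :: "real^'n \<Rightarrow> real \<Rightarrow> real^'n \<Rightarrow> real^'n::finite" where
  "rescale x r y = (1 / r) *\<^sub>R (y - x)"

lemma rescale_nth [simp]: "rescale x r y $ i = (y $ i - x $ i) / r"
  by (simp add: rescale_def)

lemma polys_coeffs:
  assumes "P \<in> polys (int m)" "r \<noteq> 0"
  obtains c where "\<And>y. P y = poly_eval m c (rescale x r y)"
proof -
  obtain c where c: "(\<lambda>z. P (x + r *\<^sub>R z)) = poly_eval m c"
    using polys_affine[OF assms(1)] by (auto simp: polys_eq_range)
  have "P y = poly_eval m c (rescale x r y)" for y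
    using fun_cong[OF c, of "rescale x r y"] assms(2) by (simp add: rescale_def)
  then show ?thesis by (rule that)
qed

lemma poly_eval_rescale_in_polys: "(\<lambda>y. poly_eval m c (rescale x r y)) \<in> polys (int m)"
proof -
  have "rescale x r y = (- (1 / r) *\<^sub>R x) + (1 / r) *\<^sub>R y" for y
    by (simp add: rescale_def algebra_simps)
  then show ?thesis
    using polys_affine[of "poly_eval m c" m "- (1 / r) *\<^sub>R x" "1 / r"] by (simp add: polys_eq_range)
qed

lemma continuous_polys:
  fixes P :: "real^'n::finite \<Rightarrow> real"
  assumes "P \<in> polys k" shows "continuous_on UNIV P"
proof -
  obtain c where "P = (\<lambda>x. \<Sum>a\<in>{a. int (\<Sum>i\<in>UNIV. a i) \<le> k}. c a * (\<Prod>i\<in>UNIV. (x $ i) ^ a i))"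
    using assms unfolding polys_def by auto
  then show ?thesis by (auto intro!: continuous_intros)
qed

lemma borel_measurable_polys: "P \<in> polys k \<Longrightarrow> P \<in> borel_measurable borel"
  by (intro borel_measurable_continuous_onI continuous_polys)

lemma abs_poly_eval_le:
  assumes "\<And>i. \<bar>z $ i\<bar> \<le> 1" shows "\<bar>poly_eval m c z\<bar> \<le> coeff_norm m c"
  unfolding poly_eval_def coeff_norm_def
proof (intro order_trans[OF sum_abs] sum_mono)
  fix a
  have "\<bar>monom_fun a z\<bar> \<le> 1" using abs_monom_fun_le[of z 1 a] assms by simp
  then show "\<bar>c a * monom_fun a z\<bar> \<le> \<bar>c a\<bar>"
    by (simp add: abs_mult mult_left_le)
qed

section \<open>First-order Taylor estimates for polynomials on the unit cube\<close>

lemma power_taylor: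
  fixes x y h :: real
  assumes "\<bar>x\<bar> \<le> 1" "\<bar>y\<bar> \<le> 1" "\<bar>x - y\<bar> \<le> h"
  shows "\<bar>x ^ m - y ^ m - real m * y ^ (m - 1) * (x - y)\<bar> \<le> (real m)\<^sup>2 * h\<^sup>2"
proof (induction m)
  case (Suc m)
  have h2: "(x - y)\<^sup>2 \<le> h\<^sup>2" using assms(3) by (metis abs_le_square_iff abs_of_nonneg abs_ge_zero order_trans)
  \<comment> \<open>The remainder for \<open>Suc m\<close> is \<open>x\<close> times the remainder
    for \<open>m\<close> plus a square with a factor bounded by \<open>m\<close>, so the constant
    \<open>m^2\<close> survives because \<open>m^2 + m \<le> (m + 1)^2\<close>.\<close>
  have eq: "x ^ Suc m - y ^ Suc m - real (Suc m) * y ^ (Suc m - 1) * (x - y)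
      = x * (x ^ m - y ^ m - real m * y ^ (m - 1) * (x - y)) + real m * y ^ (m - 1) * (x - y)\<^sup>2"
    by (cases m) (auto simp: algebra_simps power2_eq_square)
  have "\<bar>x * (x ^ m - y ^ m - real m * y ^ (m - 1) * (x - y))\<bar> \<le> 1 * ((real m)\<^sup>2 * h\<^sup>2)"
    unfolding abs_mult[of x] using assms Suc by (intro mult_mono) auto
  moreover have "\<bar>real m * y ^ (m - 1) * (x - y)\<^sup>2\<bar> \<le> real m * 1 * h\<^sup>2"
    unfolding abs_mult using assms h2 by (intro mult_mono) (auto simp: power_abs power_le_one)
  ultimately have "\<bar>x ^ Suc m - y ^ Suc m - real (Suc m) * y ^ (Suc m - 1) * (x - y)\<bar>
      \<le> (real m)\<^sup>2 * h\<^sup>2 + real m * h\<^sup>2"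
    unfolding eq by (intro order_trans[OF abs_triangle_ineq]) simp
  also have "\<dots> \<le> (real (Suc m))\<^sup>2 * h\<^sup>2"
    unfolding distrib_right[symmetric] by (intro mult_right_mono) (auto simp: power2_eq_square algebra_simps)
  finally show ?case .
qed simp

lemma prod_power_diff:
  fixes z w :: "'i \<Rightarrow> real"
  assumes "\<And>i. \<bar>z i\<bar> \<le> 1" "\<And>i. \<bar>w i\<bar> \<le> 1" "\<And>i. \<bar>z i - w i\<bar> \<le> h"
  shows "\<bar>(\<Prod>i\<in>I. z i ^ a i) - (\<Prod>i\<in>I. w i ^ a i)\<bar> \<le> real (\<Sum>i\<in>I. a i) * h"
proof -
  have "\<bar>(\<Prod>i\<in>I. z i ^ a i) - (\<Prod>i\<in>I. w i ^ a i)\<bar> \<le> (\<Sum>i\<in>I. \<bar>z i ^ a i - w i ^ a i\<bar>)"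
    using norm_prod_diff[of I "\<lambda>i. z i ^ a i" "\<lambda>i. w i ^ a i"] assms by (simp add: power_abs power_le_one)
  also have "\<dots> \<le> (\<Sum>i\<in>I. real (a i) * h)"
  proof (intro sum_mono)
    fix i
    have "\<bar>z i ^ a i - w i ^ a i\<bar> \<le> real (a i) * \<bar>z i - w i\<bar>"
      using norm_power_diff[of "z i" "w i" "a i"] assms by simp
    also have "\<dots> \<le> real (a i) * h" using assms by (intro mult_left_mono) auto
    finally show "\<bar>z i ^ a i - w i ^ a i\<bar> \<le> real (a i) * h" .
  qed
  finally show ?thesis by (simp add: sum_distrib_right)
qed

text \<open>Induction on the factors by the product rule: the new remainder consists of the product
  of two increments and of the two old remainders, and
  \<open>A * B + A^2 + B^2 \<le> (A + B)^2\<close>. Truncation in \<open>a i - 1\<close> is harmless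
  because of the factor \<open>real (a i)\<close>.\<close>

lemma prod_power_taylor:
  fixes z w :: "'i \<Rightarrow> real"
  assumes zw: "\<And>i. \<bar>z i\<bar> \<le> 1" "\<And>i. \<bar>w i\<bar> \<le> 1" "\<And>i. \<bar>z i - w i\<bar> \<le> h" and "finite I"
  shows "\<bar>(\<Prod>i\<in>I. z i ^ a i) - (\<Prod>i\<in>I. w i ^ a i)
      - (\<Sum>i\<in>I. real (a i) * (\<Prod>j\<in>I. w j ^ (a(i := a i - 1)) j) * (z i - w i))\<bar>
      \<le> (real (\<Sum>i\<in>I. a i))\<^sup>2 * h\<^sup>2"
  using \<open>finite I\<close>
proof (induction I)
  case (insert k I)
  let ?u = "z k ^ a k" and ?ub = "w k ^ a k" and ?l = "real (a k) * w k ^ (a k - 1) * (z k - w k)"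
  let ?v = "\<Prod>i\<in>I. z i ^ a i" and ?vb = "\<Prod>i\<in>I. w i ^ a i"
  let ?L = "\<Sum>i\<in>I. real (a i) * (\<Prod>j\<in>I. w j ^ (a(i := a i - 1)) j) * (z i - w i)"
  let ?A = "real (\<Sum>i\<in>I. a i)" and ?B = "real (a k)"
  have p1: "(\<Prod>j\<in>insert k I. w j ^ (a(k := a k - 1)) j) = w k ^ (a k - 1) * ?vb"
    unfolding prod.insert[OF insert.hyps] using insert.hyps
    by (intro arg_cong2[where f="(*)"] prod.cong refl) (simp, metis fun_upd_other)
  have p2: "(\<Prod>j\<in>insert k I. w j ^ (a(i := a i - 1)) j) = ?ub * (\<Prod>j\<in>I. w j ^ (a(i := a i - 1)) j)"
    if "i \<in> I" for i
    using insert.hyps that by (subst prod.insert) auto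
  have "(\<Sum>i\<in>insert k I. real (a i) * (\<Prod>j\<in>insert k I. w j ^ (a(i := a i - 1)) j) * (z i - w i))
      = real (a k) * (w k ^ (a k - 1) * ?vb) * (z k - w k)
        + (\<Sum>i\<in>I. real (a i) * (?ub * (\<Prod>j\<in>I. w j ^ (a(i := a i - 1)) j)) * (z i - w i))"
    unfolding sum.insert[OF insert.hyps] p1 by (intro arg_cong2[where f="(+)"] sum.cong refl) (simp only: p2)
  also have "\<dots> = ?l * ?vb + ?ub * ?L"
    by (simp add: sum_distrib_left mult_ac)
  finally have S: "(\<Sum>i\<in>insert k I. real (a i) * (\<Prod>j\<in>insert k I. w j ^ (a(i := a i - 1)) j) * (z i - w i))
      = ?l * ?vb + ?ub * ?L" .
  have product_rule: "u * v - u0 * v0 - (l * v0 + u0 * L) = (u - u0) * (v - v0) + u0 * (v - v0 - L) + v0 * (u - u0 - l)"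
    for u v u0 v0 l L :: real
    by (simp add: algebra_simps)
  have eq: "(\<Prod>i\<in>insert k I. z i ^ a i) - (\<Prod>i\<in>insert k I. w i ^ a i)
      - (\<Sum>i\<in>insert k I. real (a i) * (\<Prod>j\<in>insert k I. w j ^ (a(i := a i - 1)) j) * (z i - w i))
      = (?u - ?ub) * (?v - ?vb) + ?ub * (?v - ?vb - ?L) + ?vb * (?u - ?ub - ?l)"
    unfolding S unfolding prod.insert[OF insert.hyps] by (rule product_rule)
  have h: "0 \<le> h" using zw(3)[of k] by linarith
  have "\<bar>(?u - ?ub) * (?v - ?vb)\<bar> \<le> (?B * h) * (?A * h)"
    unfolding abs_mult using prod_power_diff[OF zw, where I="{k}" and a=a] prod_power_diff[OF zw, where I=I and a=a] h
    by (intro mult_mono) auto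
  moreover have "\<bar>?ub * (?v - ?vb - ?L)\<bar> \<le> 1 * (?A\<^sup>2 * h\<^sup>2)"
    unfolding abs_mult[of ?ub] using zw insert by (intro mult_mono) (auto simp: power_abs power_le_one)
  moreover have "\<bar>?vb * (?u - ?ub - ?l)\<bar> \<le> 1 * (?B\<^sup>2 * h\<^sup>2)"
    unfolding abs_mult[of ?vb] using zw power_taylor[OF zw(1,2,3)[of k], of "a k"]
    by (intro mult_mono) (auto simp: power_abs power_le_one abs_prod intro!: prod_le_1)
  ultimately have "\<bar>(?u - ?ub) * (?v - ?vb) + ?ub * (?v - ?vb - ?L) + ?vb * (?u - ?ub - ?l)\<bar>
      \<le> (?B * h) * (?A * h) + ?A\<^sup>2 * h\<^sup>2 + ?B\<^sup>2 * h\<^sup>2"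
    by linarith
  also have "\<dots> \<le> (?A + ?B)\<^sup>2 * h\<^sup>2"
  proof -
    have "(?A + ?B)\<^sup>2 * h\<^sup>2 - ((?B * h) * (?A * h) + ?A\<^sup>2 * h\<^sup>2 + ?B\<^sup>2 * h\<^sup>2) = ?A * ?B * h\<^sup>2"
      by (simp add: power2_eq_square algebra_simps)
    moreover have "0 \<le> ?A * ?B * h\<^sup>2" by (intro mult_nonneg_nonneg) (auto intro: sum_nonneg)
    ultimately show ?thesis by linarith
  qed
  finally show ?case using insert eq by (simp add: add.commute)
qed simp

text \<open>The coefficients of the partial derivative in direction \<open>i\<close>: the exponent
  \<open>b\<close> arises from \<open>b\<close> raised by one in position \<open>i\<close>, which is
  also where the factor comes from.\<close>

definition poly_deriv :: "'n \<Rightarrow> (('n \<Rightarrow> nat) \<Rightarrow> real) \<Rightarrow> ('n::finite \<Rightarrow> nat) \<Rightarrow> real" where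
  "poly_deriv i c b = real (Suc (b i)) * c (b(i := Suc (b i)))"

text \<open>Lowering the exponent of coordinate \<open>i\<close> by one maps the multi-indices with
  \<open>a i > 0\<close> of degree at most \<open>Suc m\<close> bijectively onto those of degree at
  most \<open>m\<close>.\<close>

lemma sum_midx_shift:
  fixes i :: "'n::finite" and f :: "('n \<Rightarrow> nat) \<Rightarrow> real"
  shows "(\<Sum>a\<in>midx (Suc m). if a i = 0 then 0 else f a) = (\<Sum>b\<in>midx m. f (b(i := Suc (b i))))"
proof -
  have sm: "(\<Sum>j\<in>UNIV. (b(i := Suc (b i))) j) = Suc (\<Sum>j\<in>UNIV. b j)" for b :: "'n \<Rightarrow> nat"
    by (simp add: sum.remove[of UNIV i])
  have "(\<Sum>a\<in>midx (Suc m). if a i = 0 then 0 else f a) = (\<Sum>a\<in>{a\<in>midx (Suc m). a i \<noteq> 0}. f a)"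
    by (intro sum.mono_neutral_cong_right) auto
  also have "\<dots> = (\<Sum>b\<in>midx m. f (b(i := Suc (b i))))"
  proof (rule sum.reindex_bij_witness[where i="\<lambda>b. b(i := Suc (b i))" and j="\<lambda>a. a(i := a i - 1)"])
    fix a assume a: "a \<in> {a\<in>midx (Suc m). a i \<noteq> 0}"
    then show "a(i := a i - 1) \<in> midx m"
      using sm[of "a(i := a i - 1)"] by (simp add: midx_def)
  qed (auto simp: midx_def sm simp del: fun_upd_apply, auto)
  finally show ?thesis .
qed

lemma poly_eval_diff_le:
  assumes "\<And>i. \<bar>z $ i\<bar> \<le> 1" "\<And>i. \<bar>w $ i\<bar> \<le> 1" "\<And>i. \<bar>z $ i - w $ i\<bar> \<le> h"
  shows "\<bar>poly_eval m c z - poly_eval m c w\<bar> \<le> real m * h * coeff_norm m c"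
proof -
  have h: "0 \<le> h" using assms(3)[of undefined] by linarith
  have "\<bar>poly_eval m c z - poly_eval m c w\<bar> \<le> (\<Sum>a\<in>midx m. \<bar>c a * (monom_fun a z - monom_fun a w)\<bar>)"
    unfolding poly_eval_def sum_subtractf[symmetric] right_diff_distrib[symmetric] by (rule sum_abs)
  also have "\<dots> \<le> (\<Sum>a\<in>midx m. \<bar>c a\<bar> * (real m * h))"
    unfolding abs_mult
  proof (intro sum_mono mult_left_mono)
    fix a :: "'a \<Rightarrow> nat" assume a: "a \<in> midx m"
    have "\<bar>monom_fun a z - monom_fun a w\<bar> \<le> real (\<Sum>i\<in>UNIV. a i) * h"
      unfolding monom_fun_def using assms by (intro prod_power_diff) auto
    also have "\<dots> \<le> real m * h" using a h by (intro mult_right_mono) (simp_all add: midx_def del: of_nat_sum)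
    finally show "\<bar>monom_fun a z - monom_fun a w\<bar> \<le> real m * h" .
  qed auto
  also have "\<dots> = real m * h * coeff_norm m c"
    by (simp add: coeff_norm_def sum_distrib_left mult.commute)
  finally show ?thesis .
qed

lemma poly_eval_taylor:
  fixes z w :: "real^'n::finite"
  assumes "\<And>i. \<bar>z $ i\<bar> \<le> 1" "\<And>i. \<bar>w $ i\<bar> \<le> 1" "\<And>i. \<bar>z $ i - w $ i\<bar> \<le> h"
  shows "\<bar>poly_eval (Suc m) c z - poly_eval (Suc m) c w
      - (\<Sum>i\<in>UNIV. poly_eval m (poly_deriv i c) w * (z $ i - w $ i))\<bar>
      \<le> (real (Suc m))\<^sup>2 * h\<^sup>2 * coeff_norm (Suc m) c"
proof -
  let ?D = "\<lambda>a. \<Sum>i\<in>UNIV. real (a i) * monom_fun (a(i := a i - 1)) w * (z $ i - w $ i)"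
  have "poly_eval m (poly_deriv i c) w = (\<Sum>a\<in>midx (Suc m). c a * (real (a i) * monom_fun (a(i := a i - 1)) w))" for i
  proof -
    have "(\<Sum>a\<in>midx (Suc m). c a * (real (a i) * monom_fun (a(i := a i - 1)) w))
        = (\<Sum>a\<in>midx (Suc m). if a i = 0 then 0 else c a * (real (a i) * monom_fun (a(i := a i - 1)) w))"
      by (intro sum.cong) auto
    then show ?thesis
      unfolding sum_midx_shift by (simp add: poly_eval_def poly_deriv_def mult_ac)
  qed
  then have "(\<Sum>i\<in>UNIV. poly_eval m (poly_deriv i c) w * (z $ i - w $ i)) = (\<Sum>a\<in>midx (Suc m). c a * ?D a)"
    by (simp add: sum_distrib_right sum_distrib_left mult.assoc)
      (rule sum.swap)
  then have "poly_eval (Suc m) c z - poly_eval (Suc m) c w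
      - (\<Sum>i\<in>UNIV. poly_eval m (poly_deriv i c) w * (z $ i - w $ i))
      = (\<Sum>a\<in>midx (Suc m). c a * (monom_fun a z - monom_fun a w - ?D a))"
    by (simp add: poly_eval_def sum_subtractf right_diff_distrib)
  also have "\<bar>\<dots>\<bar> \<le> (\<Sum>a\<in>midx (Suc m). \<bar>c a\<bar> * ((real (Suc m))\<^sup>2 * h\<^sup>2))"
    unfolding abs_mult[symmetric]
  proof (intro order_trans[OF sum_abs] sum_mono)
    fix a :: "'n \<Rightarrow> nat" assume a: "a \<in> midx (Suc m)"
    have "\<bar>monom_fun a z - monom_fun a w - ?D a\<bar> \<le> (real (\<Sum>i\<in>UNIV. a i))\<^sup>2 * h\<^sup>2"
      unfolding monom_fun_def by (intro prod_power_taylor assms) auto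
    also have "\<dots> \<le> (real (Suc m))\<^sup>2 * h\<^sup>2"
      using a by (intro mult_right_mono power_mono) (auto simp: midx_def simp del: of_nat_sum)
    finally show "\<bar>c a * (monom_fun a z - monom_fun a w - ?D a)\<bar> \<le> \<bar>c a\<bar> * ((real (Suc m))\<^sup>2 * h\<^sup>2)"
      unfolding abs_mult by (intro mult_left_mono) auto
  qed
  finally show ?thesis by (simp add: coeff_norm_def sum_distrib_right[symmetric] mult_ac)
qed

text \<open>Every nonconstant coefficient reappears in some partial derivative, multiplied by an
  integer that is at least 1.\<close>

lemma coeff_norm_le_deriv:
  "coeff_norm (Suc m) c \<le> \<bar>c (\<lambda>_. 0)\<bar> + (\<Sum>i\<in>UNIV. coeff_norm m (poly_deriv i c))"
proof -
  have "\<bar>c a\<bar> \<le> (if a = (\<lambda>_. 0) then \<bar>c a\<bar> else 0) + (\<Sum>i\<in>UNIV. if a i = 0 then 0 else \<bar>c a\<bar>)" for a :: "'a \<Rightarrow> nat"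
  proof (cases "a = (\<lambda>_. 0)")
    case False
    then obtain i where "a i \<noteq> 0" by auto
    then show ?thesis
      using member_le_sum[of i UNIV "\<lambda>i. if a i = 0 then 0 else \<bar>c a\<bar>"] by auto
  qed simp
  then have "coeff_norm (Suc m) c \<le> (\<Sum>a\<in>midx (Suc m). (if a = (\<lambda>_. 0) then \<bar>c a\<bar> else 0) + (\<Sum>i\<in>UNIV. if a i = 0 then 0 else \<bar>c a\<bar>))"
    unfolding coeff_norm_def by (intro sum_mono)
  also have "\<dots> = \<bar>c (\<lambda>_. 0)\<bar> + (\<Sum>i\<in>UNIV. \<Sum>a\<in>midx (Suc m). if a i = 0 then 0 else \<bar>c a\<bar>)"
    by (subst sum.swap) (simp add: sum.distrib sum.delta' midx_def[of "Suc m", symmetric], simp add: midx_def)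
  also have "\<dots> \<le> \<bar>c (\<lambda>_. 0)\<bar> + (\<Sum>i\<in>UNIV. coeff_norm m (poly_deriv i c))"
    unfolding sum_midx_shift coeff_norm_def poly_deriv_def
    by (intro add_left_mono sum_mono) (simp add: abs_mult mult_le_cancel_right1)
  finally show ?thesis .
qed

text \<open>The coefficients of the polynomial composed with multiplication by \<open>s\<close>;
  used with \<open>s = 1/2\<close> to pass to the concentric half cube.\<close>

definition coeff_scale :: "real \<Rightarrow> (('n \<Rightarrow> nat) \<Rightarrow> real) \<Rightarrow> ('n::finite \<Rightarrow> nat) \<Rightarrow> real" where
  "coeff_scale s c a = s ^ (\<Sum>i\<in>UNIV. a i) * c a"

lemma poly_eval_scale: "poly_eval m (coeff_scale s c) z = poly_eval m c (s *\<^sub>R z)"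
  by (simp add: poly_eval_def coeff_scale_def monom_fun_def power_mult_distrib prod.distrib power_sum mult_ac)

lemma poly_eval_rescale_half:
  "poly_eval m c (rescale x r y) = poly_eval m (coeff_scale (1/2) c) (rescale x (r / 2) y)"
  by (simp add: poly_eval_scale rescale_def)

lemma coeff_norm_scale_half: "coeff_norm m c \<le> 2 ^ m * coeff_norm m (coeff_scale (1/2) c)"
  unfolding coeff_norm_def sum_distrib_left
proof (intro sum_mono)
  fix a :: "'a \<Rightarrow> nat" assume "a \<in> midx m"
  then have "(2::real) ^ (\<Sum>i\<in>UNIV. a i) \<le> 2 ^ m" by (intro power_increasing) (auto simp: midx_def)
  then have "\<bar>c a\<bar> * 2 ^ (\<Sum>i\<in>UNIV. a i) \<le> \<bar>c a\<bar> * 2 ^ m" by (intro mult_left_mono) auto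
  then show "\<bar>c a\<bar> \<le> 2 ^ m * \<bar>coeff_scale (1/2) c a\<bar>"
    by (simp add: coeff_scale_def abs_mult power_abs power_one_over field_simps)
qed

section \<open>A Remez-type inequality on Ahlfors regular sets\<close>

text \<open>Hausdorff measure enters the analytic part only through these properties. Since the
  measure lives on the Borel sets, product measurability, Fubini's theorem and regularity of finite
  Borel measures are available.\<close>

locale ahlfors_regular =
  fixes M :: "(real^'n::finite) measure" and S :: "(real^'n) set" and d c1 c2 :: real
  assumes sets_M [measurable_cong, simp]: "sets M = sets borel"
    and closed_S: "closed S"
    and null_compl: "emeasure M (- S) = 0"
    and c1_pos: "0 < c1" and c2_pos: "0 < c2"
    and dim_gt: "real CARD('n) - 1 < d"
    and cube_lower: "\<And>x r. x \<in> S \<Longrightarrow> 0 < r \<Longrightarrow> r \<le> 1 \<Longrightarrow> ennreal (c1 * r powr d) \<le> emeasure M (cube x r)"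
    and cube_upper: "\<And>x r. x \<in> S \<Longrightarrow> 0 < r \<Longrightarrow> r \<le> 1 \<Longrightarrow> emeasure M (cube x r) \<le> ennreal (c2 * r powr d)"
begin

lemma space_M [simp]: "space M = UNIV"
  using sets_eq_imp_space_eq[OF sets_M] by simp

lemma S_borel [measurable]: "S \<in> sets borel"
  using closed_S by (rule borel_closed)

lemma AE_in_S: "AE x in M. x \<in> S"
  using null_compl by (intro AE_I[of _ _ "- S"]) auto

lemma emeasure_Int_S: "A \<in> sets borel \<Longrightarrow> emeasure M (A \<inter> S) = emeasure M A"
  using AE_in_S by (intro emeasure_eq_AE) (auto elim: AE_mp)

lemma cube_pos: "x \<in> S \<Longrightarrow> 0 < r \<Longrightarrow> r \<le> 1 \<Longrightarrow> 0 < emeasure M (cube x r)"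
  using cube_lower[of x r] c1_pos by (auto intro: less_le_trans[of 0 "ennreal (c1 * r powr d)"])

lemma cube_finite: "x \<in> S \<Longrightarrow> 0 < r \<Longrightarrow> r \<le> 1 \<Longrightarrow> emeasure M (cube x r) < top"
  using cube_upper[of x r] by (auto intro: le_less_trans[of _ "ennreal (c2 * r powr d)"])

text \<open>A slab of relative thickness \<open>1 / N\<close> meets at most \<open>(2 N + 1) ^ (n - 1)\<close> columns of the grid of
  mesh \<open>\<rho> / N\<close>, and in each of them \<open>S\<close> has measure \<open>O ((\<rho> / N) powr d)\<close>; since \<open>d > n - 1\<close> this is
  less than the measure of \<open>S \<inter> cube y \<rho>\<close> if \<open>N\<close> is large.\<close>

lemma linear_lower_bound:
  "\<exists>e>0. \<forall>y\<in>S. \<forall>\<rho>. 0 < \<rho> \<and> \<rho> \<le> 1 \<longrightarrow> (\<forall>g \<eta>. (\<forall>w\<in>cube y \<rho> \<inter> S. \<bar>\<Sum>i\<in>UNIV. g i * (w $ i - y $ i)\<bar> \<le> \<eta>)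
      \<longrightarrow> (\<forall>i. e * \<rho> * \<bar>g i\<bar> \<le> \<eta>))"
proof -
  define n where "n = CARD('n)"
  have n1: "1 \<le> n" unfolding n_def by (simp add: Suc_le_eq)
  have dn: "0 < d - (real n - 1)" using dim_gt by (simp add: n_def)
  \<comment> \<open>This is the bound for the measure of the slab, divided by
    \<open>\<rho> powr d\<close>: at most \<open>(3 * N) ^ (n - 1)\<close> columns, each of measure
    at most \<open>c2 * (n * \<rho> / N) powr d\<close>.\<close>
  have "((\<lambda>N. 3 ^ (n - 1) * c2 * real n powr d * real N powr (- (d - (real n - 1)))) \<longlongrightarrow> 3 ^ (n - 1) * c2 * real n powr d * 0) sequentially"
    by (intro tendsto_mult tendsto_const tendsto_neg_powr filterlim_real_sequentially) (use dn in simp)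
  then have "\<forall>\<^sub>F N in sequentially. 3 ^ (n - 1) * c2 * real n powr d * real N powr (- (d - (real n - 1))) < c1"
    using c1_pos by (auto dest: order_tendstoD(2))
  \<comment> \<open>The condition \<open>n \<le> N\<close> keeps the radius
    \<open>n * \<rho> / N\<close> of the covering cubes at most 1, where regularity applies.\<close>
  from eventually_conj[OF this eventually_ge_at_top[of n]]
  obtain N where N: "3 ^ (n - 1) * c2 * real n powr d * real N powr (- (d - (real n - 1))) < c1" "n \<le> N"
    by (auto simp: eventually_sequentially)
  then have N1: "1 \<le> N" using n1 by linarith
  \<comment> \<open>Chosen so that within a column the coordinate \<open>k\<close> varies by at most
    \<open>2 * e * \<rho> + (n - 1) * \<rho> / N = n * \<rho> / N\<close>.\<close>
  define e where "e = 1 / (2 * real N)"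
  have e0: "0 < e" using N1 by (simp add: e_def)
  have "e * \<rho> * \<bar>g i\<bar> \<le> \<eta>"
    if y: "y \<in> S" and \<rho>: "0 < \<rho>" "\<rho> \<le> 1"
      and small: "\<And>w. w \<in> cube y \<rho> \<inter> S \<Longrightarrow> \<bar>\<Sum>i\<in>UNIV. g i * (w $ i - y $ i)\<bar> \<le> \<eta>"
    for y \<rho> g \<eta> i
  proof (rule ccontr)
    assume "\<not> e * \<rho> * \<bar>g i\<bar> \<le> \<eta>"
    then have lt: "\<eta> < e * \<rho> * \<bar>g i\<bar>" by simp
    \<comment> \<open>The columns run in the direction \<open>k\<close> of a largest coefficient:
      dividing by it, the slab condition bounds \<open>w $ k\<close> in terms of the other
      coordinates without loss.\<close>
    define G where "G = Max (range (\<lambda>i. \<bar>g i\<bar>))"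
    have gG: "\<bar>g j\<bar> \<le> G" for j unfolding G_def by (intro Max_ge) auto
    have "G \<in> range (\<lambda>i. \<bar>g i\<bar>)" unfolding G_def by (intro Max_in) auto
    then obtain k where k: "G = \<bar>g k\<bar>" by (rule imageE)
    have lt2: "\<eta> < e * \<rho> * G"
      using lt gG[of i] e0 \<rho> by (smt (verit) mult_left_mono mult_pos_pos)
    have "0 \<le> \<eta>" using small[of y] y \<rho> by (simp add: cube_self)
    then have G0: "0 < G" using lt2 e0 \<rho> by (smt (verit) mult_nonneg_nonneg mult_pos_pos zero_less_mult_pos)
    define K where "K w = (\<lambda>j\<in>UNIV - {k}. \<lfloor>real N * (w $ j - y $ j) / \<rho>\<rfloor>)" for w :: "real^'n"
    define X where "X = cube y \<rho> \<inter> S"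
    define T where "T = PiE (UNIV - {k}) (\<lambda>_::'n. {- int N..int N})"
    have KT: "K w \<in> T" if "w \<in> X" for w
    proof -
      have "\<lfloor>real N * (w $ j - y $ j) / \<rho>\<rfloor> \<in> {- int N..int N}" for j
      proof -
        have "\<bar>w $ j - y $ j\<bar> \<le> \<rho>" using that by (auto simp: X_def mem_cube_iff)
        then have "\<bar>(w $ j - y $ j) / \<rho>\<bar> \<le> 1" using \<rho> by (simp add: abs_divide)
        then have "\<bar>real N * ((w $ j - y $ j) / \<rho>)\<bar> \<le> real N * 1"
          unfolding abs_mult by (intro mult_mono) auto
        then have "real N * (w $ j - y $ j) / \<rho> \<le> real N \<and> - (real N * (w $ j - y $ j) / \<rho>) \<le> real N"
          by (simp only: abs_le_iff times_divide_eq_right mult_1_right)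
        then have "- real N \<le> real N * (w $ j - y $ j) / \<rho>" "real N * (w $ j - y $ j) / \<rho> \<le> real N"
          by linarith+
        then show ?thesis by (simp add: le_floor_iff) linarith
      qed
      then show ?thesis by (auto simp: K_def T_def)
    qed
    have finT: "finite T" unfolding T_def by (intro finite_PiE) auto
    have cardT: "card T = (2 * N + 1) ^ (n - 1)"
      unfolding T_def n_def by (subst card_PiE) (auto simp: card_Diff_singleton nat_add_distrib nat_mult_distrib)
    have near: "w' \<in> cube w (real n * \<rho> / real N)" if "w \<in> X" "w' \<in> X" "K w = K w'" for w w'
      unfolding mem_cube_iff
    proof
      fix j
      have other: "\<bar>w' $ j - w $ j\<bar> \<le> \<rho> / real N" if "j \<noteq> k" for j
      proof -
        have "\<lfloor>real N * (w $ j - y $ j) / \<rho>\<rfloor> = \<lfloor>real N * (w' $ j - y $ j) / \<rho>\<rfloor>"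
          using fun_cong[OF \<open>K w = K w'\<close>, of j] that by (simp add: K_def)
        then have "\<bar>real N * (w' $ j - y $ j) / \<rho> - real N * (w $ j - y $ j) / \<rho>\<bar> \<le> 1" by linarith
        also have "real N * (w' $ j - y $ j) / \<rho> - real N * (w $ j - y $ j) / \<rho> = real N * (w' $ j - w $ j) / \<rho>"
          by (simp add: diff_divide_distrib[symmetric] right_diff_distrib)
        finally have "real N * \<bar>w' $ j - w $ j\<bar> / \<rho> \<le> 1" using \<rho> by (simp add: abs_mult abs_divide)
        then show ?thesis using \<rho> N1 by (simp add: pos_divide_le_eq pos_le_divide_eq mult.commute)
      qed
      have le1: "\<rho> / real N \<le> real n * \<rho> / real N"
        using n1 \<rho> by (intro divide_right_mono) auto
      show "\<bar>w' $ j - w $ j\<bar> \<le> real n * \<rho> / real N"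
      proof (cases "j = k")
        case False
        then show ?thesis using other le1 by (meson order_trans)
      next
        case True
        let ?f = "\<lambda>w. \<Sum>i\<in>UNIV. g i * (w $ i - y $ i)"
        have "g k * (w' $ k - w $ k) = ?f w' - ?f w - (\<Sum>i\<in>UNIV - {k}. g i * (w' $ i - w $ i))"
          unfolding sum_subtractf[symmetric] by (subst sum.remove[of UNIV k]) (auto simp: algebra_simps sum_subtractf sum.distrib)
        moreover have "\<bar>\<Sum>i\<in>UNIV - {k}. g i * (w' $ i - w $ i)\<bar> \<le> (\<Sum>i\<in>UNIV - {k}. G * (\<rho> / real N))"
          using G0 by (intro order_trans[OF sum_abs] sum_mono, unfold abs_mult, intro mult_mono other gG) auto
        moreover have "\<dots> = (real n - 1) * (G * (\<rho> / real N))"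
          using n1 by (simp add: n_def card_Diff_singleton of_nat_diff)
        moreover have "\<bar>?f w'\<bar> \<le> \<eta>" "\<bar>?f w\<bar> \<le> \<eta>" using small that by (auto simp: X_def)
        ultimately have "\<bar>g k * (w' $ k - w $ k)\<bar> \<le> 2 * (e * \<rho> * G) + (real n - 1) * (G * (\<rho> / real N))"
          using lt2 by linarith
        also have "\<dots> = G * (real n * \<rho> / real N)"
          using N1 by (simp add: e_def field_simps)
        finally have "G * \<bar>w' $ k - w $ k\<bar> \<le> G * (real n * \<rho> / real N)"
          unfolding abs_mult k .
        then show ?thesis unfolding True using G0 by (rule mult_left_le_imp_le)
      qed
    qed
    define \<kappa> where "\<kappa> = real n * \<rho> / real N"
    have \<kappa>: "0 < \<kappa>" "\<kappa> \<le> 1"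
    proof -
      show "0 < \<kappa>" using n1 N1 \<rho> by (simp add: \<kappa>_def)
      have "real n * \<rho> \<le> real N * 1" using N \<rho> by (intro mult_mono) auto
      then show "\<kappa> \<le> 1" using N1 by (simp add: \<kappa>_def)
    qed
    \<comment> \<open>The upper measure bound holds only at centres in \<open>S\<close>, so each
      covering cube is centred at a point of \<open>X\<close> in its column, and its radius bounds
      the coordinate differences of any two points there.\<close>
    define rep where "rep t = (SOME w. w \<in> X \<and> K w = t)" for t
    have rep: "rep (K w) \<in> X \<and> K (rep (K w)) = K w" if "w \<in> X" for w
      unfolding rep_def by (rule someI[of _ w]) (use that in simp)
    have cover: "X \<subseteq> (\<Union>t\<in>K ` X. cube (rep t) \<kappa>)"
    proof
      fix w assume w: "w \<in> X"
      then have "w \<in> cube (rep (K w)) \<kappa>" unfolding \<kappa>_def using rep[OF w] by (intro near) auto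
      then show "w \<in> (\<Union>t\<in>K ` X. cube (rep t) \<kappa>)" using w by blast
    qed
    have KX: "K ` X \<subseteq> T" using KT by blast
    then have finKX: "finite (K ` X)" using finT finite_subset by blast
    have "ennreal (c1 * \<rho> powr d) \<le> emeasure M (cube y \<rho>)" using y \<rho> by (rule cube_lower)
    also have "\<dots> = emeasure M X" unfolding X_def by (simp add: emeasure_Int_S)
    also have "\<dots> \<le> emeasure M (\<Union>t\<in>K ` X. cube (rep t) \<kappa>)"
      using finKX by (intro emeasure_mono cover sets.finite_UN) auto
    also have "\<dots> \<le> (\<Sum>t\<in>K ` X. emeasure M (cube (rep t) \<kappa>))"
      using finKX by (intro emeasure_subadditive_finite) auto
    also have "\<dots> \<le> (\<Sum>t\<in>K ` X. ennreal (c2 * \<kappa> powr d))"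
      using \<kappa> rep by (intro sum_mono cube_upper) (auto simp: X_def)
    also have "\<dots> = ennreal (real (card (K ` X)) * (c2 * \<kappa> powr d))"
      using c2_pos by (simp add: ennreal_mult ennreal_of_nat_eq_real_of_nat)
    also have "\<dots> \<le> ennreal ((3 * real N) ^ (n - 1) * (c2 * \<kappa> powr d))"
    proof (intro ennreal_leI mult_right_mono)
      have "real (card (K ` X)) \<le> real (card T)" using card_mono[OF finT KX] by simp
      also have "\<dots> = (2 * real N + 1) ^ (n - 1)" using cardT by (simp add: add.commute)
      also have "\<dots> \<le> (3 * real N) ^ (n - 1)" using N1 by (intro power_mono) auto
      finally show "real (card (K ` X)) \<le> (3 * real N) ^ (n - 1)" .
    qed (use c2_pos in simp)
    finally have "c1 * \<rho> powr d \<le> (3 * real N) ^ (n - 1) * (c2 * \<kappa> powr d)"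
      using c2_pos by (subst (asm) ennreal_le_iff) auto
    also have "\<dots> = (3 ^ (n - 1) * c2 * real n powr d * real N powr (- (d - (real n - 1)))) * \<rho> powr d"
    proof -
      have "real N ^ (n - 1) = real N powr (real n - 1)"
        using N1 n1 by (simp add: powr_realpow[symmetric] of_nat_diff)
      moreover have "\<kappa> powr d = real n powr d * \<rho> powr d * real N powr (- d)"
        using \<rho> N1 by (simp add: \<kappa>_def powr_mult powr_divide powr_minus_divide)
      moreover have "real N powr (- (d - (real n - 1))) = real N powr (real n - 1) * real N powr (- d)"
        by (simp add: powr_add[symmetric])
      ultimately show ?thesis by (simp add: power_mult_distrib)
    qed
    also have "\<dots> < c1 * \<rho> powr d" using N(1) \<rho> by (intro mult_strict_right_mono) auto
    finally show False by simp
  qed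
  then show ?thesis using e0 by blast
qed

text \<open>Near a point of \<open>S\<close> the polynomial differs from its linearisation by a
  quadratic error, so the previous lemma bounds the gradient at the points of \<open>S\<close>, and the
  induction hypothesis applies to the partial derivatives.\<close>

lemma remez_sup:
  "\<exists>C>0. \<forall>x\<in>S. \<forall>r. 0 < r \<and> r \<le> 1 \<longrightarrow> (\<forall>c \<eta>. (\<forall>y\<in>cube x r \<inter> S. \<bar>poly_eval m c (rescale x r y)\<bar> \<le> \<eta>)
     \<longrightarrow> coeff_norm m c \<le> C * \<eta>)"
proof (induction m)
  case 0
  have "(\<Sum>i\<in>UNIV. a i) = 0 \<longleftrightarrow> a = (\<lambda>_. 0)" for a :: "'n \<Rightarrow> nat" by (auto simp: fun_eq_iff)
  then have m0: "midx 0 = {\<lambda>_::'n. 0}" by (auto simp: midx_def)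
  show ?case
  proof (intro exI[of _ 1] conjI ballI allI impI)
    fix x r \<eta> and c :: "('n \<Rightarrow> nat) \<Rightarrow> real"
    assume "x \<in> S" "0 < r \<and> r \<le> 1" "\<forall>y\<in>cube x r \<inter> S. \<bar>poly_eval 0 c (rescale x r y)\<bar> \<le> \<eta>"
    then have "\<bar>poly_eval 0 c (rescale x r x)\<bar> \<le> \<eta>" by (auto simp: cube_self)
    then show "coeff_norm 0 c \<le> 1 * \<eta>" by (simp add: poly_eval_def coeff_norm_def m0 monom_fun_def)
  qed simp
next
  case (Suc m)
  then obtain C where C: "C > 0" and IH: "\<And>x r c \<eta>. x \<in> S \<Longrightarrow> 0 < r \<Longrightarrow> r \<le> 1 \<Longrightarrow>
      (\<And>y. y \<in> cube x r \<inter> S \<Longrightarrow> \<bar>poly_eval m c (rescale x r y)\<bar> \<le> \<eta>) \<Longrightarrow> coeff_norm m c \<le> C * \<eta>"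
    by blast
  obtain e where e: "e > 0" and slab: "\<And>y \<rho> g \<eta> i. y \<in> S \<Longrightarrow> 0 < \<rho> \<Longrightarrow> \<rho> \<le> 1 \<Longrightarrow>
      (\<And>w. w \<in> cube y \<rho> \<inter> S \<Longrightarrow> \<bar>\<Sum>i\<in>UNIV. g i * (w $ i - y $ i)\<bar> \<le> \<eta>) \<Longrightarrow> e * \<rho> * \<bar>g i\<bar> \<le> \<eta>"
    using linear_lower_bound by blast
  define n where "n = real CARD('n)"
  define B where "B = n * 2 ^ m * C / e"
  define K where "K = (real (Suc m))\<^sup>2"
  have B: "0 < B" using C e by (simp add: B_def n_def)
  have K: "0 < K" by (simp add: K_def)
  \<comment> \<open>\<open>B\<close> collects the dimension, the loss from halving the cube, the
    induction constant and the slab constant. With \<open>B * K * \<rho> \<le> 1/2\<close> the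
    remainder contributes at most half of the coefficient norm and moves to the left-hand
    side.\<close>
  define \<rho> where "\<rho> = min (1/2) (1 / (2 * B * K))"
  have \<rho>: "0 < \<rho>" "\<rho> \<le> 1/2" "B * K * \<rho> \<le> 1/2"
  proof -
    show "0 < \<rho>" "\<rho> \<le> 1/2" using B K by (auto simp: \<rho>_def)
    have "B * K * \<rho> \<le> B * K * (1 / (2 * B * K))" using B K by (intro mult_left_mono) (auto simp: \<rho>_def)
    then show "B * K * \<rho> \<le> 1/2" using B K by simp
  qed
  show ?case
  proof (intro exI[of _ "2 * (1 + 2 * B / \<rho>)"] conjI ballI allI impI)
    show "0 < 2 * (1 + 2 * B / \<rho>)" using B \<rho> by (intro mult_pos_pos add_pos_pos divide_pos_pos) auto
    fix x r \<eta> and c :: "('n \<Rightarrow> nat) \<Rightarrow> real"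
    assume x: "x \<in> S" and "0 < r \<and> r \<le> 1" and "\<forall>y\<in>cube x r \<inter> S. \<bar>poly_eval (Suc m) c (rescale x r y)\<bar> \<le> \<eta>"
    then have r: "0 < r" "r \<le> 1" and small: "\<And>y. y \<in> cube x r \<Longrightarrow> y \<in> S \<Longrightarrow> \<bar>poly_eval (Suc m) c (rescale x r y)\<bar> \<le> \<eta>"
      by auto
    let ?N = "coeff_norm (Suc m) c"
    have N0: "0 \<le> ?N" by (rule coeff_norm_nonneg)
    \<comment> \<open>On a cube of radius \<open>\<rho> * r\<close> the linear part is a difference
      of two values bounded by \<open>\<eta>\<close> up to the Taylor remainder; the slab inequality
      then divides by \<open>e * \<rho>\<close>. Only points of the half cube are used, so that
      these small cubes stay inside \<open>cube x r\<close>.\<close>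
    define \<gamma> where "\<gamma> = (2 * \<eta> + K * \<rho>\<^sup>2 * ?N) / (e * \<rho>)"
    have grad: "\<bar>poly_eval m (poly_deriv i c) (rescale x r y)\<bar> \<le> \<gamma>"
      if y: "y \<in> cube x (r / 2) \<inter> S" for y i
    proof -
      have yx: "y \<in> cube x r"
        using y r cube_subset[of x x 0 "r/2" r] by (auto simp: cube_self)
      have "e * (\<rho> * r) * \<bar>poly_eval m (poly_deriv i c) (rescale x r y) / r\<bar> \<le> 2 * \<eta> + K * \<rho>\<^sup>2 * ?N"
      proof (rule slab)
        show "y \<in> S" "0 < \<rho> * r" using y \<rho> r by auto
        have "\<rho> * r \<le> (1/2) * 1" using \<rho> r by (intro mult_mono) auto
        then show "\<rho> * r \<le> 1" by simp
        fix w assume w: "w \<in> cube y (\<rho> * r) \<inter> S"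
        have "\<rho> * r \<le> (1/2) * r" using \<rho> r by (intro mult_right_mono) auto
        then have wx: "w \<in> cube x r"
          using w y cube_subset[of y x "r / 2" "\<rho> * r" r] by auto
        have le1: "\<bar>rescale x r z $ j\<bar> \<le> 1" if "z \<in> cube x r" for z j
          using that r by (auto simp: mem_cube_iff abs_divide)
        have "\<bar>poly_eval (Suc m) c (rescale x r w) - poly_eval (Suc m) c (rescale x r y)
            - (\<Sum>i\<in>UNIV. poly_eval m (poly_deriv i c) (rescale x r y) * (rescale x r w $ i - rescale x r y $ i))\<bar>
            \<le> (real (Suc m))\<^sup>2 * \<rho>\<^sup>2 * ?N"
        proof (rule poly_eval_taylor)
          fix j
          have "\<bar>w $ j - y $ j\<bar> \<le> \<rho> * r" using w by (auto simp: mem_cube_iff)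
          then have "\<bar>(w $ j - y $ j) / r\<bar> \<le> \<rho>" using r by (simp add: abs_divide pos_divide_le_eq)
          moreover have "(w $ j - y $ j) / r = rescale x r w $ j - rescale x r y $ j"
            by (simp add: diff_divide_distrib)
          ultimately show "\<bar>rescale x r w $ j - rescale x r y $ j\<bar> \<le> \<rho>" by simp
        qed (use le1 wx yx in auto)
        moreover have "rescale x r w $ i - rescale x r y $ i = (w $ i - y $ i) / r" for i
          by (simp add: diff_divide_distrib)
        ultimately have "\<bar>poly_eval (Suc m) c (rescale x r w) - poly_eval (Suc m) c (rescale x r y)
            - (\<Sum>i\<in>UNIV. poly_eval m (poly_deriv i c) (rescale x r y) / r * (w $ i - y $ i))\<bar> \<le> K * \<rho>\<^sup>2 * ?N"
          by (simp add: K_def)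
        then show "\<bar>\<Sum>i\<in>UNIV. poly_eval m (poly_deriv i c) (rescale x r y) / r * (w $ i - y $ i)\<bar> \<le> 2 * \<eta> + K * \<rho>\<^sup>2 * ?N"
          using small[OF wx] small[OF yx] w y by auto
      qed
      moreover have "e * (\<rho> * r) * \<bar>poly_eval m (poly_deriv i c) (rescale x r y) / r\<bar> = e * \<rho> * \<bar>poly_eval m (poly_deriv i c) (rescale x r y)\<bar>"
        using r by (simp add: abs_divide)
      ultimately show ?thesis using e \<rho> by (simp add: \<gamma>_def field_simps)
    qed
    have "coeff_norm m (poly_deriv i c) \<le> 2 ^ m * (C * \<gamma>)" for i
    proof -
      have "coeff_norm m (coeff_scale (1/2) (poly_deriv i c)) \<le> C * \<gamma>"
        using r by (intro IH[OF x, of "r / 2"]) (auto simp: poly_eval_rescale_half[symmetric] intro!: grad)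
      then show ?thesis
        using coeff_norm_scale_half[of m "poly_deriv i c"] by (smt (verit) mult_left_mono zero_le_power)
    qed
    then have "(\<Sum>i\<in>UNIV. coeff_norm m (poly_deriv i c)) \<le> (\<Sum>i\<in>(UNIV::'n set). 2 ^ m * (C * \<gamma>))"
      by (intro sum_mono)
    moreover have "\<bar>c (\<lambda>_. 0)\<bar> \<le> \<eta>"
    proof -
      have "monom_fun a (rescale x r x) = (if a = (\<lambda>_. 0) then 1 else 0)" for a :: "'n \<Rightarrow> nat"
        by (auto simp: monom_fun_def fun_eq_iff zero_power)
      then have "poly_eval (Suc m) c (rescale x r x) = c (\<lambda>_. 0)"
        by (simp add: poly_eval_def if_distrib[of "\<lambda>t. _ * t"] sum.delta' cong: if_cong) (simp add: midx_def)
      then show ?thesis using small[of x] x r by (simp add: cube_self)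
    qed
    ultimately have "?N \<le> \<eta> + n * (2 ^ m * (C * \<gamma>))"
      using coeff_norm_le_deriv[of m c] by (simp add: n_def)
    also have "n * (2 ^ m * (C * \<gamma>)) = 2 * B / \<rho> * \<eta> + (B * K * \<rho>) * ?N"
      using e \<rho> by (simp add: \<gamma>_def B_def power2_eq_square field_simps)
    also have "(B * K * \<rho>) * ?N \<le> 1/2 * ?N" using \<rho> N0 by (intro mult_right_mono)
    finally have "?N \<le> \<eta> + (2 * B / \<rho> * \<eta> + 1/2 * ?N)" by simp
    moreover have "2 * (1 + 2 * B / \<rho>) * \<eta> = 2 * \<eta> + 2 * (2 * B / \<rho> * \<eta>)"
      by (simp only: distrib_left distrib_right mult.assoc mult_1_right)
    ultimately show "?N \<le> 2 * (1 + 2 * B / \<rho>) * \<eta>" by linarith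
  qed
qed

text \<open>The supremum version gives a point of the half cube where the polynomial is comparable
  to its coefficient norm. By the Lipschitz bound it remains so on a cube of comparable radius, and
  by regularity that cube carries a fixed share of the measure.\<close>

lemma remez_average:
  "\<exists>C>0. \<forall>x\<in>S. \<forall>r. 0 < r \<and> r \<le> 1 \<longrightarrow> (\<forall>c. ennreal (coeff_norm m c) * emeasure M (cube x r)
     \<le> ennreal C * (\<integral>\<^sup>+y\<in>cube x r. ennreal \<bar>poly_eval m c (rescale x r y)\<bar> \<partial>M))"
proof -
  obtain C where C: "C > 0" and sup: "\<And>x r c \<eta>. x \<in> S \<Longrightarrow> 0 < r \<Longrightarrow> r \<le> 1 \<Longrightarrow>
      (\<And>y. y \<in> cube x r \<inter> S \<Longrightarrow> \<bar>poly_eval m c (rescale x r y)\<bar> \<le> \<eta>) \<Longrightarrow> coeff_norm m c \<le> C * \<eta>"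
    using remez_sup[of m] by blast
  \<comment> \<open>The factor \<open>2 ^ m\<close> pays for the half cube. With the additional 2, a
    polynomial below \<open>\<kappa> * ?N\<close> on the half cube would have coefficient norm at
    most half of itself, hence zero, and the centre \<open>x\<close> excludes that.\<close>
  define \<kappa> where "\<kappa> = 1 / (2 * C * 2 ^ m)"
  have \<kappa>: "0 < \<kappa>" using C by (simp add: \<kappa>_def)
  define t where "t = min (1/2) (\<kappa> / (2 * (real m + 1)))"
  have t: "0 < t" "t \<le> 1/2" "real m * t \<le> \<kappa> / 2"
  proof -
    show "0 < t" using \<kappa> by (simp add: t_def)
    show "t \<le> 1/2" unfolding t_def by (rule min.cobounded1)
    have "real m * t \<le> (real m + 1) * (\<kappa> / (2 * (real m + 1)))"
      using \<kappa> by (intro mult_mono) (auto simp: t_def)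
    also have "\<dots> = \<kappa> / 2" by (simp add: divide_simps)
    finally show "real m * t \<le> \<kappa> / 2" .
  qed
  show ?thesis
  proof (intro exI[of _ "2 * c2 / (\<kappa> * c1 * t powr d)"] conjI ballI allI impI)
    show "0 < 2 * c2 / (\<kappa> * c1 * t powr d)" using c1_pos c2_pos \<kappa> t by simp
    fix x and r :: real and c :: "('n \<Rightarrow> nat) \<Rightarrow> real" assume x: "x \<in> S" and "0 < r \<and> r \<le> 1"
    then have r: "0 < r" "r \<le> 1" by auto
    let ?N = "coeff_norm m c" and ?P = "\<lambda>y. poly_eval m c (rescale x r y)"
    have N0: "0 \<le> ?N" by (rule coeff_norm_nonneg)
    have "\<exists>y\<in>cube x (r / 2) \<inter> S. \<kappa> * ?N \<le> \<bar>?P y\<bar>"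
    proof (rule ccontr)
      assume neg: "\<not> ?thesis"
      then have "coeff_norm m (coeff_scale (1/2) c) \<le> C * (\<kappa> * ?N)"
        using r by (intro sup[OF x, of "r / 2"]) (auto simp: poly_eval_rescale_half[symmetric] not_le dest: less_imp_le)
      then have "2 ^ m * coeff_norm m (coeff_scale (1/2) c) \<le> 2 ^ m * (C * (\<kappa> * ?N))"
        by (intro mult_left_mono) auto
      then have "?N \<le> 2 ^ m * (C * (\<kappa> * ?N))"
        using coeff_norm_scale_half[of m c] by linarith
      also have "\<dots> = ?N / 2" using C by (simp add: \<kappa>_def)
      finally have "?N = 0" using N0 by simp
      then show False using neg x r by (auto simp: cube_self)
    qed
    then obtain y where y: "y \<in> cube x (r / 2)" "y \<in> S" "\<kappa> * ?N \<le> \<bar>?P y\<bar>" by blast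
    have tr: "0 < t * r" "t * r \<le> r / 2" "t * r \<le> 1"
    proof -
      show "0 < t * r" using t r by simp
      show *: "t * r \<le> r / 2" using t r mult_right_mono[of t "1/2" r] by simp
      show "t * r \<le> 1" using * r by linarith
    qed
    have sub: "cube y (t * r) \<subseteq> cube x r" using y tr by (intro cube_subset[of y x "r / 2"]) auto
    have big: "\<kappa> / 2 * ?N \<le> \<bar>?P w\<bar>" if w: "w \<in> cube y (t * r)" for w
    proof -
      have yx: "y \<in> cube x r" using sub tr cube_self[of "t * r" y] by auto
      have le1: "\<bar>rescale x r z $ j\<bar> \<le> 1" if "z \<in> cube x r" for z j
        using that r by (auto simp: mem_cube_iff abs_divide)
      have "\<bar>?P w - ?P y\<bar> \<le> real m * t * ?N"
      proof (rule poly_eval_diff_le)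
        fix j
        have "\<bar>w $ j - y $ j\<bar> \<le> t * r" using w by (auto simp: mem_cube_iff)
        then have "\<bar>(w $ j - y $ j) / r\<bar> \<le> t" using r by (simp add: abs_divide pos_divide_le_eq)
        moreover have "(w $ j - y $ j) / r = rescale x r w $ j - rescale x r y $ j"
          by (simp add: diff_divide_distrib)
        ultimately show "\<bar>rescale x r w $ j - rescale x r y $ j\<bar> \<le> t" by simp
      qed (use le1 yx w sub in auto)
      also have "\<dots> \<le> \<kappa> / 2 * ?N" using t N0 by (intro mult_right_mono)
      finally show ?thesis using y(3) by linarith
    qed
    have "ennreal (\<kappa> / 2 * ?N) * ennreal (c1 * (t * r) powr d) \<le> ennreal (\<kappa> / 2 * ?N) * emeasure M (cube y (t * r))"
      using y tr by (intro mult_left_mono cube_lower) auto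
    also have "\<dots> = (\<integral>\<^sup>+w\<in>cube y (t * r). ennreal (\<kappa> / 2 * ?N) \<partial>M)"
      by (simp add: nn_integral_cmult)
    also have "\<dots> \<le> (\<integral>\<^sup>+w\<in>cube x r. ennreal \<bar>?P w\<bar> \<partial>M)"
      using sub big by (intro nn_integral_mono) (auto simp: indicator_def intro!: ennreal_leI)
    finally have lower: "ennreal (\<kappa> / 2 * ?N) * ennreal (c1 * (t * r) powr d) \<le> (\<integral>\<^sup>+w\<in>cube x r. ennreal \<bar>?P w\<bar> \<partial>M)" .
    have "ennreal ?N * emeasure M (cube x r) \<le> ennreal ?N * ennreal (c2 * r powr d)"
      using x r by (intro mult_left_mono cube_upper) auto
    also have "\<dots> = ennreal (2 * c2 / (\<kappa> * c1 * t powr d)) * (ennreal (\<kappa> / 2 * ?N) * ennreal (c1 * (t * r) powr d))"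
      using N0 c1_pos c2_pos \<kappa> t r
      by (simp add: ennreal_mult'[symmetric] powr_mult mult_nonneg_nonneg field_simps)
    also have "\<dots> \<le> ennreal (2 * c2 / (\<kappa> * c1 * t powr d)) * (\<integral>\<^sup>+w\<in>cube x r. ennreal \<bar>?P w\<bar> \<partial>M)"
      using lower by (intro mult_left_mono) auto
    finally show "ennreal ?N * emeasure M (cube x r)
        \<le> ennreal (2 * c2 / (\<kappa> * c1 * t powr d)) * (\<integral>\<^sup>+y\<in>cube x r. ennreal \<bar>?P y\<bar> \<partial>M)" .
  qed
qed

section \<open>Averages over cubes\<close>

text \<open>The origin need not lie in \<open>S\<close>, so the upper bound does not apply directly;
  compactness reduces the claim to finitely many unit cubes centred on \<open>S\<close>. Local
  finiteness also yields sigma-finiteness.\<close>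

lemma cube_origin_finite: "emeasure M (cube 0 R) < top"
proof -
  have comp: "compact (cube 0 R \<inter> S)"
  proof -
    have "bounded (cube (0::real^'n) R)"
    proof (rule boundedI)
      fix z :: "real^'n" assume "z \<in> cube 0 R"
      then have "(\<Sum>i\<in>UNIV. \<bar>z $ i\<bar>) \<le> (\<Sum>i\<in>(UNIV::'n set). R)"
        by (intro sum_mono) (auto simp: mem_cube_iff)
      then show "norm z \<le> (\<Sum>i\<in>(UNIV::'n set). R)" using norm_le_l1_cart[of z] by linarith
    qed
    then have "bounded (cube 0 R \<inter> S)" by (rule bounded_subset) auto
    then show ?thesis
      by (intro compact_eq_bounded_closed[THEN iffD2] conjI closed_Int closed_cube closed_S)
  qed
  obtain F where F: "F \<subseteq> cube 0 R \<inter> S" "finite F" "cube 0 R \<inter> S \<subseteq> (\<Union>w\<in>F. ball w 1)"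
    by (rule compactE_image[OF comp, of "cube 0 R \<inter> S" "\<lambda>w. ball w 1"]) auto
  have "ball w 1 \<subseteq> cube w 1" for w :: "real^'n"
  proof
    fix z assume "z \<in> ball w 1"
    then have "norm (z - w) \<le> 1" by (simp add: dist_norm norm_minus_commute)
    then have "\<bar>(z - w) $ i\<bar> \<le> 1" for i using component_le_norm_cart[of "z - w" i] by linarith
    then show "z \<in> cube w 1" by (simp add: mem_cube_iff)
  qed
  then have sub: "cube 0 R \<inter> S \<subseteq> (\<Union>w\<in>F. cube w 1)" using F by blast
  have "emeasure M (cube 0 R) = emeasure M (cube 0 R \<inter> S)" by (simp add: emeasure_Int_S)
  also have "\<dots> \<le> emeasure M (\<Union>w\<in>F. cube w 1)"
    using F by (intro emeasure_mono sub sets.finite_UN) auto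
  also have "\<dots> \<le> (\<Sum>w\<in>F. emeasure M (cube w 1))" using F by (intro emeasure_subadditive_finite) auto
  also have "\<dots> < top" using F cube_finite[of _ 1] by (auto simp: subset_eq)
  finally show ?thesis .
qed

lemma UN_cube_origin: "(\<Union>N::nat. cube 0 (real N)) = (UNIV :: (real^'n) set)"
proof -
  have "\<exists>N::nat. z \<in> cube 0 (real N)" for z :: "real^'n"
  proof -
    obtain N :: nat where "norm z \<le> real N" using real_arch_simple by blast
    then have "\<bar>z $ i\<bar> \<le> real N" for i using component_le_norm_cart[of z i] by linarith
    then show ?thesis by (auto simp: mem_cube_iff)
  qed
  then show ?thesis by auto
qed

lemma sigma_finite_M: "sigma_finite_measure M"
  by (unfold_locales, rule exI[of _ "range (\<lambda>N::nat. cube 0 (real N))"])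
    (use UN_cube_origin cube_origin_finite in \<open>auto simp: less_top\<close>)

lemma pair_sigma_finite_M: "pair_sigma_finite M M"
  using sigma_finite_M by (simp add: pair_sigma_finite_def)

lemma Fubini_M:
  assumes "case_prod f \<in> borel_measurable (borel \<Otimes>\<^sub>M borel)"
  shows "(\<integral>\<^sup>+y. \<integral>\<^sup>+x. f x y \<partial>M \<partial>M) = (\<integral>\<^sup>+x. \<integral>\<^sup>+y. f x y \<partial>M \<partial>M)"
proof -
  have "case_prod f \<in> borel_measurable (M \<Otimes>\<^sub>M M)"
    using assms by (simp cong: measurable_cong_sets add: sets_pair_measure_cong[OF sets_M sets_M])
  then show ?thesis by (rule pair_sigma_finite.Fubini'[OF pair_sigma_finite_M])
qed

text \<open>Joint measurability in centre, radius and point is what Fubini's theorem and the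
  integration over scales require.\<close>

lemma cube_indicator_measurable [measurable (raw)]:
  assumes [measurable]: "f \<in> N \<rightarrow>\<^sub>M borel" "g \<in> N \<rightarrow>\<^sub>M borel" "h \<in> borel_measurable N"
  shows "(\<lambda>z. indicator (cube (f z) (h z)) (g z :: real^'n) :: ennreal) \<in> borel_measurable N"
proof -
  have "(\<lambda>z. indicator (cube (f z) (h z)) (g z) :: ennreal)
      = (\<lambda>z. if \<forall>i. \<bar>g z $ i - f z $ i\<bar> \<le> h z then 1 else 0)"
    by (auto simp: indicator_def mem_cube_iff)
  moreover have "{z \<in> space N. \<forall>i\<in>UNIV. \<bar>g z $ i - f z $ i\<bar> \<le> h z} \<in> sets N"
    by (intro sets.sets_Collect_finite_All borel_measurable_le borel_measurable_abs borel_measurable_diff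
      measurable_compose[OF _ borel_measurable_nth] assms) auto
  then have "(\<lambda>z. if \<forall>i. \<bar>g z $ i - f z $ i\<bar> \<le> h z then 1 else 0 :: ennreal) \<in> borel_measurable N"
    by (intro measurable_If) auto
  ultimately show ?thesis by simp
qed

lemma emeasure_cube_measurable [measurable (raw)]:
  assumes [measurable]: "f \<in> N \<rightarrow>\<^sub>M borel" "h \<in> borel_measurable N"
  shows "(\<lambda>z. emeasure M (cube (f z :: real^'n) (h z))) \<in> borel_measurable N"
proof -
  interpret sigma_finite_measure M by (rule sigma_finite_M)
  have "(\<lambda>z. \<integral>\<^sup>+y. indicator (cube (f z) (h z)) y \<partial>M) \<in> borel_measurable N"
    by (rule borel_measurable_nn_integral) measurable
  then show ?thesis by simp
qed

text \<open>Encoding the average as an integral over \<open>uniform_measure\<close> makes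
  additivity, monotonicity and Jensen's inequality instances of facts about integrals. The
  regularity bounds apply at centres in \<open>S\<close>, whose complement is null.\<close>

definition avg :: "real^'n \<Rightarrow> real \<Rightarrow> (real^'n \<Rightarrow> ennreal) \<Rightarrow> ennreal" where
  "avg x t h = (\<integral>\<^sup>+y. h y \<partial>uniform_measure M (cube x t))"

lemma avg_eq: "h \<in> borel_measurable borel \<Longrightarrow> avg x t h = (\<integral>\<^sup>+y\<in>cube x t. h y \<partial>M) / emeasure M (cube x t)"
  unfolding avg_def by (intro nn_integral_uniform_measure) auto

lemma avg_mono_AE: "AE y in M. y \<in> cube x t \<longrightarrow> g y \<le> h y \<Longrightarrow> avg x t g \<le> avg x t h"
  unfolding avg_def by (intro nn_integral_mono_AE AE_uniform_measureI) auto

lemma avg_mono: "(\<And>y. y \<in> cube x t \<Longrightarrow> g y \<le> h y) \<Longrightarrow> avg x t g \<le> avg x t h"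
  by (intro avg_mono_AE) auto

lemma emeasure_uniform_UNIV:
  "x \<in> S \<Longrightarrow> 0 < t \<Longrightarrow> t \<le> 1 \<Longrightarrow> emeasure (uniform_measure M (cube x t)) UNIV = 1"
  using cube_pos[of x t] cube_finite[of x t]
  by (subst emeasure_uniform_measure) (auto simp: less_top)

lemma avg_const: "x \<in> S \<Longrightarrow> 0 < t \<Longrightarrow> t \<le> 1 \<Longrightarrow> avg x t (\<lambda>_. c) = c"
  unfolding avg_def by (simp add: emeasure_uniform_UNIV del: emeasure_uniform_measure)

lemma avg_add:
  "g \<in> borel_measurable borel \<Longrightarrow> h \<in> borel_measurable borel \<Longrightarrow> avg x t (\<lambda>y. g y + h y) = avg x t g + avg x t h"
  unfolding avg_def by (intro nn_integral_add) auto

lemma avg_cmult: "h \<in> borel_measurable borel \<Longrightarrow> avg x t (\<lambda>y. c * h y) = c * avg x t h"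
  unfolding avg_def by (intro nn_integral_cmult) auto

lemma avg_Jensen:
  assumes "h \<in> borel_measurable borel" "1 \<le> p" "x \<in> S" "0 < t" "t \<le> 1"
  shows "avg x t h epowr p \<le> avg x t (\<lambda>y. h y epowr p)"
  using nn_integral_Jensen[of h "uniform_measure M (cube x t)" p] assms
  by (simp add: avg_def emeasure_uniform_UNIV ennreal_powr_def[of 1] del: emeasure_uniform_measure cong: measurable_cong_sets)

lemma avg_measurable [measurable (raw)]:
  assumes [measurable]: "case_prod h \<in> borel_measurable (N \<Otimes>\<^sub>M borel)" "f \<in> N \<rightarrow>\<^sub>M borel" "r \<in> borel_measurable N"
  shows "(\<lambda>z. avg (f z) (r z) (h z)) \<in> borel_measurable N"
proof -
  interpret sigma_finite_measure M by (rule sigma_finite_M)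
  have [measurable]: "case_prod h \<in> borel_measurable (N \<Otimes>\<^sub>M M)"
    using assms(1) by (simp cong: measurable_cong_sets add: sets_pair_measure_cong[OF refl sets_M])
  have "avg (f z) (r z) (h z) = (\<integral>\<^sup>+y. h z y * indicator (cube (f z) (r z)) y \<partial>M) / emeasure M (cube (f z) (r z))"
    if "z \<in> space N" for z
    using that by (intro avg_eq) measurable
  moreover have "(\<lambda>z. (\<integral>\<^sup>+y. h z y * indicator (cube (f z) (r z)) y \<partial>M) / emeasure M (cube (f z) (r z))) \<in> borel_measurable N"
    by measurable
  ultimately show ?thesis by (simp cong: measurable_cong)
qed

text \<open>Two-sided regularity bounds the ratio of the measures of the two cubes by
  \<open>c2 / c1 * (t / s) powr d\<close>, hence the constant.\<close>

lemma avg_doubling: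
  "\<exists>C>0. \<forall>x\<in>S. \<forall>y\<in>S. \<forall>s t h. 0 < s \<and> s \<le> 1 \<and> t \<le> 1 \<and> 0 < t \<and> t \<le> 4 * s \<and> cube y s \<subseteq> cube x t \<and> h \<in> borel_measurable borel
     \<longrightarrow> avg y s h \<le> ennreal C * avg x t h"
proof (intro exI[of _ "4 powr d * c2 / c1"] conjI ballI allI impI)
  show "0 < 4 powr d * c2 / c1" using c1_pos c2_pos by simp
  fix x y s t and h :: "real^'n \<Rightarrow> ennreal"
  assume xy: "x \<in> S" "y \<in> S" and st: "0 < s \<and> s \<le> 1 \<and> t \<le> 1 \<and> 0 < t \<and> t \<le> 4 * s \<and> cube y s \<subseteq> cube x t \<and> h \<in> borel_measurable borel"
  have d0: "0 \<le> d" using dim_gt zero_less_card_finite[where 'a='n] by linarith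
  let ?A = "\<integral>\<^sup>+z\<in>cube x t. h z \<partial>M"
  have "avg y s h = (\<integral>\<^sup>+z\<in>cube y s. h z \<partial>M) / emeasure M (cube y s)" using st by (intro avg_eq) auto
  also have "\<dots> \<le> ?A / ennreal (c1 * s powr d)"
  proof -
    have "(\<integral>\<^sup>+z\<in>cube y s. h z \<partial>M) \<le> ?A"
      using st by (intro nn_integral_mono) (auto simp: indicator_def)
    moreover have "ennreal (c1 * s powr d) \<le> emeasure M (cube y s)" using st xy by (intro cube_lower) auto
    ultimately show ?thesis by (intro divide_mono_ennreal)
  qed
  also have "\<dots> = ennreal (1 / (c1 * s powr d)) * ?A"
    using c1_pos st by (simp add: divide_ennreal_def inverse_ennreal mult.commute inverse_eq_divide)
  also have "\<dots> \<le> ennreal (4 powr d * c2 / c1 * (1 / (c2 * t powr d))) * ?A"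
  proof (intro mult_right_mono ennreal_leI)
    have "t powr d \<le> (4 * s) powr d" using st d0 by (intro powr_mono2) auto
    then have "t powr d \<le> 4 powr d * s powr d" using st by (simp add: powr_mult)
    then show "1 / (c1 * s powr d) \<le> 4 powr d * c2 / c1 * (1 / (c2 * t powr d))"
      using c1_pos c2_pos st by (simp add: field_simps)
  qed simp
  also have "\<dots> = ennreal (4 powr d * c2 / c1) * (?A / ennreal (c2 * t powr d))"
    using c1_pos c2_pos st by (subst ennreal_mult) (auto simp: divide_ennreal_def inverse_ennreal inverse_eq_divide mult_ac)
  also have "\<dots> \<le> ennreal (4 powr d * c2 / c1) * (?A / emeasure M (cube x t))"
    using st xy by (intro mult_left_mono divide_mono_ennreal cube_upper) auto
  also have "?A / emeasure M (cube x t) = avg x t h" using st by (intro avg_eq[symmetric]) auto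
  finally show "avg y s h \<le> ennreal (4 powr d * c2 / c1) * avg x t h" .
qed

lemma coeff_norm_avg:
  "\<exists>C>0. \<forall>x\<in>S. \<forall>r. 0 < r \<and> r \<le> 1 \<longrightarrow> (\<forall>c. ennreal (coeff_norm m c) \<le> ennreal C * avg x r (\<lambda>y. ennreal \<bar>poly_eval m c (rescale x r y)\<bar>))"
proof -
  obtain C where C: "C > 0" and rem: "\<And>x r c. x \<in> S \<Longrightarrow> 0 < r \<Longrightarrow> r \<le> 1 \<Longrightarrow> ennreal (coeff_norm m c) * emeasure M (cube x r)
     \<le> ennreal C * (\<integral>\<^sup>+y\<in>cube x r. ennreal \<bar>poly_eval m c (rescale x r y)\<bar> \<partial>M)"
    using remez_average[of m] by blast
  show ?thesis
  proof (intro exI[of _ C] conjI ballI allI impI C)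
    fix x c and r :: real assume x: "x \<in> S" and r: "0 < r \<and> r \<le> 1"
    let ?h = "\<lambda>y. ennreal \<bar>poly_eval m c (rescale x r y)\<bar>"
    have [measurable]: "(\<lambda>y. poly_eval m c (rescale x r y)) \<in> borel_measurable borel"
      using poly_eval_rescale_in_polys by (rule borel_measurable_polys)
    have "ennreal (coeff_norm m c) = ennreal (coeff_norm m c) * emeasure M (cube x r) / emeasure M (cube x r)"
      using x r cube_pos[of x r] cube_finite[of x r] by (subst ennreal_mult_divide_eq) auto
    also have "\<dots> \<le> ennreal C * (\<integral>\<^sup>+y\<in>cube x r. ?h y \<partial>M) / emeasure M (cube x r)"
      using x r by (intro divide_right_mono_ennreal rem) auto
    also have "\<dots> = ennreal C * avg x r ?h"
      by (subst avg_eq) (auto simp: ennreal_times_divide)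
    finally show "ennreal (coeff_norm m c) \<le> ennreal C * avg x r ?h" .
  qed
qed

text \<open>Both estimates pass through the coefficients in the coordinates of
  \<open>cube x r\<close>. For the second, \<open>T\<close> keeps the monomials of degree at most
  \<open>l\<close>; each discarded one is at most \<open>(t / r) ^ Suc l\<close> on
  \<open>cube x t\<close>. The same \<open>T\<close> serves all \<open>t \<le> r\<close>.\<close>

lemma poly_bounds:
  assumes "l \<le> m"
  shows "\<exists>C>0. \<forall>P\<in>polys (int m). \<forall>x\<in>S. \<forall>r. 0 < r \<and> r \<le> 1 \<longrightarrow>
      (\<forall>y\<in>cube x r. ennreal \<bar>P y\<bar> \<le> ennreal C * avg x r (\<lambda>y. ennreal \<bar>P y\<bar>)) \<and>
      (\<exists>T\<in>polys (int l). \<forall>t. 0 < t \<and> t \<le> r \<longrightarrow> (\<forall>y\<in>cube x t.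
         ennreal \<bar>P y - T y\<bar> \<le> ennreal (C * (t / r) ^ Suc l) * avg x r (\<lambda>y. ennreal \<bar>P y\<bar>)))"
proof -
  obtain C where C: "C > 0" and cn: "\<And>x r c. x \<in> S \<Longrightarrow> 0 < r \<Longrightarrow> r \<le> 1 \<Longrightarrow> ennreal (coeff_norm m c)
      \<le> ennreal C * avg x r (\<lambda>y. ennreal \<bar>poly_eval m c (rescale x r y)\<bar>)"
    using coeff_norm_avg[of m] by blast
  show ?thesis
  proof (intro exI[of _ C] conjI ballI allI impI C)
    fix P :: "real^'n \<Rightarrow> real" and x and r :: real
    assume P: "P \<in> polys (int m)" and x: "x \<in> S" and r: "0 < r \<and> r \<le> 1"
    from P r obtain c where c: "\<And>y. P y = poly_eval m c (rescale x r y)"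
      by (auto elim: polys_coeffs[of P m r x])
    let ?A = "avg x r (\<lambda>y. ennreal \<bar>P y\<bar>)"
    have cnP: "ennreal (coeff_norm m c) \<le> ennreal C * ?A"
      using cn[OF x, of r c] r by (simp add: c)
    have le: "\<bar>rescale x r z $ j\<bar> \<le> t / r" if "z \<in> cube x t" for z j t
      using that r by (auto simp: mem_cube_iff abs_divide intro: divide_right_mono)
    show "ennreal \<bar>P y\<bar> \<le> ennreal C * ?A" if "y \<in> cube x r" for y
    proof -
      have "\<bar>P y\<bar> \<le> coeff_norm m c"
        unfolding c using le[OF that] r by (intro abs_poly_eval_le) auto
      then show ?thesis using cnP by (meson ennreal_leI order_trans)
    qed
    define T where "T = (\<lambda>y. poly_eval l c (rescale x r y))"
    have "ennreal \<bar>P y - T y\<bar> \<le> ennreal (C * (t / r) ^ Suc l) * ?A"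
      if t: "0 < t" "t \<le> r" and y: "y \<in> cube x t" for t y
    proof -
      let ?z = "rescale x r y"
      have tr: "0 \<le> t / r" "t / r \<le> 1" using t r by auto
      have sub: "midx l \<subseteq> (midx m :: ('n \<Rightarrow> nat) set)" using assms by (auto simp: midx_def)
      have "P y - T y = (\<Sum>a\<in>midx m - midx l. c a * monom_fun a ?z)"
        unfolding c T_def poly_eval_def by (subst sum_diff[OF _ sub]) auto
      also have "\<bar>\<dots>\<bar> \<le> (\<Sum>a\<in>midx m - midx l. \<bar>c a\<bar> * (t / r) ^ Suc l)"
      proof (intro order_trans[OF sum_abs] sum_mono)
        fix a :: "'n \<Rightarrow> nat" assume "a \<in> midx m - midx l"
        then have "Suc l \<le> (\<Sum>i\<in>UNIV. a i)" by (auto simp: midx_def)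
        then have "(t / r) ^ (\<Sum>i\<in>UNIV. a i) \<le> (t / r) ^ Suc l" using tr by (intro power_decreasing) auto
        then have "\<bar>monom_fun a ?z\<bar> \<le> (t / r) ^ Suc l"
          using abs_monom_fun_le[of ?z "t / r" a, OF le[OF y] tr(1)] by linarith
        then show "\<bar>c a * monom_fun a ?z\<bar> \<le> \<bar>c a\<bar> * (t / r) ^ Suc l"
          unfolding abs_mult by (intro mult_left_mono) auto
      qed
      also have "\<dots> \<le> (t / r) ^ Suc l * coeff_norm m c"
      proof -
        have "(\<Sum>a\<in>midx m - midx l. \<bar>c a\<bar> * (t / r) ^ Suc l) \<le> (\<Sum>a\<in>midx m. \<bar>c a\<bar> * (t / r) ^ Suc l)"
          using tr by (intro sum_mono2 mult_nonneg_nonneg zero_le_power) auto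
        then show ?thesis unfolding coeff_norm_def sum_distrib_left by (simp only: mult.commute)
      qed
      finally have "ennreal \<bar>P y - T y\<bar> \<le> ennreal ((t / r) ^ Suc l * coeff_norm m c)" by (rule ennreal_leI)
      also have "\<dots> = ennreal ((t / r) ^ Suc l) * ennreal (coeff_norm m c)"
        using tr coeff_norm_nonneg[of m c] by (intro ennreal_mult zero_le_power)
      also have "\<dots> \<le> ennreal ((t / r) ^ Suc l) * (ennreal C * ?A)" by (intro mult_left_mono cnP) auto
      also have "\<dots> = ennreal (C * (t / r) ^ Suc l) * ?A"
      proof -
        have "ennreal (C * (t / r) ^ Suc l) = ennreal C * ennreal ((t / r) ^ Suc l)"
          using C tr by (intro ennreal_mult zero_le_power) auto
        then show ?thesis by (simp only: mult_ac)
      qed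
      finally show ?thesis .
    qed
    moreover have "T \<in> polys (int l)" unfolding T_def by (rule poly_eval_rescale_in_polys)
    ultimately show "\<exists>T\<in>polys (int l). \<forall>t. 0 < t \<and> t \<le> r \<longrightarrow> (\<forall>y\<in>cube x t.
         ennreal \<bar>P y - T y\<bar> \<le> ennreal (C * (t / r) ^ Suc l) * ?A)"
      by (intro bexI[of _ T]) auto
  qed
qed

section \<open>Near-minimisers of the local best approximation\<close>

text \<open>Only rational coefficients are admitted, which makes \<open>err\<close> measurable; by density this does not
  change the infimum at points of \<open>S\<close>.\<close>

definition rat_polys :: "nat \<Rightarrow> (real^'n \<Rightarrow> real) set" where
  "rat_polys m = poly_eval m ` PiE (midx m) (\<lambda>_. \<rat>)"

abbreviation dev :: "real^'n \<Rightarrow> real \<Rightarrow> (real^'n \<Rightarrow> real) \<Rightarrow> (real^'n \<Rightarrow> real) \<Rightarrow> ennreal" where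
  "dev x t f g \<equiv> avg x t (\<lambda>y. ennreal \<bar>f y - g y\<bar>)"

definition err :: "nat \<Rightarrow> (real^'n \<Rightarrow> real) \<Rightarrow> real^'n \<Rightarrow> real \<Rightarrow> ennreal" where
  "err m f x t = (INF P\<in>rat_polys m. dev x t f P)"

lemma countable_rat_polys: "countable (rat_polys m)"
  unfolding rat_polys_def by (intro countable_image countable_PiE finite_midx countable_rat)

lemma rat_polys_subset: "rat_polys m \<subseteq> polys (int m)"
  by (auto simp: rat_polys_def polys_eq_range)

lemma rat_polys_borel: "P \<in> rat_polys m \<Longrightarrow> P \<in> borel_measurable borel"
  using rat_polys_subset borel_measurable_polys by blast

lemma rat_polys_dense:
  assumes P: "P \<in> polys (int m)" and e: "0 < e"
  shows "\<exists>Q\<in>rat_polys m. \<forall>y\<in>cube x t. \<bar>P y - Q y\<bar> \<le> e"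
proof -
  obtain c where c: "P = poly_eval m c" using P by (auto simp: polys_eq_range)
  define R where "R = max 1 (Max (range (\<lambda>i. \<bar>x $ i\<bar>)) + \<bar>t\<bar>)"
  have R: "1 \<le> R" "\<bar>x $ i\<bar> + \<bar>t\<bar> \<le> R" for i
  proof -
    have "\<bar>x $ i\<bar> \<le> Max (range (\<lambda>i. \<bar>x $ i\<bar>))" by (intro Max_ge) auto
    then show "\<bar>x $ i\<bar> + \<bar>t\<bar> \<le> R" unfolding R_def le_max_iff_disj by simp
  qed (simp add: R_def)
  define K where "K = real (card (midx m :: ('n \<Rightarrow> nat) set)) * R ^ m"
  have K: "0 \<le> K" using R(1) unfolding K_def by (intro mult_nonneg_nonneg zero_le_power) auto
  define \<delta> where "\<delta> = e / (K + 1)"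
  have \<delta>: "0 < \<delta>" using e K by (simp add: \<delta>_def)
  have "\<exists>q\<in>\<rat>. c a < q \<and> q < c a + \<delta>" for a using \<delta> by (intro Rats_dense_in_real) simp
  then obtain q where q: "\<And>a. q a \<in> \<rat>" "\<And>a. c a < q a" "\<And>a. q a < c a + \<delta>" by metis
  show ?thesis
  proof (rule bexI[of _ "poly_eval m (restrict q (midx m))"], rule ballI)
    show "poly_eval m (restrict q (midx m)) \<in> rat_polys m"
      unfolding rat_polys_def using q by (intro imageI) auto
    fix y assume y: "y \<in> cube x t"
    have yR: "\<bar>y $ i\<bar> \<le> R" for i
      using y R(2)[of i] by (auto simp: mem_cube_iff dest!: spec[of _ i])
    have "\<bar>P y - poly_eval m (restrict q (midx m)) y\<bar> = \<bar>\<Sum>a\<in>midx m. (c a - q a) * monom_fun a y\<bar>"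
      by (simp add: c poly_eval_def sum_subtractf left_diff_distrib)
    also have "\<dots> \<le> (\<Sum>a\<in>(midx m :: ('n \<Rightarrow> nat) set). \<delta> * R ^ m)"
    proof (intro order_trans[OF sum_abs] sum_mono)
      fix a :: "'n \<Rightarrow> nat" assume "a \<in> midx m"
      then have "R ^ (\<Sum>i\<in>UNIV. a i) \<le> R ^ m" using R by (intro power_increasing) (auto simp: midx_def)
      then have "\<bar>monom_fun a y\<bar> \<le> R ^ m"
        using abs_monom_fun_le[OF yR, of a] R(1) by linarith
      moreover have "\<bar>c a - q a\<bar> \<le> \<delta>" using q(2,3)[of a] by linarith
      ultimately show "\<bar>(c a - q a) * monom_fun a y\<bar> \<le> \<delta> * R ^ m"
        unfolding abs_mult using \<delta> by (intro mult_mono) auto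
    qed
    also have "\<dots> = \<delta> * K" by (simp add: K_def)
    also have "\<dots> \<le> e" using e K by (simp add: \<delta>_def field_simps)
    finally show "\<bar>P y - poly_eval m (restrict q (midx m)) y\<bar> \<le> e" .
  qed
qed

lemma avg_triangle:
  assumes [measurable]: "f \<in> borel_measurable borel" "g \<in> borel_measurable borel" "h \<in> borel_measurable borel"
  shows "dev x t f h \<le> dev x t f g + dev x t g h"
proof -
  have "dev x t f h \<le> avg x t (\<lambda>y. ennreal \<bar>f y - g y\<bar> + ennreal \<bar>g y - h y\<bar>)"
    by (intro avg_mono) (simp flip: ennreal_plus add: ennreal_leI)
  also have "\<dots> = dev x t f g + dev x t g h"
    by (intro avg_add) measurable
  finally show ?thesis .
qed

lemma err_le:
  assumes f: "f \<in> borel_measurable borel" and P: "P \<in> polys (int m)" and x: "x \<in> S" "0 < t" "t \<le> 1"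
  shows "err m f x t \<le> dev x t f P"
proof (rule ennreal_le_epsilon)
  fix e :: real assume e: "0 < e"
  obtain Q where Q: "Q \<in> rat_polys m" "\<forall>y\<in>cube x t. \<bar>P y - Q y\<bar> \<le> e"
    using rat_polys_dense[OF P e] by blast
  have "err m f x t \<le> dev x t f Q"
    unfolding err_def by (intro INF_lower Q)
  also have "\<dots> \<le> dev x t f P + dev x t P Q"
    by (intro avg_triangle f borel_measurable_polys[OF P] rat_polys_borel[OF Q(1)])
  also have "dev x t P Q \<le> avg x t (\<lambda>_. ennreal e)"
    using Q(2) by (intro avg_mono ennreal_leI) auto
  also have "\<dots> = ennreal e" using x by (rule avg_const)
  finally show "err m f x t \<le> dev x t f P + ennreal e" by (simp add: add_left_mono)
qed

lemma err_measurable [measurable (raw)]: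
  assumes [measurable]: "f \<in> borel_measurable borel" "g \<in> N \<rightarrow>\<^sub>M borel" "r \<in> borel_measurable N"
  shows "(\<lambda>z. err m f (g z) (r z)) \<in> borel_measurable N"
  unfolding err_def
proof (intro borel_measurable_INF countable_rat_polys)
  fix P :: "real^'n \<Rightarrow> real" assume "P \<in> rat_polys m"
  then have [measurable]: "P \<in> borel_measurable borel" by (rule rat_polys_borel)
  show "(\<lambda>z. avg (g z) (r z) (\<lambda>y. ennreal \<bar>f y - P y\<bar>)) \<in> borel_measurable N" by measurable
qed

text \<open>For a positive finite infimum the factor 2 leaves room, and for an infinite one every
  polynomial qualifies. An infimum of zero has to be attained: the coefficients of a minimising
  sequence are Cauchy by the Remez bound, and their limit has deviation zero.\<close>

lemma near_minimizer:
  assumes f [measurable]: "f \<in> borel_measurable borel" and x: "x \<in> S" and t: "0 < t" "t \<le> 1"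
  shows "\<exists>P\<in>polys (int m). dev x t f P \<le> 2 * err m f x t"
proof (cases "err m f x t = 0")
  case False
  show ?thesis
  proof (cases "err m f x t = top")
    case True
    then show ?thesis using zero_in_polys[of "int m"] by (intro bexI) (auto simp: ennreal_mult_top)
  next
    case fin: False
    have "err m f x t < 2 * err m f x t"
      using False fin by (metis ennreal_add_left_cancel_less add.right_neutral mult_2 infinity_ennreal_def zero_less_iff_neq_zero)
    then obtain P where "P \<in> rat_polys m" "dev x t f P < 2 * err m f x t"
      using INF_less_iff[of "\<lambda>P. dev x t f P" "rat_polys m"] unfolding err_def by blast
    then show ?thesis using rat_polys_subset by (intro bexI[of _ P]) auto
  qed
next
  case True
  obtain C where C: "C > 0" and cn: "\<And>c. ennreal (coeff_norm m c) \<le> ennreal C * avg x t (\<lambda>y. ennreal \<bar>poly_eval m c (rescale x t y)\<bar>)"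
    using coeff_norm_avg[of m] x t by blast
  have "\<exists>P\<in>polys (int m). dev x t f P < ennreal ((1/2) ^ j)" for j
  proof -
    have "err m f x t < ennreal ((1/2) ^ j)" using True by simp
    then show ?thesis unfolding err_def INF_less_iff using rat_polys_subset by blast
  qed
  then have "\<exists>c. avg x t (\<lambda>y. ennreal \<bar>f y - poly_eval m c (rescale x t y)\<bar>) < ennreal ((1/2) ^ j)" for j
  proof -
    obtain P where P: "P \<in> polys (int m)" "dev x t f P < ennreal ((1/2) ^ j)"
      using \<open>\<And>j. \<exists>P\<in>polys (int m). dev x t f P < ennreal ((1/2) ^ j)\<close> by blast
    have "t \<noteq> 0" using t by simp
    from polys_coeffs[OF P(1) this] obtain c where "\<And>y. P y = poly_eval m c (rescale x t y)" by blast
    then show ?thesis using P(2) by auto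
  qed
  then obtain c where c: "\<And>j. avg x t (\<lambda>y. ennreal \<bar>f y - poly_eval m (c j) (rescale x t y)\<bar>) < ennreal ((1/2) ^ j)"
    by metis
  have PM [measurable]: "(\<lambda>y. poly_eval m c (rescale x t y)) \<in> borel_measurable borel" for c
    by (rule borel_measurable_polys[OF poly_eval_rescale_in_polys])
  have diff: "poly_eval m c z - poly_eval m c' z = poly_eval m (\<lambda>a. c a - c' a) z" for c c' and z :: "real^'n"
    by (simp add: poly_eval_def sum_subtractf left_diff_distrib)
  have cauchy: "coeff_norm m (\<lambda>a. c i a - c j a) \<le> C * ((1/2) ^ i + (1/2) ^ j)" for i j
  proof -
    have "ennreal (coeff_norm m (\<lambda>a. c i a - c j a))
        \<le> ennreal C * avg x t (\<lambda>y. ennreal \<bar>poly_eval m (c i) (rescale x t y) - poly_eval m (c j) (rescale x t y)\<bar>)"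
      using cn[of "\<lambda>a. c i a - c j a"] by (simp add: diff)
    also have "\<dots> \<le> ennreal C * (avg x t (\<lambda>y. ennreal \<bar>poly_eval m (c i) (rescale x t y) - f y\<bar>)
        + avg x t (\<lambda>y. ennreal \<bar>f y - poly_eval m (c j) (rescale x t y)\<bar>))"
      by (intro mult_left_mono avg_triangle PM f) auto
    also have "\<dots> \<le> ennreal C * (ennreal ((1/2) ^ i) + ennreal ((1/2) ^ j))"
      using c[of i] c[of j] by (intro mult_left_mono add_mono) (auto simp: abs_minus_commute less_imp_le)
    also have "\<dots> = ennreal (C * ((1/2) ^ i + (1/2) ^ j))"
      using C by (simp add: ennreal_mult ennreal_plus)
    finally show ?thesis using C by (subst (asm) ennreal_le_iff) auto
  qed
  have cle: "\<bar>c i a - c j a\<bar> \<le> C * ((1/2) ^ i + (1/2) ^ j)" if "a \<in> midx m" for a i j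
    using cauchy[of i j] member_le_sum[of a "midx m" "\<lambda>a. \<bar>c i a - c j a\<bar>"] that
    by (simp add: coeff_norm_def)
  have lim0: "(\<lambda>j. C * ((1/2::real) ^ i + (1/2) ^ j)) \<longlonglongrightarrow> C * ((1/2) ^ i + 0)" for i
    by (intro tendsto_intros LIMSEQ_realpow_zero) auto
  have "convergent (\<lambda>j. c j a)" if a: "a \<in> midx m" for a
  proof -
    have "Cauchy (\<lambda>j. c j a)"
    proof (rule metric_CauchyI)
      fix e :: real assume e: "0 < e"
      have "(\<lambda>j. C * (1/2::real) ^ j) \<longlonglongrightarrow> C * 0"
        by (intro tendsto_intros LIMSEQ_realpow_zero) auto
      then have "\<forall>\<^sub>F j in sequentially. C * (1/2) ^ j < e / 2"
        using e by (intro order_tendstoD(2)) auto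
      then obtain N where N: "\<And>j. j \<ge> N \<Longrightarrow> C * (1/2) ^ j < e / 2" by (auto simp: eventually_sequentially)
      have "dist (c i a) (c j a) < e" if "i \<ge> N" "j \<ge> N" for i j
        using cle[OF a, of i j] N[OF that(1)] N[OF that(2)] by (simp add: dist_real_def distrib_left)
      then show "\<exists>N. \<forall>i\<ge>N. \<forall>j\<ge>N. dist (c i a) (c j a) < e" by blast
    qed
    then show ?thesis by (rule real_Cauchy_convergent)
  qed
  then have lim: "(\<lambda>j. c j a) \<longlonglongrightarrow> lim (\<lambda>j. c j a)" if "a \<in> midx m" for a
    using that by (simp add: convergent_LIMSEQ_iff)
  define b where "b a = lim (\<lambda>j. c j a)" for a
  have "(\<lambda>j. coeff_norm m (\<lambda>a. c j a - b a)) \<longlonglongrightarrow> (\<Sum>a\<in>midx m. \<bar>b a - b a\<bar>)"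
    unfolding coeff_norm_def using lim by (intro tendsto_intros) (auto simp: b_def)
  then have "(\<lambda>j. (1/2) ^ j + coeff_norm m (\<lambda>a. c j a - b a)) \<longlonglongrightarrow> 0 + 0"
    by (intro tendsto_add LIMSEQ_realpow_zero) auto
  then have to0: "(\<lambda>j. ennreal ((1/2) ^ j + coeff_norm m (\<lambda>a. c j a - b a))) \<longlonglongrightarrow> ennreal 0"
    by (intro tendsto_ennrealI) simp
  have bnd: "avg x t (\<lambda>y. ennreal \<bar>f y - poly_eval m b (rescale x t y)\<bar>) \<le> ennreal ((1/2) ^ j + coeff_norm m (\<lambda>a. c j a - b a))" for j
  proof -
    have "avg x t (\<lambda>y. ennreal \<bar>f y - poly_eval m b (rescale x t y)\<bar>)
      \<le> avg x t (\<lambda>y. ennreal \<bar>f y - poly_eval m (c j) (rescale x t y)\<bar>)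
        + avg x t (\<lambda>y. ennreal \<bar>poly_eval m (c j) (rescale x t y) - poly_eval m b (rescale x t y)\<bar>)"
      by (intro avg_triangle PM f)
    also have "\<dots> \<le> ennreal ((1/2) ^ j) + avg x t (\<lambda>_. ennreal (coeff_norm m (\<lambda>a. c j a - b a)))"
    proof (intro add_mono avg_mono ennreal_leI)
      fix y assume "y \<in> cube x t"
      then show "\<bar>poly_eval m (c j) (rescale x t y) - poly_eval m b (rescale x t y)\<bar> \<le> coeff_norm m (\<lambda>a. c j a - b a)"
        unfolding diff using t by (intro abs_poly_eval_le) (auto simp: mem_cube_iff)
    qed (use c[of j] in \<open>simp add: less_imp_le\<close>)
    also have "\<dots> = ennreal ((1/2) ^ j + coeff_norm m (\<lambda>a. c j a - b a))"
      unfolding avg_const[OF x t] by (intro ennreal_plus[symmetric] coeff_norm_nonneg) simp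
    finally show ?thesis .
  qed
  have "avg x t (\<lambda>y. ennreal \<bar>f y - poly_eval m b (rescale x t y)\<bar>) \<le> ennreal 0"
    using to0 by (rule LIMSEQ_le_const) (auto intro: bnd)
  then show ?thesis
    using poly_eval_rescale_in_polys[of m b x t]
    by (intro bexI[of _ "\<lambda>y. poly_eval m b (rescale x t y)"]) auto
qed

definition near_min :: "nat \<Rightarrow> (real^'n \<Rightarrow> real) \<Rightarrow> real^'n \<Rightarrow> real \<Rightarrow> (real^'n \<Rightarrow> real) \<Rightarrow> bool" where
  "near_min m f x t P \<longleftrightarrow> P \<in> polys (int m) \<and> dev x t f P \<le> 2 * err m f x t"

lemma near_min_exists:
  "f \<in> borel_measurable borel \<Longrightarrow> x \<in> S \<Longrightarrow> 0 < t \<Longrightarrow> t \<le> 1 \<Longrightarrow> \<exists>P. near_min m f x t P"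
  unfolding near_min_def using near_minimizer by blast

text \<open>On the small cube \<open>P\<close> and \<open>Q\<close> are compared through
  \<open>f\<close>. As \<open>Q\<close> competes with \<open>P\<close> there, their distance is at
  most three times the deviation of \<open>Q\<close>, and doubling bounds the latter by
  \<open>2 * C1\<close> times the error on the large cube. The Remez bound turns the average into a
  pointwise estimate.\<close>

lemma near_min_compare:
  obtains C where "C > 0" and "\<And>f x y s t P Q. f \<in> borel_measurable borel \<Longrightarrow> x \<in> S \<Longrightarrow> y \<in> S \<Longrightarrow>
     0 < s \<Longrightarrow> s \<le> t \<Longrightarrow> t \<le> 1 \<Longrightarrow> t \<le> 4 * s \<Longrightarrow> cube y s \<subseteq> cube x t \<Longrightarrow>
     near_min m f y s P \<Longrightarrow> near_min m f x t Q \<Longrightarrow>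
     dev y s P Q \<le> ennreal C * err m f x t \<and>
     (\<forall>w\<in>cube y s. ennreal \<bar>P w - Q w\<bar> \<le> ennreal C * err m f x t)"
proof -
  obtain C1 where C1: "C1 > 0" and dbl: "\<And>x y s t h. x \<in> S \<Longrightarrow> y \<in> S \<Longrightarrow> 0 < s \<and> s \<le> 1 \<and> t \<le> 1 \<and> 0 < t \<and> t \<le> 4 * s \<and> cube y s \<subseteq> cube x t \<and> h \<in> borel_measurable borel
     \<Longrightarrow> avg y s h \<le> ennreal C1 * avg x t h"
    using avg_doubling by blast
  obtain C2 where C2: "C2 > 0" and sup: "\<And>P x r y. P \<in> polys (int m) \<Longrightarrow> x \<in> S \<Longrightarrow> 0 < r \<Longrightarrow> r \<le> 1 \<Longrightarrow> y \<in> cube x r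
      \<Longrightarrow> ennreal \<bar>P y\<bar> \<le> ennreal C2 * avg x r (\<lambda>y. ennreal \<bar>P y\<bar>)"
    using poly_bounds[of m m] by blast
  define C where "C = max 1 C2 * (6 * C1)"
  have C: "0 < C" using C1 by (simp add: C_def)
  show ?thesis
  proof (rule that[OF C], intro conjI ballI)
    fix f :: "real^'n \<Rightarrow> real" and x y s t P Q
    assume f: "f \<in> borel_measurable borel" and xy: "x \<in> S" "y \<in> S"
      and st: "0 < s" "s \<le> t" "t \<le> 1" "t \<le> 4 * s" "cube y s \<subseteq> cube x t"
      and nm: "near_min m f y s P" "near_min m f x t Q"
    have PQ: "P \<in> polys (int m)" "Q \<in> polys (int m)"
      and Ple: "dev y s f P \<le> 2 * err m f y s"
      and Qle: "dev x t f Q \<le> 2 * err m f x t"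
      using nm by (auto simp: near_min_def)
    note [measurable] = f borel_measurable_polys[OF PQ(1)] borel_measurable_polys[OF PQ(2)]
    let ?E = "err m f x t"
    have Qs: "dev y s f Q \<le> ennreal (2 * C1) * ?E"
    proof -
      have "dev y s f Q \<le> ennreal C1 * dev x t f Q"
        using st xy by (intro dbl) auto
      also have "\<dots> \<le> ennreal C1 * (2 * ?E)" by (intro mult_left_mono Qle) auto
      also have "\<dots> = ennreal (2 * C1) * ?E" using C1 by (simp add: ennreal_mult mult_ac)
      finally show ?thesis .
    qed
    have "dev y s P Q \<le> dev y s P f + dev y s f Q"
      by (intro avg_triangle) measurable
    also have "dev y s P f \<le> 2 * err m f y s"
      using Ple by (simp add: abs_minus_commute)
    also have "err m f y s \<le> dev y s f Q"
      using st xy by (intro err_le f PQ) auto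
    finally have "dev y s P Q \<le> 2 * dev y s f Q + dev y s f Q"
      by (simp add: mult_left_mono add_right_mono)
    also have "\<dots> = 3 * dev y s f Q" by (rule ennreal_double_add)
    also have "\<dots> \<le> 3 * (ennreal (2 * C1) * ?E)" by (intro mult_left_mono Qs) auto
    also have "\<dots> = ennreal (6 * C1) * ?E" using C1 by (simp add: ennreal_mult mult_ac)
    finally have a: "dev y s P Q \<le> ennreal (6 * C1) * ?E" .
    have le: "ennreal C' * (ennreal (6 * C1) * ?E) \<le> ennreal C * ?E" if "0 \<le> C'" "C' \<le> max 1 C2" for C'
    proof -
      have "ennreal C' * (ennreal (6 * C1) * ?E) = ennreal (C' * (6 * C1)) * ?E"
        using that C1 by (simp add: ennreal_mult mult_ac)
      also have "\<dots> \<le> ennreal C * ?E"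
        unfolding C_def using that C1 by (intro mult_right_mono ennreal_leI) auto
      finally show ?thesis .
    qed
    show "dev y s P Q \<le> ennreal C * ?E" using a le[of 1] by simp
    show "ennreal \<bar>P w - Q w\<bar> \<le> ennreal C * ?E" if "w \<in> cube y s" for w
    proof -
      have "ennreal \<bar>P w - Q w\<bar> \<le> ennreal C2 * dev y s P Q"
        using st xy that by (intro sup polys_diff PQ) auto
      also have "\<dots> \<le> ennreal C2 * (ennreal (6 * C1) * ?E)" by (intro mult_left_mono a) auto
      also have "\<dots> \<le> ennreal C * ?E" using C2 by (intro le) auto
      finally show ?thesis .
    qed
  qed
qed

section \<open>Lebesgue points\<close>

text \<open>Membership \<open>z \<in> cube y s\<close> is symmetric, so by Fubini's theorem both
  summands contribute the integral of \<open>B\<close> times the measure of a cube. It controls the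
  error terms in the continuity argument that follows.\<close>

lemma near_diagonal_bound:
  fixes N :: "(real^'n) measure"
  assumes [measurable_cong, simp]: "sets N = sets borel" and "finite_measure N"
    and \<kappa>: "AE y in N. emeasure N (cube y s) \<le> \<kappa>"
    and [measurable]: "B \<in> borel_measurable borel"
  shows "(\<integral>\<^sup>+y. (\<integral>\<^sup>+z\<in>cube y s. (B z + B y) \<partial>N) \<partial>N) \<le> 2 * \<kappa> * (\<integral>\<^sup>+y. B y \<partial>N)"
proof -
  interpret N: finite_measure N by fact
  interpret NN: pair_sigma_finite N N ..
  have mu: "(\<integral>\<^sup>+z\<in>cube y s. c \<partial>N) = c * emeasure N (cube y s)" for y c
    by (simp add: nn_integral_cmult)
  have le: "(\<integral>\<^sup>+y. B y * emeasure N (cube y s) \<partial>N) \<le> \<kappa> * (\<integral>\<^sup>+y. B y \<partial>N)"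
  proof -
    have "(\<integral>\<^sup>+y. B y * emeasure N (cube y s) \<partial>N) \<le> (\<integral>\<^sup>+y. B y * \<kappa> \<partial>N)"
      using \<kappa> by (intro nn_integral_mono_AE) (auto elim!: eventually_mono intro: mult_left_mono)
    also have "\<dots> = \<kappa> * (\<integral>\<^sup>+y. B y \<partial>N)"
      by (subst nn_integral_multc) (auto simp: mult.commute)
    finally show ?thesis .
  qed
  have "(\<integral>\<^sup>+y. (\<integral>\<^sup>+z\<in>cube y s. (B z + B y) \<partial>N) \<partial>N)
      = (\<integral>\<^sup>+y. (\<integral>\<^sup>+z\<in>cube y s. B z \<partial>N) + (\<integral>\<^sup>+z\<in>cube y s. B y \<partial>N) \<partial>N)"
    by (intro nn_integral_cong) (simp add: distrib_right nn_integral_add)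
  also have "\<dots> = (\<integral>\<^sup>+y. (\<integral>\<^sup>+z\<in>cube y s. B z \<partial>N) \<partial>N) + (\<integral>\<^sup>+y. (\<integral>\<^sup>+z\<in>cube y s. B y \<partial>N) \<partial>N)"
    by (intro nn_integral_add) measurable
  also have "(\<integral>\<^sup>+y. (\<integral>\<^sup>+z\<in>cube y s. B z \<partial>N) \<partial>N) = (\<integral>\<^sup>+z. \<integral>\<^sup>+y. B z * indicator (cube y s) z \<partial>N \<partial>N)"
    by (intro NN.Fubini') measurable
  also have "\<dots> = (\<integral>\<^sup>+z. (\<integral>\<^sup>+y\<in>cube z s. B z \<partial>N) \<partial>N)"
    by (intro nn_integral_cong) (simp add: indicator_def cube_commute)
  also have "\<dots> + (\<integral>\<^sup>+y. (\<integral>\<^sup>+z\<in>cube y s. B y \<partial>N) \<partial>N) \<le> \<kappa> * (\<integral>\<^sup>+y. B y \<partial>N) + \<kappa> * (\<integral>\<^sup>+y. B y \<partial>N)"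
    unfolding mu by (intro add_mono le)
  finally show ?thesis by (simp add: mult_2 distrib_right)
qed

text \<open>Left unnormalised: the claim will be that it is of smaller order than
  \<open>s powr d\<close>, the order of the measure of a cube.\<close>

abbreviation osc :: "(real^'n) measure \<Rightarrow> real \<Rightarrow> (real^'n \<Rightarrow> real) \<Rightarrow> ennreal" where
  "osc N s f \<equiv> (\<integral>\<^sup>+y. (\<integral>\<^sup>+z\<in>cube y s. ennreal \<bar>f z - f y\<bar> \<partial>N) \<partial>N)"

text \<open>For an indicator function, regularity gives compact \<open>K \<subseteq> A\<close> and open \<open>U \<supseteq> A\<close> with \<open>U - K\<close>
  small; if \<open>s\<close> is less than the distance from \<open>K\<close> to the complement of \<open>U\<close>, the values at two
  points at distance at most \<open>s\<close> can differ only if one of them lies in \<open>U - K\<close>.\<close>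

lemma L1_continuity:
  fixes N :: "(real^'n) measure"
  assumes sN [measurable_cong, simp]: "sets N = sets borel" and finN: "finite_measure N" and k: "0 < k"
    and upper: "\<And>s. 0 < s \<Longrightarrow> s \<le> 1 \<Longrightarrow> AE y in N. emeasure N (cube y s) \<le> ennreal (k * s powr d)"
    and "integrable N g"
  shows "0 < e \<Longrightarrow> \<exists>\<delta>>0. \<forall>s. 0 < s \<and> s \<le> \<delta> \<and> s \<le> 1 \<longrightarrow>
     osc N s g \<le> ennreal (e * s powr d)"
  using \<open>integrable N g\<close>
proof (induction arbitrary: e rule: integrable_induct)
  interpret N: finite_measure N by fact
  have spN: "space N = UNIV" using sets_eq_imp_space_eq[OF sN] by simp
  case (base A c)
  define \<epsilon> where "\<epsilon> = e / (2 * k * (\<bar>c\<bar> + 1))"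
  have \<epsilon>: "0 < \<epsilon>" using base k by (auto simp: \<epsilon>_def intro!: divide_pos_pos mult_pos_pos)
  have A: "A \<in> sets borel" using base by simp
  have fin: "emeasure N (space N) \<noteq> \<infinity>" by simp
  have "\<exists>K\<in>{K. K \<subseteq> A \<and> compact K}. emeasure N A < emeasure N K + ennreal (\<epsilon> / 2)"
  proof (rule SUP_approx_ennreal)
    show "emeasure N A = (SUP K\<in>{K. K \<subseteq> A \<and> compact K}. emeasure N K)" by (rule inner_regular[OF sN fin A])
  qed (use \<epsilon> in auto)
  then obtain K where K: "compact K" "K \<subseteq> A" "emeasure N A < emeasure N K + ennreal (\<epsilon> / 2)" by blast
  have "\<exists>U\<in>{U. A \<subseteq> U \<and> open U}. emeasure N U < emeasure N A + ennreal (\<epsilon> / 2)"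
  proof (rule INF_approx_ennreal)
    show "emeasure N A = (INF U\<in>{U. A \<subseteq> U \<and> open U}. emeasure N U)" by (rule outer_regular[OF sN fin A])
  qed (use \<epsilon> in auto)
  then obtain U where U: "open U" "A \<subseteq> U" "emeasure N U < emeasure N A + ennreal (\<epsilon> / 2)" by blast
  have KU [measurable]: "K \<in> sets borel" "U \<in> sets borel" "A \<in> sets borel"
    using K U A by (auto intro: borel_compact borel_open)
  have "emeasure N K + emeasure N (U - K) = emeasure N U"
    using K U KU by (subst plus_emeasure) (auto intro!: arg_cong[where f="emeasure N"])
  also have "\<dots> \<le> emeasure N K + ennreal (\<epsilon> / 2) + ennreal (\<epsilon> / 2)"
    using U(3) K(3) by (meson add_right_mono less_imp_le order_trans)
  also have "\<dots> = emeasure N K + ennreal \<epsilon>"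
    using \<epsilon> by (simp add: add.assoc flip: ennreal_plus)
  finally have small: "emeasure N (U - K) \<le> ennreal \<epsilon>"
    using N.emeasure_finite[of K] by (simp add: ennreal_add_left_cancel_le)
  obtain \<delta>0 where \<delta>0: "0 < \<delta>0" "\<forall>x\<in>K. \<forall>y\<in>-U. \<delta>0 \<le> dist x y"
    using separate_compact_closed[of K "- U"] K U by auto
  \<comment> \<open>Cubes use the maximum norm and \<open>\<delta>0\<close> is a Euclidean distance;
    the latter is bounded by the sum of the coordinate differences. The 2 makes the inequality
    strict.\<close>
  define \<delta> where "\<delta> = \<delta>0 / (2 * real CARD('n))"
  have \<delta>: "0 < \<delta>" using \<delta>0 by (simp add: \<delta>_def)
  have sep: "\<not> (y \<in> K \<and> z \<notin> U)" if "z \<in> cube y s" "s \<le> \<delta>" for y z s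
  proof
    assume yz: "y \<in> K \<and> z \<notin> U"
    have "dist y z \<le> (\<Sum>i\<in>UNIV. \<bar>(z - y) $ i\<bar>)"
      using norm_le_l1_cart[of "z - y"] by (simp add: dist_norm norm_minus_commute)
    also have "\<dots> \<le> (\<Sum>i\<in>(UNIV :: 'n set). \<delta>)"
      using that by (intro sum_mono) (auto simp: mem_cube_iff intro: order_trans)
    also have "\<dots> < \<delta>0" using \<delta>0 by (simp add: \<delta>_def)
    finally show False using \<delta>0 yz by force
  qed
  let ?B = "\<lambda>y. ennreal \<bar>c\<bar> * indicator (U - K) y :: ennreal"
  show ?case
  proof (intro exI[of _ \<delta>] conjI \<delta> allI impI)
    fix s assume s: "0 < s \<and> s \<le> \<delta> \<and> s \<le> 1"
    have "(\<integral>\<^sup>+y. (\<integral>\<^sup>+z\<in>cube y s. ennreal \<bar>indicator A z *\<^sub>R c - indicator A y *\<^sub>R c\<bar> \<partial>N) \<partial>N)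
        \<le> (\<integral>\<^sup>+y. (\<integral>\<^sup>+z\<in>cube y s. (?B z + ?B y) \<partial>N) \<partial>N)"
    proof (intro nn_integral_mono)
      fix y z
      show "ennreal \<bar>indicator A z *\<^sub>R c - indicator A y *\<^sub>R c\<bar> * indicator (cube y s) z
          \<le> (?B z + ?B y) * indicator (cube y s) z"
      proof (cases "z \<in> cube y s")
        case True
        have "y \<in> cube z s" using True by (simp add: cube_commute)
        then show ?thesis
          using K(2) U(2) sep[OF True, of] sep[of y z s] s True
          by (cases "z \<in> A"; cases "y \<in> A") (auto simp: indicator_def)
      qed simp
    qed
    also have "\<dots> \<le> 2 * ennreal (k * s powr d) * (\<integral>\<^sup>+y. ?B y \<partial>N)"
      using s by (intro near_diagonal_bound upper finN) auto
    also have "(\<integral>\<^sup>+y. ?B y \<partial>N) = ennreal \<bar>c\<bar> * emeasure N (U - K)"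
      by (subst nn_integral_cmult) auto
    also have "2 * ennreal (k * s powr d) * \<dots> \<le> 2 * ennreal (k * s powr d) * (ennreal \<bar>c\<bar> * ennreal \<epsilon>)"
      by (intro mult_left_mono small) auto
    also have "\<dots> = ennreal (2 * (k * s powr d) * (\<bar>c\<bar> * \<epsilon>))"
      using k \<epsilon> by (simp add: ennreal_mult)
    also have "\<dots> \<le> ennreal (e * s powr d)"
    proof (intro ennreal_leI)
      have "2 * k * (\<bar>c\<bar> * \<epsilon>) \<le> 2 * k * ((\<bar>c\<bar> + 1) * \<epsilon>)"
        using k \<epsilon> by (intro mult_left_mono mult_right_mono) auto
      also have "\<dots> = e" using k by (simp add: \<epsilon>_def)
      finally have "2 * k * (\<bar>c\<bar> * \<epsilon>) * s powr d \<le> e * s powr d" by (intro mult_right_mono) auto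
      then show "2 * (k * s powr d) * (\<bar>c\<bar> * \<epsilon>) \<le> e * s powr d" by (simp only: mult_ac)
    qed
    finally show "(\<integral>\<^sup>+y. (\<integral>\<^sup>+z\<in>cube y s. ennreal \<bar>indicator A z *\<^sub>R c - indicator A y *\<^sub>R c\<bar> \<partial>N) \<partial>N)
        \<le> ennreal (e * s powr d)" .
  qed
next
  interpret N: finite_measure N by fact
  case (add f g)
  note [measurable] = borel_measurable_integrable[OF add.hyps(1)] borel_measurable_integrable[OF add.hyps(2)]
  obtain \<delta>1 where \<delta>1: "\<delta>1 > 0" "\<And>s. 0 < s \<Longrightarrow> s \<le> \<delta>1 \<Longrightarrow> s \<le> 1 \<Longrightarrow>
     osc N s f \<le> ennreal (e / 2 * s powr d)"
    using add.IH(1)[of "e / 2"] add.prems by auto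
  obtain \<delta>2 where \<delta>2: "\<delta>2 > 0" "\<And>s. 0 < s \<Longrightarrow> s \<le> \<delta>2 \<Longrightarrow> s \<le> 1 \<Longrightarrow>
     osc N s g \<le> ennreal (e / 2 * s powr d)"
    using add.IH(2)[of "e / 2"] add.prems by auto
  show ?case
  proof (intro exI[of _ "min \<delta>1 \<delta>2"] conjI allI impI)
    fix s assume s: "0 < s \<and> s \<le> min \<delta>1 \<delta>2 \<and> s \<le> 1"
    have "(\<integral>\<^sup>+y. (\<integral>\<^sup>+z\<in>cube y s. ennreal \<bar>f z + g z - (f y + g y)\<bar> \<partial>N) \<partial>N)
        \<le> (\<integral>\<^sup>+y. \<integral>\<^sup>+z. ennreal \<bar>f z - f y\<bar> * indicator (cube y s) z + ennreal \<bar>g z - g y\<bar> * indicator (cube y s) z \<partial>N \<partial>N)"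
      by (intro nn_integral_mono) (auto simp: indicator_def simp flip: ennreal_plus intro!: ennreal_leI)
    also have "\<dots> = (\<integral>\<^sup>+y. (\<integral>\<^sup>+z\<in>cube y s. ennreal \<bar>f z - f y\<bar> \<partial>N) + (\<integral>\<^sup>+z\<in>cube y s. ennreal \<bar>g z - g y\<bar> \<partial>N) \<partial>N)"
      by (intro nn_integral_cong nn_integral_add) measurable
    also have "\<dots> = osc N s f + osc N s g"
      by (intro nn_integral_add) measurable
    also have "\<dots> \<le> ennreal (e / 2 * s powr d) + ennreal (e / 2 * s powr d)"
      using s by (intro add_mono \<delta>1 \<delta>2) auto
    also have "\<dots> = ennreal (e * s powr d)"
      using add.prems by (subst ennreal_plus[symmetric]) auto
    finally show "(\<integral>\<^sup>+y. (\<integral>\<^sup>+z\<in>cube y s. ennreal \<bar>f z + g z - (f y + g y)\<bar> \<partial>N) \<partial>N) \<le> ennreal (e * s powr d)" .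
  qed (use \<delta>1 \<delta>2 in simp)
next
  interpret N: finite_measure N by fact
  have spN: "space N = UNIV" using sets_eq_imp_space_eq[OF sN] by simp
  case (lim f u)
  note [measurable] = borel_measurable_integrable[OF lim.hyps(1)] borel_measurable_integrable[OF lim.hyps(4)]
  have fin: "(\<integral>\<^sup>+x. ennreal (2 * norm (f x)) \<partial>N) < \<infinity>"
    using lim.hyps(4) by (simp add: integrable_iff_bounded ennreal_mult nn_integral_cmult ennreal_mult_less_top)
  have "(\<lambda>i. \<integral>\<^sup>+x. norm (f x - u i x) \<partial>N) \<longlonglongrightarrow> 0"
    by (rule nn_integral_dominated_convergence_norm[where w="\<lambda>x. 2 * norm (f x)"])
      (use lim.hyps fin spN in auto)
  \<comment> \<open>Half of the budget is for the approximant \<open>u i\<close>. The other half is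
    for \<open>f - u i\<close>, because \<open>near_diagonal_bound\<close> multiplies its norm by
    \<open>2 * k * s powr d\<close>.\<close>
  moreover have "0 < ennreal (e / (4 * k))" using lim.prems k by simp
  ultimately have "\<forall>\<^sub>F i in sequentially. (\<integral>\<^sup>+x. norm (f x - u i x) \<partial>N) < ennreal (e / (4 * k))"
    by (rule order_tendstoD(2))
  then obtain i where i: "(\<integral>\<^sup>+x. ennreal \<bar>f x - u i x\<bar> \<partial>N) < ennreal (e / (4 * k))"
    by (auto simp: eventually_sequentially)
  obtain \<delta> where \<delta>: "\<delta> > 0" "\<And>s. 0 < s \<Longrightarrow> s \<le> \<delta> \<Longrightarrow> s \<le> 1 \<Longrightarrow>
     osc N s (u i) \<le> ennreal (e / 2 * s powr d)"
    using lim.IH[of "e / 2" i] lim.prems by auto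
  let ?B = "\<lambda>x. ennreal \<bar>f x - u i x\<bar>"
  show ?case
  proof (intro exI[of _ \<delta>] conjI allI impI \<delta>(1))
    fix s assume s: "0 < s \<and> s \<le> \<delta> \<and> s \<le> 1"
    have "osc N s f
        \<le> (\<integral>\<^sup>+y. \<integral>\<^sup>+z. ennreal \<bar>u i z - u i y\<bar> * indicator (cube y s) z + (?B z + ?B y) * indicator (cube y s) z \<partial>N \<partial>N)"
      by (intro nn_integral_mono) (auto simp: indicator_def simp flip: ennreal_plus intro!: ennreal_leI)
    also have "\<dots> = (\<integral>\<^sup>+y. (\<integral>\<^sup>+z\<in>cube y s. ennreal \<bar>u i z - u i y\<bar> \<partial>N) + (\<integral>\<^sup>+z\<in>cube y s. (?B z + ?B y) \<partial>N) \<partial>N)"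
      by (intro nn_integral_cong nn_integral_add) measurable
    also have "\<dots> = osc N s (u i) + (\<integral>\<^sup>+y. (\<integral>\<^sup>+z\<in>cube y s. (?B z + ?B y) \<partial>N) \<partial>N)"
      by (intro nn_integral_add) measurable
    also have "\<dots> \<le> ennreal (e / 2 * s powr d) + 2 * ennreal (k * s powr d) * (\<integral>\<^sup>+y. ?B y \<partial>N)"
      using s by (intro add_mono \<delta> near_diagonal_bound upper finN sN) auto
    also have "\<dots> \<le> ennreal (e / 2 * s powr d) + 2 * ennreal (k * s powr d) * ennreal (e / (4 * k))"
      using i by (intro add_mono mult_left_mono) (auto simp: less_imp_le)
    also have "2 * ennreal (k * s powr d) * ennreal (e / (4 * k)) = ennreal (2 * (k * s powr d) * (e / (4 * k)))"
    proof -
      have "ennreal (2 * a * b) = 2 * ennreal a * ennreal b" if "0 \<le> a" "0 \<le> b" for a b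
        using that by (simp add: ennreal_mult)
      then show ?thesis using k lim.prems
        by (metis divide_nonneg_nonneg less_imp_le mult_nonneg_nonneg powr_ge_zero zero_le_numeral)
    qed
    also have "2 * (k * s powr d) * (e / (4 * k)) = e / 2 * s powr d"
      using k by (simp add: field_simps)
    also have "ennreal (e / 2 * s powr d) + ennreal (e / 2 * s powr d) = ennreal (e * s powr d)"
      using lim.prems by (subst ennreal_plus[symmetric]) auto
    finally show "osc N s f \<le> ennreal (e * s powr d)" .
  qed
qed

text \<open>No maximal function is used: the mean oscillations tend to zero in the mean along the
  given scales, and Fatou's lemma gives a vanishing lower limit almost everywhere. A lower limit is
  enough, since the telescoping argument only has to stop at some scale with small
  oscillation.\<close>

lemma Lebesgue_points:
  assumes f [measurable]: "f \<in> borel_measurable borel"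
    and loc: "\<And>R. (\<integral>\<^sup>+x\<in>cube 0 R. ennreal \<bar>f x\<bar> \<partial>M) < \<infinity>"
    and r: "\<And>J. 0 < r J" "\<And>J. r J \<le> 1" "r \<longlonglongrightarrow> 0"
  shows "AE y in M. liminf (\<lambda>J. avg y (r J) (\<lambda>z. ennreal \<bar>f z - f y\<bar>)) = 0"
proof -
  let ?u = "\<lambda>J y. avg y (r J) (\<lambda>z. ennreal \<bar>f z - f y\<bar>)"
  have "AE y in M. y \<in> cube 0 (real R) \<longrightarrow> liminf (\<lambda>J. ?u J y) = 0" for R :: nat
  proof -
    \<comment> \<open>The enlarged cube contains all cubes of radius at most 1 centred in
      \<open>cube 0 (real R)\<close>, so there the integrals with respect to \<open>N\<close> and
      \<open>M\<close> agree, while \<open>N\<close> is finite.\<close>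
    define N where "N = density M (indicator (cube 0 (real R + 1)))"
    have sN [measurable_cong, simp]: "sets N = sets borel" by (simp add: N_def)
    have intN: "(\<integral>\<^sup>+y. h y \<partial>N) = (\<integral>\<^sup>+y\<in>cube 0 (real R + 1). h y \<partial>M)" if "h \<in> borel_measurable borel" for h
      unfolding N_def using that by (subst nn_integral_density) (auto simp: mult.commute)
    have finN: "finite_measure N"
      using intN[of "\<lambda>_. 1"] cube_origin_finite[of "real R + 1"] sets_eq_imp_space_eq[OF sN]
      by (intro finite_measureI) (auto simp: less_top)
    interpret N: finite_measure N by (rule finN)
    have up: "AE y in N. emeasure N (cube y s) \<le> ennreal (c2 * s powr d)" if "0 < s" "s \<le> 1" for s
    proof -
      have nle: "emeasure N (cube y s) \<le> emeasure M (cube y s)" for y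
      proof -
        have "emeasure N (cube y s) = (\<integral>\<^sup>+z. indicator (cube y s) z \<partial>N)" by simp
        also have "\<dots> = (\<integral>\<^sup>+z\<in>cube 0 (real R + 1). indicator (cube y s) z \<partial>M)" by (rule intN) simp
        also have "\<dots> \<le> (\<integral>\<^sup>+z. indicator (cube y s) z \<partial>M)"
          by (intro nn_integral_mono) (simp split: split_indicator)
        finally show ?thesis by simp
      qed
      have "AE y in M. emeasure N (cube y s) \<le> ennreal (c2 * s powr d)"
        using AE_in_S
      proof eventually_elim
        case (elim y)
        show ?case using nle cube_upper[OF elim that] by (rule order_trans)
      qed
      then show ?thesis unfolding N_def by (subst AE_density) auto
    qed
    have int: "integrable N f"
      using loc[of "real R + 1"] by (intro integrableI_bounded) (auto simp: intN)
    have tend: "(\<lambda>J. \<integral>\<^sup>+y\<in>cube 0 (real R). ?u J y \<partial>M) \<longlonglongrightarrow> 0"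
    proof (rule ennreal_tendsto_0_I)
      fix e :: real assume e: "0 < e"
      obtain \<delta> where \<delta>: "0 < \<delta>" "\<And>s. 0 < s \<Longrightarrow> s \<le> \<delta> \<Longrightarrow> s \<le> 1 \<Longrightarrow>
         osc N s f \<le> ennreal (e * c1 * s powr d)"
        using L1_continuity[OF sN finN c2_pos up int, of "e * c1"] e c1_pos by auto
      have "\<forall>\<^sub>F J in sequentially. r J < \<delta>" using r(3) \<delta>(1) by (rule order_tendstoD(2))
      then show "\<forall>\<^sub>F J in sequentially. (\<integral>\<^sup>+y\<in>cube 0 (real R). ?u J y \<partial>M) \<le> ennreal e"
      proof eventually_elim
        case (elim J)
        let ?s = "r J"
        have "AE y in M. ?u J y * indicator (cube 0 (real R)) y
            \<le> ennreal (1 / (c1 * ?s powr d)) * ((\<integral>\<^sup>+z\<in>cube y ?s. ennreal \<bar>f z - f y\<bar> \<partial>N) * indicator (cube 0 (real R + 1)) y)"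
          using AE_in_S
        proof eventually_elim
          case (elim y)
          show ?case
          proof (cases "y \<in> cube 0 (real R)")
            case True
            then have sub: "cube y ?s \<subseteq> cube 0 (real R + 1)" using r(2)[of J] by (intro cube_subset) auto
            then have y1: "y \<in> cube 0 (real R + 1)" using cube_self[of ?s y] r(1)[of J] by auto
            have "?u J y = (\<integral>\<^sup>+z\<in>cube y ?s. ennreal \<bar>f z - f y\<bar> \<partial>M) / emeasure M (cube y ?s)"
              by (intro avg_eq) measurable
            also have "\<dots> \<le> (\<integral>\<^sup>+z\<in>cube y ?s. ennreal \<bar>f z - f y\<bar> \<partial>M) / ennreal (c1 * ?s powr d)"
              using elim r by (intro divide_mono_ennreal cube_lower) auto
            also have "(\<integral>\<^sup>+z\<in>cube y ?s. ennreal \<bar>f z - f y\<bar> \<partial>M) = (\<integral>\<^sup>+z\<in>cube y ?s. ennreal \<bar>f z - f y\<bar> \<partial>N)"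
              using sub by (subst intN) (auto intro!: nn_integral_cong simp: indicator_def)
            also have "\<dots> / ennreal (c1 * ?s powr d) = ennreal (1 / (c1 * ?s powr d)) * (\<integral>\<^sup>+z\<in>cube y ?s. ennreal \<bar>f z - f y\<bar> \<partial>N)"
              using c1_pos r(1)[of J] by (simp add: divide_ennreal_def inverse_ennreal mult.commute inverse_eq_divide)
            finally show ?thesis using True y1 by simp
          qed simp
        qed
        then have "(\<integral>\<^sup>+y\<in>cube 0 (real R). ?u J y \<partial>M)
            \<le> (\<integral>\<^sup>+y. ennreal (1 / (c1 * ?s powr d)) * ((\<integral>\<^sup>+z\<in>cube y ?s. ennreal \<bar>f z - f y\<bar> \<partial>N) * indicator (cube 0 (real R + 1)) y) \<partial>M)"
          by (rule nn_integral_mono_AE)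
        also have "\<dots> = ennreal (1 / (c1 * ?s powr d)) * (\<integral>\<^sup>+y. (\<integral>\<^sup>+z\<in>cube y ?s. ennreal \<bar>f z - f y\<bar> \<partial>N) \<partial>N)"
          by (subst nn_integral_cmult) (auto intro!: intN[symmetric] arg_cong2[where f="(*)"])
        also have "\<dots> \<le> ennreal (1 / (c1 * ?s powr d)) * ennreal (e * c1 * ?s powr d)"
          using elim r by (intro mult_left_mono \<delta>) (auto simp: less_imp_le)
        also have "\<dots> = ennreal e"
          using c1_pos e r(1)[of J] by (simp flip: ennreal_mult)
        finally show ?case .
      qed
    qed
    have "(\<integral>\<^sup>+y. liminf (\<lambda>J. ?u J y * indicator (cube 0 (real R)) y) \<partial>M) \<le> liminf (\<lambda>J. \<integral>\<^sup>+y\<in>cube 0 (real R). ?u J y \<partial>M)"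
      by (intro nn_integral_liminf) measurable
    also have "\<dots> = 0" using tend by (intro lim_imp_Liminf) auto
    finally have "AE y in M. liminf (\<lambda>J. ?u J y * indicator (cube 0 (real R)) y) = 0"
      by (subst (asm) le_zero_eq, subst (asm) nn_integral_0_iff_AE) auto
    then show ?thesis by eventually_elim auto
  qed
  then have "AE y in M. \<forall>R::nat. y \<in> cube 0 (real R) \<longrightarrow> liminf (\<lambda>J. ?u J y) = 0"
    unfolding AE_all_countable by (rule allI)
  then show ?thesis
  proof eventually_elim
    case (elim y)
    then show ?case using UN_cube_origin by blast
  qed
qed

section \<open>Pointwise and integral estimates\<close>

lemma Lebesgue_point_approx:
  obtains C where "C > 0" and "\<And>f y t P. f \<in> borel_measurable borel \<Longrightarrow> y \<in> S \<Longrightarrow> 0 < t \<Longrightarrow> t \<le> 1 \<Longrightarrow>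
     liminf (\<lambda>J. avg y (t / 2 ^ J) (\<lambda>z. ennreal \<bar>f z - f y\<bar>)) = 0 \<Longrightarrow> near_min m f y t P \<Longrightarrow>
     ennreal \<bar>f y - P y\<bar> \<le> ennreal C * (\<Sum>j. err m f y (t / 2 ^ j))"
proof -
  obtain C1 where C1: "C1 > 0" and cmp: "\<And>f x y s t P Q. f \<in> borel_measurable borel \<Longrightarrow> x \<in> S \<Longrightarrow> y \<in> S \<Longrightarrow>
     0 < s \<Longrightarrow> s \<le> t \<Longrightarrow> t \<le> 1 \<Longrightarrow> t \<le> 4 * s \<Longrightarrow> cube y s \<subseteq> cube x t \<Longrightarrow>
     near_min m f y s P \<Longrightarrow> near_min m f x t Q \<Longrightarrow>
     dev y s P Q \<le> ennreal C1 * err m f x t \<and>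
     (\<forall>w\<in>cube y s. ennreal \<bar>P w - Q w\<bar> \<le> ennreal C1 * err m f x t)"
    by (rule near_min_compare[of m]) blast
  obtain C2 where C2: "C2 > 0" and sup: "\<And>P x r y. P \<in> polys (int m) \<Longrightarrow> x \<in> S \<Longrightarrow> 0 < r \<Longrightarrow> r \<le> 1 \<Longrightarrow> y \<in> cube x r
      \<Longrightarrow> ennreal \<bar>P y\<bar> \<le> ennreal C2 * avg x r (\<lambda>y. ennreal \<bar>P y\<bar>)"
    using poly_bounds[of m m] by blast
  show ?thesis
  proof (rule that[OF C1])
    fix f :: "real^'n \<Rightarrow> real" and y P and t :: real
    assume f [measurable]: "f \<in> borel_measurable borel" and y: "y \<in> S" and t: "0 < t" "t \<le> 1"
      and leb: "liminf (\<lambda>J. avg y (t / 2 ^ J) (\<lambda>z. ennreal \<bar>f z - f y\<bar>)) = 0"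
      and P: "near_min m f y t P"
    have tj: "0 < t / 2 ^ j" "t / 2 ^ j \<le> 1" for j
    proof -
      show "0 < t / 2 ^ j" using t by simp
      have "t / 2 ^ j \<le> t / 1" using t by (intro divide_left_mono) auto
      then show "t / 2 ^ j \<le> 1" using t by linarith
    qed
    have "\<exists>Q. near_min m f y (t / 2 ^ j) Q \<and> (j = 0 \<longrightarrow> Q = P)" for j
    proof (cases "j = 0")
      case False
      then show ?thesis using near_min_exists[OF f y tj, of m j] by blast
    qed (use P in auto)
    then obtain Q where nm: "\<And>j. near_min m f y (t / 2 ^ j) (Q j)" and Q0: "Q 0 = P"
      by metis
    then have Q: "\<And>j. Q j \<in> polys (int m)" "Q 0 = P"
        "\<And>j. dev y (t / 2 ^ j) f (Q j) \<le> 2 * err m f y (t / 2 ^ j)"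
      by (auto simp: near_min_def)
    let ?a = "\<lambda>J. avg y (t / 2 ^ J) (\<lambda>z. ennreal \<bar>f z - f y\<bar>)"
    let ?E = "\<lambda>j. err m f y (t / 2 ^ j)"
    have step: "ennreal \<bar>Q (Suc j) y - Q j y\<bar> \<le> ennreal C1 * ?E j" for j
    proof -
      have "t / 2 ^ Suc j = (t / 2 ^ j) / 2" by simp
      moreover have "a \<le> 4 * (a / 2)" "a / 2 \<le> a" if "0 < a" for a :: real using that by auto
      ultimately have le: "t / 2 ^ j \<le> 4 * (t / 2 ^ Suc j)" "t / 2 ^ Suc j \<le> t / 2 ^ j"
        using tj(1)[of j] by (simp_all only:)
      then have "cube y (t / 2 ^ Suc j) \<subseteq> cube y (t / 2 ^ j)"
        by (intro cube_subset[of y y 0]) (auto simp: cube_self)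
      from cmp[OF f y y tj(1) le(2) tj(2) le(1) this nm nm] show ?thesis
        using cube_self[of "t / 2 ^ Suc j" y] tj(1)[of "Suc j"] by auto
    qed
    have chain: "ennreal \<bar>Q J y - P y\<bar> \<le> ennreal C1 * (\<Sum>j<J. ?E j)" for J
    proof (induction J)
      case (Suc J)
      have "ennreal \<bar>Q (Suc J) y - P y\<bar> \<le> ennreal \<bar>Q (Suc J) y - Q J y\<bar> + ennreal \<bar>Q J y - P y\<bar>"
        by (simp flip: ennreal_plus add: ennreal_leI)
      also have "\<dots> \<le> ennreal C1 * ?E J + ennreal C1 * (\<Sum>j<J. ?E j)" by (intro add_mono step Suc)
      finally show ?case by (simp add: distrib_left add.commute)
    qed (use Q in simp)
    \<comment> \<open>The constant \<open>f y\<close> is itself an admissible polynomial, so the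
      error is at most the oscillation \<open>?a J\<close>, and \<open>Q J\<close> is within three
      oscillations of \<open>f y\<close> on average; the Remez bound evaluates this at
      \<open>y\<close>.\<close>
    have close: "ennreal \<bar>Q J y - f y\<bar> \<le> ennreal (3 * C2) * ?a J" for J
    proof -
      note QM [measurable] = borel_measurable_polys[OF Q(1)]
      have "ennreal \<bar>Q J y - f y\<bar> \<le> ennreal C2 * avg y (t / 2 ^ J) (\<lambda>z. ennreal \<bar>Q J z - f y\<bar>)"
        using sup[of "\<lambda>z. Q J z - f y" y "t / 2 ^ J" y] tj[of J] y
        by (simp add: polys_diff Q const_in_polys cube_self)
      also have "avg y (t / 2 ^ J) (\<lambda>z. ennreal \<bar>Q J z - f y\<bar>)
          \<le> dev y (t / 2 ^ J) (Q J) f + ?a J"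
        by (intro avg_triangle) measurable
      also have "dev y (t / 2 ^ J) (Q J) f \<le> 2 * ?E J"
        using Q(3)[of J] by (simp add: abs_minus_commute)
      also have "?E J \<le> ?a J" by (intro err_le f const_in_polys y tj)
      finally have "ennreal \<bar>Q J y - f y\<bar> \<le> ennreal C2 * (2 * ?a J + ?a J)"
        by (simp add: mult_left_mono add_right_mono)
      also have "2 * ?a J + ?a J = 3 * ?a J" by (rule ennreal_double_add)
      also have "ennreal C2 * (3 * ?a J) = ennreal (3 * C2) * ?a J"
        using C2 by (simp add: ennreal_mult mult_ac)
      finally show ?thesis .
    qed
    show "ennreal \<bar>f y - P y\<bar> \<le> ennreal C1 * (\<Sum>j. ?E j)"
    proof (rule ennreal_le_epsilon)
      fix e :: real assume e: "0 < e"
      have "\<exists>J. ?a J < ennreal (e / (3 * C2))"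
      proof (rule ccontr)
        assume "\<not> ?thesis"
        then have "ennreal (e / (3 * C2)) \<le> liminf ?a"
          by (intro Liminf_bounded always_eventually allI) (simp add: not_less)
        then show False using leb e C2 by simp
      qed
      then obtain J where J: "?a J < ennreal (e / (3 * C2))" ..
      have "ennreal \<bar>f y - P y\<bar> \<le> ennreal \<bar>Q J y - P y\<bar> + ennreal \<bar>Q J y - f y\<bar>"
        by (simp flip: ennreal_plus add: ennreal_leI)
      also have "\<dots> \<le> ennreal C1 * (\<Sum>j. ?E j) + ennreal (3 * C2) * ennreal (e / (3 * C2))"
      proof (intro add_mono)
        have "ennreal \<bar>Q J y - P y\<bar> \<le> ennreal C1 * (\<Sum>j<J. ?E j)" by (rule chain)
        also have "\<dots> \<le> ennreal C1 * (\<Sum>j. ?E j)" by (intro mult_left_mono sum_le_suminf) auto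
        finally show "ennreal \<bar>Q J y - P y\<bar> \<le> ennreal C1 * (\<Sum>j. ?E j)" .
        show "ennreal \<bar>Q J y - f y\<bar> \<le> ennreal (3 * C2) * ennreal (e / (3 * C2))"
          using close[of J] J by (meson less_imp_le mult_left_mono order_trans zero_le)
      qed
      also have "ennreal (3 * C2) * ennreal (e / (3 * C2)) = ennreal e"
        using C2 e by (subst ennreal_mult[symmetric]) auto
      finally show "ennreal \<bar>f y - P y\<bar> \<le> ennreal C1 * (\<Sum>j. ?E j) + ennreal e" .
    qed
  qed
qed

abbreviation coarse_sum :: "nat \<Rightarrow> nat \<Rightarrow> (real^'n \<Rightarrow> real) \<Rightarrow> real^'n \<Rightarrow> real \<Rightarrow> nat \<Rightarrow> ennreal" where
  "coarse_sum l m f x t J \<equiv> (\<Sum>i\<le>J. ennreal (((1/2) ^ i) ^ Suc l) * err m f x (2 ^ i * t))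
      + ennreal (((1/2) ^ J) ^ Suc l) * avg x (2 ^ J * t) (\<lambda>z. ennreal \<bar>f z\<bar>)"

text \<open>Marchaud-type estimate: the degree of a near-minimiser is lowered by truncating the Taylor
  expansions of its differences along the scales up to \<open>2 ^ J * t\<close>.\<close>

lemma near_min_truncate:
  assumes "l \<le> m"
  obtains C where "C > 0" and "\<And>f x t J P. f \<in> borel_measurable borel \<Longrightarrow> x \<in> S \<Longrightarrow> 0 < t \<Longrightarrow> 1 \<le> J \<Longrightarrow> 2 ^ J * t \<le> 1 \<Longrightarrow>
     near_min m f x (2 * t) P \<Longrightarrow> \<exists>T\<in>polys (int l). \<forall>y\<in>cube x t. ennreal \<bar>P y - T y\<bar> \<le> ennreal C *
        coarse_sum l m f x t J"
proof -
  obtain C1 where C1: "C1 > 0" and cmp: "\<And>f x y s t P Q. f \<in> borel_measurable borel \<Longrightarrow> x \<in> S \<Longrightarrow> y \<in> S \<Longrightarrow>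
     0 < s \<Longrightarrow> s \<le> t \<Longrightarrow> t \<le> 1 \<Longrightarrow> t \<le> 4 * s \<Longrightarrow> cube y s \<subseteq> cube x t \<Longrightarrow>
     near_min m f y s P \<Longrightarrow> near_min m f x t Q \<Longrightarrow>
     dev y s P Q \<le> ennreal C1 * err m f x t \<and>
     (\<forall>w\<in>cube y s. ennreal \<bar>P w - Q w\<bar> \<le> ennreal C1 * err m f x t)"
    by (rule near_min_compare[of m]) blast
  obtain C2 where C2: "C2 > 0" and tay: "\<And>P x r. P \<in> polys (int m) \<Longrightarrow> x \<in> S \<Longrightarrow> 0 < r \<Longrightarrow> r \<le> 1 \<Longrightarrow>
      \<exists>T\<in>polys (int l). \<forall>t. 0 < t \<and> t \<le> r \<longrightarrow> (\<forall>y\<in>cube x t.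
         ennreal \<bar>P y - T y\<bar> \<le> ennreal (C2 * (t / r) ^ Suc l) * avg x r (\<lambda>y. ennreal \<bar>P y\<bar>))"
    using poly_bounds[OF assms] by blast
  \<comment> \<open>In the difference of near-minimisers at two consecutive scales the Taylor factor
    belongs to the smaller scale and the error to the larger one; \<open>2 ^ Suc l\<close> pays for
    this shift of the weight.\<close>
  define K where "K = C1 * C2 * 2 ^ Suc l"
  have K: "0 < K" using C1 C2 by (simp add: K_def)
  define C where "C = max K (3 * C2)"
  have C: "0 < C" using K by (simp add: C_def)
  show ?thesis
  proof (rule that[OF C])
    fix f :: "real^'n \<Rightarrow> real" and x P and t :: real and J :: nat
    assume f [measurable]: "f \<in> borel_measurable borel" and x: "x \<in> S"
      and t: "0 < t" and J: "1 \<le> J" "2 ^ J * t \<le> 1" and P: "near_min m f x (2 * t) P"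
    have tj: "0 < 2 ^ j * t" "2 ^ j * t \<le> 1" "t \<le> 2 ^ j * t" if "j \<le> J" for j
    proof -
      show "0 < 2 ^ j * t" using t by simp
      have "(2::real) ^ j * t \<le> 2 ^ J * t" using t that by (intro mult_right_mono power_increasing) auto
      then show "2 ^ j * t \<le> 1" using J by simp
      have "1 * t \<le> 2 ^ j * t" using t by (intro mult_right_mono) auto
      then show "t \<le> 2 ^ j * t" by simp
    qed
    \<comment> \<open>The chain starts at index 1, with the given \<open>P\<close> at radius
      \<open>2 * t\<close>: this radius lets \<open>cube x (2 * t)\<close> contain the cubes of
      radius \<open>t\<close> around all points of \<open>cube x t\<close>.\<close>
    have "\<exists>Q. j \<le> J \<longrightarrow> near_min m f x (2 ^ j * t) Q \<and> (j = 1 \<longrightarrow> Q = P)" for j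
    proof (cases "j = 1")
      case False
      then show ?thesis using near_min_exists[OF f x tj(1) tj(2), of j m] by blast
    qed (use P in auto)
    then obtain Q where nm: "\<And>j. j \<le> J \<Longrightarrow> near_min m f x (2 ^ j * t) (Q j)" and Q1: "Q 1 = P"
      using J(1) by metis
    then have Q: "\<And>j. j \<le> J \<Longrightarrow> Q j \<in> polys (int m)"
        "\<And>j. j \<le> J \<Longrightarrow> dev x (2 ^ j * t) f (Q j) \<le> 2 * err m f x (2 ^ j * t)"
      by (auto simp: near_min_def)
    let ?w = "\<lambda>i. ennreal (((1/2) ^ i) ^ Suc l)" and ?E = "\<lambda>i. err m f x (2 ^ i * t)"
    have ratio: "t / (2 ^ j * t) = (1/2) ^ j" for j using t by (simp add: power_one_over)
    have "\<exists>T\<in>polys (int l). \<forall>y\<in>cube x t. ennreal \<bar>P y - Q (Suc j) y - T y\<bar> \<le> ennreal K * (\<Sum>i\<le>Suc j. ?w i * ?E i)"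
      if "Suc j \<le> J" for j
      using that
    proof (induction j)
      case 0
      show ?case by (intro bexI[of _ "\<lambda>_. 0"]) (use Q1 in \<open>auto intro: zero_in_polys\<close>)
    next
      case (Suc j)
      then obtain T where T: "T \<in> polys (int l)"
          "\<And>y. y \<in> cube x t \<Longrightarrow> ennreal \<bar>P y - Q (Suc j) y - T y\<bar> \<le> ennreal K * (\<Sum>i\<le>Suc j. ?w i * ?E i)"
        by auto
      let ?R = "\<lambda>y. Q (Suc j) y - Q (Suc (Suc j)) y"
      have QS: "Q (Suc j) \<in> polys (int m)" "Q (Suc (Suc j)) \<in> polys (int m)" using Suc.prems by (auto intro: Q)
      have r: "0 < 2 ^ Suc j * t" "2 ^ Suc j * t \<le> 1" "t \<le> 2 ^ Suc j * t"
        using tj[of "Suc j"] Suc.prems by (auto simp del: power_Suc)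
      obtain T' where T': "T' \<in> polys (int l)" and T'le: "\<And>y. y \<in> cube x t \<Longrightarrow>
          ennreal \<bar>?R y - T' y\<bar> \<le> ennreal (C2 * (t / (2 ^ Suc j * t)) ^ Suc l) * avg x (2 ^ Suc j * t) (\<lambda>y. ennreal \<bar>?R y\<bar>)"
        using tay[OF polys_diff[OF QS] x r(1,2)] t r(3) by blast
      have RE: "avg x (2 ^ Suc j * t) (\<lambda>y. ennreal \<bar>?R y\<bar>) \<le> ennreal C1 * ?E (Suc (Suc j))"
      proof -
        have le: "(2::real) ^ Suc (Suc j) * t \<le> 4 * (2 ^ Suc j * t)" "(2::real) ^ Suc j * t \<le> 2 ^ Suc (Suc j) * t" using t by auto
        then have sub: "cube x (2 ^ Suc j * t) \<subseteq> cube x (2 ^ Suc (Suc j) * t)"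
          by (intro cube_subset[of x x 0]) (auto simp: cube_self)
        have "Suc j \<le> J" using Suc.prems by simp
        from cmp[OF f x x r(1) le(2) tj(2)[OF Suc.prems] le(1) sub nm[OF this] nm[OF Suc.prems]]
        show ?thesis by blast
      qed
      show ?case
      proof (intro bexI[of _ "\<lambda>y. T y + T' y"] polys_add T T' ballI)
        fix y assume y: "y \<in> cube x t"
        have "ennreal \<bar>P y - Q (Suc (Suc j)) y - (T y + T' y)\<bar>
            \<le> ennreal \<bar>P y - Q (Suc j) y - T y\<bar> + ennreal \<bar>?R y - T' y\<bar>"
          by (simp flip: ennreal_plus add: ennreal_leI)
        also have "\<dots> \<le> ennreal K * (\<Sum>i\<le>Suc j. ?w i * ?E i) + ennreal K * (?w (Suc (Suc j)) * ?E (Suc (Suc j)))"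
        proof (intro add_mono T y)
          have "ennreal \<bar>?R y - T' y\<bar> \<le> ennreal (C2 * ((1/2) ^ Suc j) ^ Suc l) * avg x (2 ^ Suc j * t) (\<lambda>y. ennreal \<bar>?R y\<bar>)"
            using T'le[OF y] unfolding ratio .
          also have "\<dots> \<le> ennreal (C2 * ((1/2) ^ Suc j) ^ Suc l) * (ennreal C1 * ?E (Suc (Suc j)))"
            by (intro mult_left_mono RE) auto
          also have "\<dots> = ennreal (C2 * ((1/2) ^ Suc j) ^ Suc l * C1) * ?E (Suc (Suc j))"
            using C1 C2 by (subst ennreal_mult) (auto simp: mult.assoc)
          also have "C2 * ((1/2) ^ Suc j) ^ Suc l * C1 = K * ((1/2) ^ Suc (Suc j)) ^ Suc l"
          proof -
            have "((1/2::real) ^ Suc (Suc j)) ^ Suc l = (1/2 * (1/2) ^ Suc j) ^ Suc l" by (simp only: power_Suc)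
            also have "\<dots> = (1/2) ^ Suc l * ((1/2) ^ Suc j) ^ Suc l" by (rule power_mult_distrib)
            finally show ?thesis unfolding K_def
              by (simp only: mult.assoc mult.commute mult.left_commute) (simp add: power_one_over)
          qed
          also have "ennreal (K * ((1/2) ^ Suc (Suc j)) ^ Suc l) = ennreal K * ?w (Suc (Suc j))"
            using K by (intro ennreal_mult) auto
          finally show "ennreal \<bar>?R y - T' y\<bar> \<le> ennreal K * (?w (Suc (Suc j)) * ?E (Suc (Suc j)))"
            by (simp only: mult.assoc)
        qed
        also have "\<dots> = ennreal K * (\<Sum>i\<le>Suc (Suc j). ?w i * ?E i)"
          by (simp only: sum.atMost_Suc distrib_left add.assoc)
        finally show "ennreal \<bar>P y - Q (Suc (Suc j)) y - (T y + T' y)\<bar> \<le> \<dots>" .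
      qed
    qed
    from this[of "J - 1"] J obtain T where T: "T \<in> polys (int l)"
        "\<And>y. y \<in> cube x t \<Longrightarrow> ennreal \<bar>P y - Q J y - T y\<bar> \<le> ennreal K * (\<Sum>i\<le>J. ?w i * ?E i)"
      by auto
    let ?r = "2 ^ J * t"
    have r: "0 < ?r" "?r \<le> 1" "t \<le> ?r" by (auto intro: tj)
    note QJ = Q(1)[OF order_refl]
    note QM [measurable] = borel_measurable_polys[OF QJ]
    obtain T' where T': "T' \<in> polys (int l)" and T'le: "\<And>y. y \<in> cube x t \<Longrightarrow>
        ennreal \<bar>Q J y - T' y\<bar> \<le> ennreal (C2 * (t / ?r) ^ Suc l) * avg x ?r (\<lambda>y. ennreal \<bar>Q J y\<bar>)"
      using tay[OF QJ x r(1,2)] t r(3) by blast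
    let ?F = "avg x ?r (\<lambda>z. ennreal \<bar>f z\<bar>)"
    \<comment> \<open>The zero polynomial is a competitor, so the error at the top scale is at most
      \<open>?F\<close>.\<close>
    have Qf: "avg x ?r (\<lambda>y. ennreal \<bar>Q J y\<bar>) \<le> 3 * ?F"
    proof -
      have "avg x ?r (\<lambda>y. ennreal \<bar>Q J y\<bar>) \<le> dev x ?r (Q J) f + ?F"
        using avg_triangle[of "Q J" f "\<lambda>_. 0" x ?r] by simp
      also have "dev x ?r (Q J) f \<le> 2 * err m f x ?r"
        using Q(2)[OF order_refl] by (simp add: abs_minus_commute)
      also have "err m f x ?r \<le> ?F" using err_le[OF f zero_in_polys x r(1,2)] by simp
      finally have "avg x ?r (\<lambda>y. ennreal \<bar>Q J y\<bar>) \<le> 2 * ?F + ?F" by (simp add: mult_left_mono add_right_mono)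
      also have "2 * ?F + ?F = 3 * ?F" by (rule ennreal_double_add)
      finally show ?thesis .
    qed
    show "\<exists>T\<in>polys (int l). \<forall>y\<in>cube x t. ennreal \<bar>P y - T y\<bar> \<le> ennreal C * ((\<Sum>i\<le>J. ?w i * ?E i) + ?w J * ?F)"
    proof (intro bexI[of _ "\<lambda>y. T y + T' y"] polys_add T T' ballI)
      fix y assume y: "y \<in> cube x t"
      have "ennreal \<bar>P y - (T y + T' y)\<bar> \<le> ennreal \<bar>P y - Q J y - T y\<bar> + ennreal \<bar>Q J y - T' y\<bar>"
        by (simp flip: ennreal_plus add: ennreal_leI)
      also have "\<dots> \<le> ennreal C * (\<Sum>i\<le>J. ?w i * ?E i) + ennreal C * (?w J * ?F)"
      proof (intro add_mono)
        show "ennreal \<bar>P y - Q J y - T y\<bar> \<le> ennreal C * (\<Sum>i\<le>J. ?w i * ?E i)"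
          using T(2)[OF y] by (rule order_trans) (intro mult_right_mono ennreal_leI, auto simp: C_def)
        have "ennreal \<bar>Q J y - T' y\<bar> \<le> ennreal (C2 * ((1/2) ^ J) ^ Suc l) * avg x ?r (\<lambda>y. ennreal \<bar>Q J y\<bar>)"
          using T'le[OF y] unfolding ratio .
        also have "\<dots> \<le> ennreal (C2 * ((1/2) ^ J) ^ Suc l) * (3 * ?F)" by (intro mult_left_mono Qf) auto
        also have "\<dots> = ennreal (3 * C2) * (?w J * ?F)"
        proof -
          have "ennreal (C2 * ((1/2) ^ J) ^ Suc l) = ennreal C2 * ?w J" using C2 by (intro ennreal_mult) auto
          moreover have "ennreal (3 * C2) = 3 * ennreal C2" using C2 by (simp add: ennreal_mult)
          ultimately show ?thesis by (simp only: mult_ac)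
        qed
        also have "\<dots> \<le> ennreal C * (?w J * ?F)" by (intro mult_right_mono ennreal_leI) (auto simp: C_def)
        finally show "ennreal \<bar>Q J y - T' y\<bar> \<le> ennreal C * (?w J * ?F)" .
      qed
      finally show "ennreal \<bar>P y - (T y + T' y)\<bar> \<le> ennreal C * ((\<Sum>i\<le>J. ?w i * ?E i) + ?w J * ?F)"
        by (simp only: distrib_left)
    qed
  qed
qed

text \<open>Three differences are added: \<open>f - Q\<close> at the Lebesgue point
  \<open>y\<close>, \<open>Q - P\<close> between near-minimisers on \<open>cube y t\<close> and
  \<open>cube x (2 * t)\<close>, and \<open>P - T\<close> from truncation. \<open>Q\<close> varies
  with \<open>y\<close>, whereas \<open>T\<close> depends on \<open>x\<close> alone and so is a
  competitor in the best approximation on \<open>cube x t\<close>.\<close>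

lemma pointwise_estimate:
  assumes "l \<le> m"
  obtains C where "C > 0" and "\<And>f t J x. f \<in> borel_measurable borel \<Longrightarrow> (\<And>R. (\<integral>\<^sup>+x\<in>cube 0 R. ennreal \<bar>f x\<bar> \<partial>M) < \<infinity>) \<Longrightarrow>
     0 < t \<Longrightarrow> 1 \<le> J \<Longrightarrow> 2 ^ J * t \<le> 1 \<Longrightarrow> x \<in> S \<Longrightarrow> \<exists>T\<in>polys (int l). AE y in M. y \<in> cube x t \<longrightarrow>
       ennreal \<bar>f y - T y\<bar> \<le> ennreal C * ((\<Sum>j. err m f y (t / 2 ^ j)) +
          coarse_sum l m f x t J)"
proof -
  obtain C1 where C1: "C1 > 0" and cmp: "\<And>f x y s t P Q. f \<in> borel_measurable borel \<Longrightarrow> x \<in> S \<Longrightarrow> y \<in> S \<Longrightarrow>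
     0 < s \<Longrightarrow> s \<le> t \<Longrightarrow> t \<le> 1 \<Longrightarrow> t \<le> 4 * s \<Longrightarrow> cube y s \<subseteq> cube x t \<Longrightarrow>
     near_min m f y s P \<Longrightarrow> near_min m f x t Q \<Longrightarrow>
     dev y s P Q \<le> ennreal C1 * err m f x t \<and>
     (\<forall>w\<in>cube y s. ennreal \<bar>P w - Q w\<bar> \<le> ennreal C1 * err m f x t)"
    by (rule near_min_compare[of m]) blast
  obtain C2 where C2: "C2 > 0" and leb: "\<And>f y t P. f \<in> borel_measurable borel \<Longrightarrow> y \<in> S \<Longrightarrow> 0 < t \<Longrightarrow> t \<le> 1 \<Longrightarrow>
     liminf (\<lambda>J. avg y (t / 2 ^ J) (\<lambda>z. ennreal \<bar>f z - f y\<bar>)) = 0 \<Longrightarrow> near_min m f y t P \<Longrightarrow>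
     ennreal \<bar>f y - P y\<bar> \<le> ennreal C2 * (\<Sum>j. err m f y (t / 2 ^ j))"
    by (rule Lebesgue_point_approx[of m]) blast
  obtain C3 where C3: "C3 > 0" and trunc: "\<And>f x t J P. f \<in> borel_measurable borel \<Longrightarrow> x \<in> S \<Longrightarrow> 0 < t \<Longrightarrow> 1 \<le> J \<Longrightarrow> 2 ^ J * t \<le> 1 \<Longrightarrow>
     near_min m f x (2 * t) P \<Longrightarrow> \<exists>T\<in>polys (int l). \<forall>y\<in>cube x t. ennreal \<bar>P y - T y\<bar> \<le> ennreal C3 *
        coarse_sum l m f x t J"
    by (rule near_min_truncate[OF assms]) blast
  \<comment> \<open>The error at radius \<open>2 * t\<close> is the term \<open>i = 1\<close> of the
    coarse sum, whose weight is \<open>(1/2) ^ Suc l\<close>.\<close>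
  define K where "K = C1 * 2 ^ Suc l"
  have K: "0 < K" using C1 by (simp add: K_def)
  define C where "C = C2 + (K + C3)"
  have C: "0 < C" using C2 C3 K by (simp add: C_def)
  show ?thesis
  proof (rule that[OF C])
    fix f :: "real^'n \<Rightarrow> real" and x and t :: real and J :: nat
    assume f [measurable]: "f \<in> borel_measurable borel" and loc: "\<And>R. (\<integral>\<^sup>+x\<in>cube 0 R. ennreal \<bar>f x\<bar> \<partial>M) < \<infinity>"
      and tJ: "0 < t" "1 \<le> J" "2 ^ J * t \<le> 1" and x: "x \<in> S"
    have "(2::real) ^ 1 \<le> 2 ^ J" using tJ by (intro power_increasing) auto
    then have "2 * t \<le> 2 ^ J * t" using tJ(1) by (intro mult_right_mono) auto
    then have t: "0 < t" "2 * t \<le> 1" using tJ by - (linarith+)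
    obtain P where P: "near_min m f x (2 * t) P"
      using near_min_exists[OF f x, of "2 * t" m] t by auto
    let ?W1 = "\<Sum>i\<le>J. ennreal (((1/2) ^ i) ^ Suc l) * err m f x (2 ^ i * t)"
    let ?W = "?W1 + ennreal (((1/2) ^ J) ^ Suc l) * avg x (2 ^ J * t) (\<lambda>z. ennreal \<bar>f z\<bar>)"
    obtain T where T: "T \<in> polys (int l)" and PT: "\<And>y. y \<in> cube x t \<Longrightarrow> ennreal \<bar>P y - T y\<bar> \<le> ennreal C3 * ?W"
      using trunc[OF f x tJ P] by blast
    have Eb: "ennreal C1 * err m f x (2 * t) \<le> ennreal K * ?W"
    proof -
      have "ennreal C1 * err m f x (2 * t) = ennreal K * (ennreal (((1/2) ^ 1) ^ Suc l) * err m f x (2 ^ 1 * t))"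
      proof -
        have "ennreal K * ennreal (((1/2) ^ 1) ^ Suc l) = ennreal (K * ((1/2) ^ 1) ^ Suc l)"
          using K by (intro ennreal_mult[symmetric]) auto
        also have "K * ((1/2) ^ 1) ^ Suc l = C1" unfolding K_def by (simp add: power_one_over)
        finally show ?thesis by (simp add: mult.assoc[symmetric])
      qed
      also have "\<dots> \<le> ennreal K * ?W1"
        using tJ by (intro mult_left_mono member_le_sum) auto
      also have "\<dots> \<le> ennreal K * ?W" by (intro mult_left_mono) auto
      finally show ?thesis .
    qed
    have leb': "AE y in M. liminf (\<lambda>J. avg y (t / 2 ^ J) (\<lambda>z. ennreal \<bar>f z - f y\<bar>)) = 0"
    proof (rule Lebesgue_points[OF f])
      show "0 < t / 2 ^ J" for J using t by simp
      have le: "t / 2 ^ J \<le> t / 1" for J using t by (intro divide_left_mono) auto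
      show "t / 2 ^ J \<le> 1" for J using le[of J] t by linarith
      have "(\<lambda>J. t * (1/2) ^ J) \<longlonglongrightarrow> t * 0" by (intro tendsto_intros LIMSEQ_realpow_zero) auto
      then show "(\<lambda>J. t / 2 ^ J) \<longlonglongrightarrow> 0" by (simp add: power_one_over field_simps)
    qed (use loc in auto)
    show "\<exists>T\<in>polys (int l). AE y in M. y \<in> cube x t \<longrightarrow>
       ennreal \<bar>f y - T y\<bar> \<le> ennreal C * ((\<Sum>j. err m f y (t / 2 ^ j)) + ?W)"
    proof (rule bexI[OF _ T])
      show "AE y in M. y \<in> cube x t \<longrightarrow> ennreal \<bar>f y - T y\<bar> \<le> ennreal C * ((\<Sum>j. err m f y (t / 2 ^ j)) + ?W)"
        using AE_in_S leb'
      proof eventually_elim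
        case (elim y)
        show ?case
        proof
          assume yx: "y \<in> cube x t"
          let ?A = "\<Sum>j. err m f y (t / 2 ^ j)"
          obtain Q where Q: "near_min m f y t Q"
            using near_min_exists[OF f elim(1), of t m] t by auto
          have "ennreal \<bar>f y - T y\<bar> \<le> ennreal (\<bar>f y - Q y\<bar> + (\<bar>Q y - P y\<bar> + \<bar>P y - T y\<bar>))"
            by (intro ennreal_leI) linarith
          also have "\<dots> = ennreal \<bar>f y - Q y\<bar> + (ennreal \<bar>Q y - P y\<bar> + ennreal \<bar>P y - T y\<bar>)"
            by simp
          also have "\<dots> \<le> ennreal C2 * ?A + (ennreal K * ?W + ennreal C3 * ?W)"
          proof (intro add_mono)
            show "ennreal \<bar>f y - Q y\<bar> \<le> ennreal C2 * ?A"
              using t elim by (intro leb f Q) auto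
            have "ennreal \<bar>Q y - P y\<bar> \<le> ennreal C1 * err m f x (2 * t)"
              using cmp[OF f x elim(1) _ _ _ _ _ Q P] t yx cube_subset[OF yx, of t "2 * t"] by (auto simp: cube_self)
            then show "ennreal \<bar>Q y - P y\<bar> \<le> ennreal K * ?W" using Eb by (rule order_trans)
          qed (rule PT[OF yx])
          also have "\<dots> \<le> ennreal C * ?A + ennreal C * ?W"
          proof (intro add_mono)
            show "ennreal C2 * ?A \<le> ennreal C * ?A"
              using C3 K by (intro mult_right_mono ennreal_leI) (auto simp: C_def)
            have "ennreal K * ?W + ennreal C3 * ?W = ennreal (K + C3) * ?W"
              using K C3 by (simp add: distrib_right)
            also have "\<dots> \<le> ennreal C * ?W"
              using C2 by (intro mult_right_mono ennreal_leI) (auto simp: C_def)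
            finally show "ennreal K * ?W + ennreal C3 * ?W \<le> ennreal C * ?W" .
          qed
          finally show "ennreal \<bar>f y - T y\<bar> \<le> ennreal C * (?A + ?W)" by (simp only: distrib_left)
        qed
      qed
    qed
  qed
qed

section \<open>Integrating the pointwise estimate over \<open>S\<close> at a fixed scale\<close>

lemma integral_avg_le:
  assumes [measurable]: "B \<in> borel_measurable borel" and t: "0 < t" "t \<le> 1"
  shows "(\<integral>\<^sup>+x. avg x t B \<partial>M) \<le> ennreal (c2 / c1) * (\<integral>\<^sup>+x. B x \<partial>M)"
proof -
  interpret sigma_finite_measure M by (rule sigma_finite_M)
  let ?k = "ennreal (1 / (c1 * t powr d))"
  have "(\<integral>\<^sup>+x. avg x t B \<partial>M) \<le> (\<integral>\<^sup>+x. ?k * (\<integral>\<^sup>+y\<in>cube x t. B y \<partial>M) \<partial>M)"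
  proof (rule nn_integral_mono_AE)
    show "AE x in M. avg x t B \<le> ?k * (\<integral>\<^sup>+y\<in>cube x t. B y \<partial>M)"
      using AE_in_S
    proof eventually_elim
      case (elim x)
      have "avg x t B = (\<integral>\<^sup>+y\<in>cube x t. B y \<partial>M) / emeasure M (cube x t)" by (intro avg_eq) measurable
      also have "\<dots> \<le> (\<integral>\<^sup>+y\<in>cube x t. B y \<partial>M) / ennreal (c1 * t powr d)"
        using elim t by (intro divide_mono_ennreal cube_lower) auto
      also have "\<dots> = ?k * (\<integral>\<^sup>+y\<in>cube x t. B y \<partial>M)"
        using c1_pos t by (simp add: divide_ennreal_def inverse_ennreal mult.commute inverse_eq_divide)
      finally show ?case .
    qed
  qed
  \<comment> \<open>After the integrals are exchanged, symmetry of \<open>y \<in> cube x t\<close>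
    turns the inner one into the measure of \<open>cube y t\<close>, which cancels the normalisation
    up to \<open>c2 / c1\<close>.\<close>
  also have "\<dots> = ?k * (\<integral>\<^sup>+x. (\<integral>\<^sup>+y. B y * indicator (cube x t) y \<partial>M) \<partial>M)"
    by (intro nn_integral_cmult) measurable
  also have "(\<integral>\<^sup>+x. (\<integral>\<^sup>+y. B y * indicator (cube x t) y \<partial>M) \<partial>M) = (\<integral>\<^sup>+y. (\<integral>\<^sup>+x. B y * indicator (cube x t) y \<partial>M) \<partial>M)"
    by (intro Fubini_M[symmetric]) measurable
  also have "\<dots> = (\<integral>\<^sup>+y. B y * emeasure M (cube y t) \<partial>M)"
  proof (intro nn_integral_cong)
    fix y
    have "(\<integral>\<^sup>+x. B y * indicator (cube x t) y \<partial>M) = (\<integral>\<^sup>+x. B y * indicator (cube y t) x \<partial>M)"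
      by (intro nn_integral_cong) (simp add: indicator_def cube_commute)
    then show "(\<integral>\<^sup>+x. B y * indicator (cube x t) y \<partial>M) = B y * emeasure M (cube y t)"
      by (simp add: nn_integral_cmult)
  qed
  also have "\<dots> \<le> (\<integral>\<^sup>+y. B y * ennreal (c2 * t powr d) \<partial>M)"
    using AE_in_S t by (intro nn_integral_mono_AE) (auto elim!: eventually_mono intro!: mult_left_mono cube_upper)
  also have "\<dots> = ennreal (c2 * t powr d) * (\<integral>\<^sup>+y. B y \<partial>M)"
    by (subst nn_integral_multc) (auto simp: mult.commute)
  also have "?k * (ennreal (c2 * t powr d) * (\<integral>\<^sup>+y. B y \<partial>M)) = ennreal (1 / (c1 * t powr d) * (c2 * t powr d)) * (\<integral>\<^sup>+y. B y \<partial>M)"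
    using c1_pos c2_pos by (subst ennreal_mult) (auto simp: mult.assoc)
  also have "1 / (c1 * t powr d) * (c2 * t powr d) = c2 / c1" using t by simp
  finally show ?thesis by (simp add: mult_left_mono)
qed

lemma Lp_norm_avg:
  assumes [measurable]: "h \<in> borel_measurable borel" and t: "0 < t" "t \<le> 1" and p: "1 \<le> p"
  shows "Lp_norm M p (\<lambda>x. avg x t (\<lambda>y. h y epowr p) epowr (1 / p)) \<le> ennreal ((c2 / c1) powr (1 / p)) * Lp_norm M p h"
proof -
  have "Lp_norm M p (\<lambda>x. avg x t (\<lambda>y. h y epowr p) epowr (1 / p)) = (\<integral>\<^sup>+x. avg x t (\<lambda>y. h y epowr p) \<partial>M) epowr (1 / p)"
    using p by (simp add: Lp_norm_def)
  also have "\<dots> \<le> (ennreal (c2 / c1) * (\<integral>\<^sup>+x. h x epowr p \<partial>M)) epowr (1 / p)"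
    using p t by (intro epowr_mono integral_avg_le) auto
  also have "\<dots> = ennreal ((c2 / c1) powr (1 / p)) * Lp_norm M p h"
    using c1_pos c2_pos by (simp add: epowr_mult Lp_norm_def)
  finally show ?thesis .
qed

lemma Lp_locally_integrable:
  assumes [measurable]: "f \<in> borel_measurable borel" and p: "1 \<le> p"
    and fin: "Lp_norm M p (\<lambda>x. ennreal \<bar>f x\<bar>) < \<infinity>"
  shows "(\<integral>\<^sup>+x\<in>cube 0 R. ennreal \<bar>f x\<bar> \<partial>M) < \<infinity>"
proof -
  have "x \<le> 1 + x powr p" if "0 \<le> x" for x :: real
  proof (cases "x \<le> 1")
    case False
    then have "x powr 1 \<le> x powr p" using p by (intro powr_mono) auto
    then show ?thesis using False by simp
  qed (use that in \<open>auto intro: order_trans\<close>)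
  then have "ennreal \<bar>f x\<bar> \<le> ennreal (1 + \<bar>f x\<bar> powr p)" for x by (intro ennreal_leI) auto
  then have "ennreal \<bar>f x\<bar> \<le> 1 + ennreal (\<bar>f x\<bar> powr p)" for x by simp
  then have "(\<integral>\<^sup>+x\<in>cube 0 R. ennreal \<bar>f x\<bar> \<partial>M) \<le> (\<integral>\<^sup>+x. indicator (cube 0 R) x + ennreal \<bar>f x\<bar> epowr p \<partial>M)"
    by (intro nn_integral_mono) (simp split: split_indicator)
  also have "\<dots> = emeasure M (cube 0 R) + (\<integral>\<^sup>+x. ennreal \<bar>f x\<bar> epowr p \<partial>M)"
    by (subst nn_integral_add) auto
  also have "\<dots> < \<infinity>"
    using fin cube_origin_finite[of R] by (simp add: Lp_norm_def)
  finally show ?thesis .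
qed

text \<open>Vanishing outside (0, 1] allows the dyadic sums to run over all indices although the
  estimates hold only for radii up to 1.\<close>

definition err_norm :: "nat \<Rightarrow> real \<Rightarrow> (real^'n \<Rightarrow> real) \<Rightarrow> real \<Rightarrow> ennreal" where
  "err_norm m p f s = (if 0 < s \<and> s \<le> 1 then Lp_norm M p (\<lambda>x. err m f x s) else 0)"

lemma err_norm_measurable [measurable]:
  assumes [measurable]: "f \<in> borel_measurable borel"
  shows "err_norm m p f \<in> borel_measurable borel"
proof -
  interpret sigma_finite_measure M by (rule sigma_finite_M)
  have [measurable]: "(\<lambda>(s, x). err m f x s) \<in> borel_measurable (borel \<Otimes>\<^sub>M M)"
    by measurable
  show ?thesis unfolding err_norm_def Lp_norm_def by measurable
qed

text \<open>The upper bound keeps the top scale admissible; the lower bound, through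
  \<open>(1/2) ^ J < 2 * t\<close>, turns the weight at the top scale into a power of
  \<open>t\<close>.\<close>

lemma dyadic_scale:
  fixes t :: real
  assumes "0 < t" "t \<le> 1/2"
  obtains J :: nat where "1 \<le> J" "1/2 < 2 ^ J * t" "2 ^ J * t \<le> 1"
proof -
  define J where "J = (LEAST n. 1/2 < 2 ^ n * t)"
  obtain n where "1 / (2 * t) < 2 ^ n" using real_arch_pow[of 2 "1 / (2 * t)"] by auto
  then have "1/2 < 2 ^ n * t" using assms by (simp add: field_simps)
  then have J: "1/2 < 2 ^ J * t" unfolding J_def by (rule LeastI)
  moreover have "J \<noteq> 0"
  proof
    assume "J = 0"
    then show False using J assms by simp
  qed
  then obtain K where K: "J = Suc K" by (cases J) auto
  then have "\<not> 1/2 < 2 ^ K * t" using not_less_Least[of K "\<lambda>n. 1/2 < 2 ^ n * t"] by (simp add: J_def)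
  then have "2 ^ J * t \<le> 1" using K by simp
  ultimately show ?thesis using K by (intro that[of J]) auto
qed

abbreviation best_Lp :: "nat \<Rightarrow> real \<Rightarrow> (real^'n \<Rightarrow> real) \<Rightarrow> real^'n \<Rightarrow> real \<Rightarrow> ennreal" where
  "best_Lp l p f x t \<equiv> (INF T\<in>polys (int l). avg x t (\<lambda>y. ennreal (\<bar>f y - T y\<bar> powr p)) epowr (1 / p))"

text \<open>\<open>W\<close> does not depend on \<open>y\<close>, so it leaves the average
  unchanged. The crude inequality for powers of sums is used twice, with \<open>p\<close> inside and
  with \<open>1 / p\<close> outside, which produces the two powers of 2.\<close>

lemma best_Lp_le:
  assumes [measurable]: "f \<in> borel_measurable borel" "A \<in> borel_measurable borel"
    and T: "T \<in> polys (int l)" and x: "x \<in> S" and t: "0 < t" "t \<le> 1" and p: "1 \<le> p" and C: "0 < C"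
    and le: "AE y in M. y \<in> cube x t \<longrightarrow> ennreal \<bar>f y - T y\<bar> \<le> ennreal C * (A y + W)"
  shows "best_Lp l p f x t
    \<le> ennreal (C * 2 * 2 powr (1 / p)) * (avg x t (\<lambda>y. A y epowr p) epowr (1 / p) + W)"
proof -
  let ?K = "ennreal (C powr p) * ennreal (2 powr p)"
  have "best_Lp l p f x t
      \<le> avg x t (\<lambda>y. ennreal (\<bar>f y - T y\<bar> powr p)) epowr (1 / p)"
    by (intro INF_lower T)
  also have "\<dots> \<le> avg x t (\<lambda>y. ?K * (A y epowr p + W epowr p)) epowr (1 / p)"
  proof (intro epowr_mono avg_mono_AE)
    show "AE y in M. y \<in> cube x t \<longrightarrow> ennreal (\<bar>f y - T y\<bar> powr p) \<le> ?K * (A y epowr p + W epowr p)"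
      using le
    proof eventually_elim
      case (elim y)
      show ?case
      proof
        assume "y \<in> cube x t"
        then have "ennreal \<bar>f y - T y\<bar> epowr p \<le> (ennreal C * (A y + W)) epowr p"
          using elim p by (intro epowr_mono) auto
        also have "\<dots> = ennreal (C powr p) * (A y + W) epowr p"
          using C by (simp add: epowr_mult)
        also have "\<dots> \<le> ennreal (C powr p) * (ennreal (2 powr p) * (A y epowr p + W epowr p))"
          using p by (intro mult_left_mono epowr_add_le) auto
        finally show "ennreal (\<bar>f y - T y\<bar> powr p) \<le> ?K * (A y epowr p + W epowr p)"
          by (simp add: mult.assoc)
      qed
    qed
  qed (use p in auto)
  also have "avg x t (\<lambda>y. ?K * (A y epowr p + W epowr p)) = ?K * (avg x t (\<lambda>y. A y epowr p) + W epowr p)"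
    using x t by (simp add: avg_cmult avg_add avg_const)
  also have "\<dots> epowr (1 / p) = ennreal (C * 2) * (avg x t (\<lambda>y. A y epowr p) + W epowr p) epowr (1 / p)"
    using C p by (simp add: epowr_mult powr_powr ennreal_mult)
  also have "\<dots> \<le> ennreal (C * 2) * (ennreal (2 powr (1 / p)) * (avg x t (\<lambda>y. A y epowr p) epowr (1 / p) + (W epowr p) epowr (1 / p)))"
    using p by (intro mult_left_mono epowr_add_le) auto
  also have "\<dots> = ennreal (C * 2 * 2 powr (1 / p)) * (avg x t (\<lambda>y. A y epowr p) epowr (1 / p) + W)"
    using C p by (simp add: ennreal_mult mult.assoc)
  finally show ?thesis .
qed

text \<open>The best approximation with exponent \<open>p\<close> is replaced by a Borel majorant
  \<open>U\<close>, assembled from averages and \<open>err\<close>, because Minkowski's inequality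
  needs measurable functions.\<close>

lemma scale_estimate:
  assumes lm: "l \<le> m" and p: "1 \<le> p"
  obtains C where "C > 0" and "\<And>f t. f \<in> borel_measurable borel \<Longrightarrow> Lp_norm M p (\<lambda>x. ennreal \<bar>f x\<bar>) < \<infinity> \<Longrightarrow>
     0 < t \<Longrightarrow> t \<le> 1 \<Longrightarrow> \<exists>U\<in>borel_measurable borel.
       (\<forall>x\<in>S. best_Lp l p f x t \<le> U x) \<and>
       Lp_norm M p U \<le> ennreal C * dyadic_sum (Suc l) (err_norm m p f) (Lp_norm M p (\<lambda>x. ennreal \<bar>f x\<bar>)) t"
proof -
  obtain C1 where C1: "C1 > 0" and pw: "\<And>f t J x. f \<in> borel_measurable borel \<Longrightarrow> (\<And>R. (\<integral>\<^sup>+x\<in>cube 0 R. ennreal \<bar>f x\<bar> \<partial>M) < \<infinity>) \<Longrightarrow>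
     0 < t \<Longrightarrow> 1 \<le> J \<Longrightarrow> 2 ^ J * t \<le> 1 \<Longrightarrow> x \<in> S \<Longrightarrow> \<exists>T\<in>polys (int l). AE y in M. y \<in> cube x t \<longrightarrow>
       ennreal \<bar>f y - T y\<bar> \<le> ennreal C1 * ((\<Sum>j. err m f y (t / 2 ^ j)) +
          coarse_sum l m f x t J)"
    by (rule pointwise_estimate[OF lm]) blast
  define D where "D = max 1 ((c2 / c1) powr (1 / p))"
  have D: "1 \<le> D" by (simp add: D_def)
  define K where "K = C1 * 2 * 2 powr (1 / p)"
  have K: "0 < K" using C1 by (simp add: K_def)
  define C where "C = (K + 1) * D * 2 ^ Suc l"
  have C: "0 < C" using K D by (simp add: C_def)
  have LpD: "Lp_norm M p (\<lambda>x. avg x t (\<lambda>y. h y epowr p) epowr (1 / p)) \<le> ennreal D * Lp_norm M p h"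
    if "h \<in> borel_measurable borel" "0 < t" "t \<le> 1" for h t
    by (rule order_trans[OF Lp_norm_avg[OF that p]]) (intro mult_right_mono ennreal_leI, auto simp: D_def)
  show ?thesis
  proof (rule that[OF C])
    fix f :: "real^'n \<Rightarrow> real" and t :: real
    assume f [measurable]: "f \<in> borel_measurable borel" and fin: "Lp_norm M p (\<lambda>x. ennreal \<bar>f x\<bar>) < \<infinity>"
      and t: "0 < t" "t \<le> 1"
    let ?F = "Lp_norm M p (\<lambda>x. ennreal \<bar>f x\<bar>)"
    let ?w = "\<lambda>i. ennreal (((1/2) ^ i) ^ Suc l)"
    let ?X = "\<Sum>j. err_norm m p f (t / 2 ^ j)" and ?Y = "\<Sum>i. ?w i * err_norm m p f (2 ^ i * t)"
    let ?Z = "ennreal (t ^ Suc l) * ?F"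
    show "\<exists>U\<in>borel_measurable borel.
       (\<forall>x\<in>S. best_Lp l p f x t \<le> U x) \<and>
       Lp_norm M p U \<le> ennreal C * (?X + ?Y + ?Z)"
    proof (cases "t \<le> 1/2")
      \<comment> \<open>Here twice the radius would exceed 1 and no chain can be started; the zero
        polynomial suffices because \<open>t ^ Suc l\<close> is bounded below.\<close>
      case False
      define U where "U x = avg x t (\<lambda>y. ennreal \<bar>f y\<bar> epowr p) epowr (1 / p)" for x
      have [measurable]: "U \<in> borel_measurable borel" unfolding U_def by measurable
      have "best_Lp l p f x t \<le> U x" for x
        using INF_lower[OF zero_in_polys, of "\<lambda>T. avg x t (\<lambda>y. ennreal (\<bar>f y - T y\<bar> powr p)) epowr (1 / p)" "int l"]
        by (simp add: U_def)
      moreover have "Lp_norm M p U \<le> ennreal C * (?X + ?Y + ?Z)"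
      proof -
        have "Lp_norm M p U \<le> ennreal D * ?F" unfolding U_def using t by (intro LpD) auto
        also have "\<dots> \<le> ennreal (C * t ^ Suc l) * ?F"
        proof (intro mult_right_mono ennreal_leI)
          have "1 \<le> (2 * t) ^ Suc l" using False by (intro one_le_power) auto
          then have "(0 + 1) * D * 1 \<le> (K + 1) * D * (2 * t) ^ Suc l"
            using D K by (intro mult_mono) auto
          then show "D \<le> C * t ^ Suc l" by (simp only: C_def power_mult_distrib mult.assoc add_0 mult_1 mult_1_right)
        qed simp
        also have "\<dots> = ennreal C * ?Z"
          using C t by (simp add: ennreal_mult mult.assoc del: power_Suc)
        also have "\<dots> \<le> ennreal C * (?X + ?Y + ?Z)" by (intro mult_left_mono) auto
        finally show ?thesis .
      qed
      ultimately show ?thesis by (intro bexI[of _ U]) auto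
    next
      case True
      obtain J :: nat where J: "1 \<le> J" "1/2 < 2 ^ J * t" "2 ^ J * t \<le> 1"
        using dyadic_scale[OF t(1) True] by blast
      define A where "A y = (\<Sum>j. err m f y (t / 2 ^ j))" for y
      define V where "V x = avg x (2 ^ J * t) (\<lambda>z. ennreal \<bar>f z\<bar>)" for x
      define W where "W x = (\<Sum>i\<le>J. ?w i * err m f x (2 ^ i * t)) + ?w J * V x" for x
      have [measurable]: "A \<in> borel_measurable borel" "V \<in> borel_measurable borel" "W \<in> borel_measurable borel"
        unfolding A_def V_def W_def by measurable
      define U where "U x = ennreal K * (avg x t (\<lambda>y. A y epowr p) epowr (1 / p) + W x)" for x
      have [measurable]: "U \<in> borel_measurable borel" unfolding U_def by measurable
      have "best_Lp l p f x t \<le> U x" if x: "x \<in> S" for x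
      proof -
        have "\<exists>T\<in>polys (int l). AE y in M. y \<in> cube x t \<longrightarrow> ennreal \<bar>f y - T y\<bar> \<le> ennreal C1 * (A y + W x)"
          unfolding A_def W_def V_def
          by (rule pw[OF f Lp_locally_integrable[OF f p fin] t(1) J(1,3) x])
        then obtain T where T: "T \<in> polys (int l)" "AE y in M. y \<in> cube x t \<longrightarrow> ennreal \<bar>f y - T y\<bar> \<le> ennreal C1 * (A y + W x)"
          by blast
        show ?thesis unfolding U_def K_def
          by (rule best_Lp_le[OF f _ T(1) x t p C1 T(2)]) simp
      qed
      moreover have "Lp_norm M p U \<le> ennreal C * (?X + ?Y + ?Z)"
      proof -
        have A: "Lp_norm M p A \<le> ?X"
        proof -
          have "Lp_norm M p A \<le> (\<Sum>j. Lp_norm M p (\<lambda>x. err m f x (t / 2 ^ j)))"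
            unfolding A_def using p by (intro Lp_norm_suminf) measurable
          also have "\<dots> = ?X"
          proof (intro suminf_cong)
            fix j
            have "t / 2 ^ j \<le> t / 1" using t by (intro divide_left_mono) auto
            then have "t / 2 ^ j \<le> 1" using t by linarith
            then show "Lp_norm M p (\<lambda>x. err m f x (t / 2 ^ j)) = err_norm m p f (t / 2 ^ j)"
              using t by (simp add: err_norm_def)
          qed
          finally show ?thesis .
        qed
        have W: "Lp_norm M p W \<le> ?Y + ?w J * Lp_norm M p V"
        proof -
          have fs: "(\<Sum>i\<le>J. h i) = (\<Sum>i. if i \<le> J then h i else 0)" for h :: "nat \<Rightarrow> ennreal"
            by (subst suminf_finite[of "{..J}"]) auto
          have "Lp_norm M p W \<le> Lp_norm M p (\<lambda>x. \<Sum>i\<le>J. ?w i * err m f x (2 ^ i * t)) + Lp_norm M p (\<lambda>x. ?w J * V x)"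
            unfolding W_def using p by (intro Lp_norm_add) measurable
          also have "Lp_norm M p (\<lambda>x. ?w J * V x) = ?w J * Lp_norm M p V"
            using p by (intro Lp_norm_cmult) auto
          also have "Lp_norm M p (\<lambda>x. \<Sum>i\<le>J. ?w i * err m f x (2 ^ i * t))
              \<le> (\<Sum>i. Lp_norm M p (\<lambda>x. if i \<le> J then ?w i * err m f x (2 ^ i * t) else 0))"
            unfolding fs using p by (intro Lp_norm_suminf) measurable
          also have "\<dots> \<le> ?Y"
          proof (intro suminf_le)
            fix i
            show "Lp_norm M p (\<lambda>x. if i \<le> J then ?w i * err m f x (2 ^ i * t) else 0) \<le> ?w i * err_norm m p f (2 ^ i * t)"
            proof (cases "i \<le> J")
              case iJ: True
              then have "(2::real) ^ i * t \<le> 2 ^ J * t" using t by (intro mult_right_mono power_increasing) auto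
              from this J(3) have "2 ^ i * t \<le> 1" by (rule order_trans)
              moreover have "0 < 2 ^ i * t" using t by simp
              moreover have "Lp_norm M p (\<lambda>x. ?w i * err m f x (2 ^ i * t)) = ?w i * Lp_norm M p (\<lambda>x. err m f x (2 ^ i * t))"
                using p by (intro Lp_norm_cmult) auto
              ultimately show ?thesis using iJ by (simp add: err_norm_def)
            qed (simp add: Lp_norm_def)
          qed auto
          finally show ?thesis by (simp add: add_right_mono)
        qed
        have V: "Lp_norm M p V \<le> ennreal D * ?F"
        proof -
          have "Lp_norm M p V \<le> Lp_norm M p (\<lambda>x. avg x (2 ^ J * t) (\<lambda>y. ennreal \<bar>f y\<bar> epowr p) epowr (1 / p))"
          proof (rule Lp_norm_mono_AE)
            show "AE x in M. V x \<le> avg x (2 ^ J * t) (\<lambda>y. ennreal \<bar>f y\<bar> epowr p) epowr (1 / p)"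
              using AE_in_S
            proof eventually_elim
              case (elim x)
              have "V x epowr p \<le> avg x (2 ^ J * t) (\<lambda>y. ennreal \<bar>f y\<bar> epowr p)"
                unfolding V_def using p J t elim by (intro avg_Jensen) auto
              then show ?case using p by (subst (asm) epowr_le_iff) auto
            qed
          qed (use p in auto)
          also have "\<dots> \<le> ennreal D * ?F" using J t by (intro LpD) auto
          finally show ?thesis .
        qed
        \<comment> \<open>The lower bound \<open>1/2 < 2 ^ J * t\<close> converts the weight of the
          top scale into \<open>t ^ Suc l\<close>, at the price of \<open>2 ^ Suc l\<close>.\<close>
        have wJ: "?w J * (ennreal D * ?F) \<le> ennreal (D * 2 ^ Suc l) * ?Z"
        proof -
          have "((1/2::real) ^ J) ^ Suc l \<le> (2 * t) ^ Suc l"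
            using J(2) by (intro power_mono) (auto simp: power_one_over field_simps)
          then have "((1/2) ^ J) ^ Suc l * D \<le> D * 2 ^ Suc l * t ^ Suc l"
            using D by (simp add: power_mult_distrib mult.commute[of D] mult_right_mono del: power_Suc)
          then have "ennreal (((1/2) ^ J) ^ Suc l * D) * ?F \<le> ennreal (D * 2 ^ Suc l * t ^ Suc l) * ?F"
            by (intro mult_right_mono ennreal_leI) auto
          then show ?thesis using D t by (simp add: ennreal_mult mult.assoc del: power_Suc)
        qed
        let ?A = "\<lambda>x. avg x t (\<lambda>y. A y epowr p) epowr (1 / p)"
        have "Lp_norm M p U = ennreal K * Lp_norm M p (\<lambda>x. ?A x + W x)"
          unfolding U_def using p by (intro Lp_norm_cmult) measurable
        also have "\<dots> \<le> ennreal K * (Lp_norm M p ?A + Lp_norm M p W)"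
          using p by (intro mult_left_mono Lp_norm_add) measurable
        also have "\<dots> \<le> ennreal K * (ennreal D * ?X + (?Y + ennreal (D * 2 ^ Suc l) * ?Z))"
        proof (intro mult_left_mono add_mono)
          have "Lp_norm M p ?A \<le> ennreal D * Lp_norm M p A" using t by (intro LpD) auto
          also have "\<dots> \<le> ennreal D * ?X" by (intro mult_left_mono A) auto
          finally show "Lp_norm M p ?A \<le> ennreal D * ?X" .
          have "Lp_norm M p W \<le> ?Y + ?w J * (ennreal D * ?F)"
            using W V by (meson add_left_mono mult_left_mono order_trans zero_le)
          also have "\<dots> \<le> ?Y + ennreal (D * 2 ^ Suc l) * ?Z" by (intro add_left_mono wJ)
          finally show "Lp_norm M p W \<le> ?Y + ennreal (D * 2 ^ Suc l) * ?Z" .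
        qed auto
        also have "\<dots> \<le> ennreal K * (ennreal (D * 2 ^ Suc l) * ?X + (ennreal (D * 2 ^ Suc l) * ?Y + ennreal (D * 2 ^ Suc l) * ?Z))"
        proof -
          have one: "1 \<le> (2::real) ^ Suc l" by (rule one_le_power) simp
          have a: "D \<le> D * 2 ^ Suc l" using mult_left_mono[OF one, of D] D by (simp del: power_Suc)
          have "1 \<le> D * 2 ^ Suc l" using D a by (rule order_trans)
          then have "1 * ?Y \<le> ennreal (D * 2 ^ Suc l) * ?Y" by (intro mult_right_mono) (simp_all add: ennreal_leI flip: ennreal_1)
          then show ?thesis using a by (intro mult_left_mono add_mono mult_right_mono ennreal_leI) auto
        qed
        also have "\<dots> = ennreal (K * (D * 2 ^ Suc l)) * (?X + ?Y + ?Z)"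
          using K D by (subst ennreal_mult) (auto simp: distrib_left mult.assoc add.assoc)
        also have "\<dots> \<le> ennreal C * (?X + ?Y + ?Z)"
          unfolding C_def mult.assoc[of "K + 1"] using D by (intro mult_right_mono ennreal_leI) auto
        finally show ?thesis .
      qed
      ultimately show ?thesis by (intro bexI[of _ U]) auto
    qed
  qed
qed

end

section \<open>Hardy's inequality for dyadic sums\<close>

text \<open>The measure dt/t on the positive half-line, which is invariant under dilations.\<close>

definition log_measure :: "real measure" where
  "log_measure = density lborel (\<lambda>t. ennreal (1 / t) * indicator {0<..} t)"

lemma sets_log_measure [measurable_cong, simp]: "sets log_measure = sets borel"
  by (simp add: log_measure_def)

lemma nn_integral_log_measure:
  "g \<in> borel_measurable borel \<Longrightarrow> (\<integral>\<^sup>+t. g t \<partial>log_measure) = (\<integral>\<^sup>+t\<in>{0<..}. ennreal (1 / t) * g t \<partial>lborel)"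
  unfolding log_measure_def by (subst nn_integral_density) (auto simp: mult_ac)

lemma AE_log_measure_pos: "AE t in log_measure. 0 < t"
  unfolding log_measure_def by (subst AE_density) (auto simp: indicator_def split: if_splits)

lemma log_measure_scale:
  assumes [measurable]: "g \<in> borel_measurable borel" and c: "0 < c"
  shows "(\<integral>\<^sup>+t. g (c * t) \<partial>log_measure) = (\<integral>\<^sup>+t. g t \<partial>log_measure)"
proof -
  have "(\<integral>\<^sup>+t. g t \<partial>log_measure) = (\<integral>\<^sup>+t\<in>{0<..}. ennreal (1 / t) * g t \<partial>lborel)"
    by (rule nn_integral_log_measure) simp
  also have "\<dots> = ennreal c * (\<integral>\<^sup>+t. ennreal (1 / (c * t)) * g (c * t) * indicator {0<..} (c * t) \<partial>lborel)"
    using c by (subst nn_integral_real_affine[where c=c and t=0]) auto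
  also have "\<dots> = (\<integral>\<^sup>+t. ennreal c * (ennreal (1 / (c * t)) * g (c * t) * indicator {0<..} (c * t)) \<partial>lborel)"
    by (subst nn_integral_cmult) auto
  also have "\<dots> = (\<integral>\<^sup>+t\<in>{0<..}. ennreal (1 / t) * g (c * t) \<partial>lborel)"
  proof (intro nn_integral_cong)
    fix t :: real
    show "ennreal c * (ennreal (1 / (c * t)) * g (c * t) * indicator {0<..} (c * t)) = ennreal (1 / t) * g (c * t) * indicator {0<..} t"
    proof (cases "0 < t")
      case True
      then have "ennreal c * ennreal (1 / (c * t)) = ennreal (1 / t)"
        using c by (subst ennreal_mult[symmetric]) auto
      then show ?thesis using True c by (simp add: mult.assoc[symmetric])
    next
      case False
      then show ?thesis using c by (simp add: zero_less_mult_iff)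
    qed
  qed
  also have "\<dots> = (\<integral>\<^sup>+t. g (c * t) \<partial>log_measure)"
    by (rule nn_integral_log_measure[symmetric]) simp
  finally show ?thesis by simp
qed

lemma Lp_norm_log_scale:
  assumes [measurable]: "g \<in> borel_measurable borel" and c: "0 < c"
  shows "Lp_norm log_measure q (\<lambda>t. g (c * t)) = Lp_norm log_measure q g"
proof -
  have "(\<lambda>t. g t epowr q) \<in> borel_measurable borel" by measurable
  from log_measure_scale[OF this c] show ?thesis by (simp only: Lp_norm_def)
qed

text \<open>Dilation invariance moves \<open>c\<close> out of \<open>g\<close>, and the weight
  \<open>t powr - \<alpha>\<close> pays \<open>c powr \<alpha>\<close> for it. The two integrands
  are compared almost everywhere, since the rules for powers require \<open>t > 0\<close>.\<close>

lemma Lp_norm_log_weighted_scale: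
  fixes g :: "real \<Rightarrow> ennreal"
  assumes [measurable]: "g \<in> borel_measurable borel" and c: "0 < c" and q: "1 \<le> q"
  shows "Lp_norm log_measure q (\<lambda>t. ennreal (t powr - \<alpha>) * g (c * t))
    = ennreal (c powr \<alpha>) * Lp_norm log_measure q (\<lambda>t. ennreal (t powr - \<alpha>) * g t)"
proof -
  let ?h = "\<lambda>t. ennreal (t powr - \<alpha>) * g t"
  have "Lp_norm log_measure q (\<lambda>t. ennreal (t powr - \<alpha>) * g (c * t)) = Lp_norm log_measure q (\<lambda>t. ennreal (c powr \<alpha>) * ?h (c * t))"
  proof -
    have "AE t in log_measure. ennreal (t powr - \<alpha>) * g (c * t) = ennreal (c powr \<alpha>) * ?h (c * t)"
      using AE_log_measure_pos
    proof eventually_elim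
      case (elim t)
      have "c powr \<alpha> * (c * t) powr - \<alpha> = t powr - \<alpha>"
        using c elim by (simp add: powr_mult powr_add[symmetric] mult.assoc[symmetric])
      then have "ennreal (c powr \<alpha>) * ennreal ((c * t) powr - \<alpha>) = ennreal (t powr - \<alpha>)"
        by (subst ennreal_mult[symmetric]) auto
      then show ?case by (simp add: mult.assoc[symmetric])
    qed
    then show ?thesis using q by (intro antisym Lp_norm_mono_AE) (auto elim: eventually_mono)
  qed
  also have "\<dots> = ennreal (c powr \<alpha>) * Lp_norm log_measure q (\<lambda>t. ?h (c * t))"
    using q by (intro Lp_norm_cmult) measurable
  also have "Lp_norm log_measure q (\<lambda>t. ?h (c * t)) = Lp_norm log_measure q ?h"
    using c by (intro Lp_norm_log_scale) measurable
  finally show ?thesis .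
qed

lemma Lp_norm_log_power_finite:
  assumes b: "0 < b" and q: "1 \<le> q"
  shows "Lp_norm log_measure q (\<lambda>t. ennreal (t powr b) * indicator {0<..1} t) < \<infinity>"
proof -
  have "(\<integral>\<^sup>+t. (ennreal (t powr b) * indicator {0<..1} t) epowr q \<partial>log_measure)
      = (\<integral>\<^sup>+t\<in>{0<..}. ennreal (1 / t) * (ennreal (t powr b) * indicator {0<..1} t) epowr q \<partial>lborel)"
    by (rule nn_integral_log_measure) measurable
  also have "\<dots> = (\<integral>\<^sup>+t\<in>{0..1}. ennreal (t powr (b * q - 1)) \<partial>lborel)"
  proof (intro nn_integral_cong)
    fix t :: real
    have "ennreal (1 / t) * ennreal ((t powr b) powr q) = ennreal (t powr (b * q - 1))" if "0 < t"
      using that by (subst ennreal_mult[symmetric]) (auto simp: powr_powr powr_diff)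
    moreover have "0 powr (b * q - 1) = (0::real)" by simp
    ultimately show "ennreal (1 / t) * (ennreal (t powr b) * indicator {0<..1} t) epowr q * indicator {0<..} t
        = ennreal (t powr (b * q - 1)) * indicator {0..1} t"
      by (cases "t = 0") (auto simp: indicator_def)
  qed
  also have "\<dots> < \<infinity>"
  proof -
    have "b * q - 1 > - 1" using b q by simp
    then have "((\<lambda>t. t powr (b * q - 1)) has_integral (1 powr (b * q - 1 + 1) / (b * q - 1 + 1))) {0..1::real}"
      by (intro has_integral_powr_from_0) auto
    then have "(\<integral>\<^sup>+t. ennreal (indicator {0..1} t * t powr (b * q - 1)) \<partial>lborel) = ennreal (1 powr (b * q - 1 + 1) / (b * q - 1 + 1))"
      by (intro nn_integral_has_integral_lebesgue) auto
    moreover have "(\<integral>\<^sup>+t\<in>{0..1}. ennreal (t powr (b * q - 1)) \<partial>lborel) = (\<integral>\<^sup>+t. ennreal (indicator {0..1} t * t powr (b * q - 1)) \<partial>lborel)"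
      by (intro nn_integral_cong) (simp split: split_indicator)
    ultimately show ?thesis by simp
  qed
  finally show ?thesis by (simp add: Lp_norm_def)
qed

text \<open>By Minkowski's inequality and dilation, the finer scales give a geometric series of
  ratio \<open>(1/2) powr \<alpha>\<close> and the coarser ones, with their weights, of ratio
  \<open>(1/2) powr (b - \<alpha>)\<close>. The two conditions on \<open>\<alpha>\<close> are
  exactly their convergence.\<close>

lemma Hardy_dyadic:
  assumes \<alpha>: "0 < \<alpha>" "\<alpha> < real b" and q: "1 \<le> q"
  obtains C where "C > 0" and "\<And>g F. g \<in> borel_measurable borel \<Longrightarrow>
    Lp_norm log_measure q (\<lambda>t. ennreal (t powr - \<alpha>) * (dyadic_sum b g F t * indicator {0<..1} t))
      \<le> ennreal C * (Lp_norm log_measure q (\<lambda>t. ennreal (t powr - \<alpha>) * g t) + F)"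
proof -
  have geo: "\<exists>G. (\<Sum>j. ennreal (x ^ j)) = ennreal G \<and> 0 \<le> G" if "0 < x" "x < 1" for x :: real
    using that by (intro exI[of _ "suminf (\<lambda>j. x ^ j)"]) (auto intro!: suminf_ennreal2 suminf_nonneg summable_geometric)
  have lt: "0 < (1/2::real) powr a" "(1/2::real) powr a < 1" if "0 < a" for a
    using that powr_less_mono'[of "1/2::real" 0 a] by auto
  obtain G1 where G1: "(\<Sum>j. ennreal (((1/2) powr \<alpha>) ^ j)) = ennreal G1" "0 \<le> G1"
    using geo[OF lt[OF \<alpha>(1)]] by (elim exE conjE)
  have "0 < real b - \<alpha>" using \<alpha> by simp
  from geo[OF lt[OF this]] obtain G2 where
    G2: "(\<Sum>j. ennreal (((1/2) powr (real b - \<alpha>)) ^ j)) = ennreal G2" "0 \<le> G2" by (elim exE conjE)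
  \<comment> \<open>The factor that multiplies \<open>F\<close>: the weighted norm of
    \<open>t ^ b\<close> on (0, 1], finite because \<open>\<alpha> < b\<close>.\<close>
  define H where "H = enn2real (Lp_norm log_measure q (\<lambda>t. ennreal (t powr (real b - \<alpha>)) * indicator {0<..1} t))"
  have H: "Lp_norm log_measure q (\<lambda>t. ennreal (t powr (real b - \<alpha>)) * indicator {0<..1} t) = ennreal H"
    using Lp_norm_log_power_finite[of "real b - \<alpha>" q] \<alpha> q by (simp add: H_def)
  define C where "C = G1 + G2 + H + 1"
  have H0: "0 \<le> H" by (simp add: H_def)
  have C: "0 < C" using G1 G2 H0 by (simp add: C_def)
  show ?thesis
  proof (rule that[OF C])
    fix g :: "real \<Rightarrow> ennreal" and F assume g [measurable]: "g \<in> borel_measurable borel"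
    let ?N = "Lp_norm log_measure q (\<lambda>t. ennreal (t powr - \<alpha>) * g t)"
    let ?X = "\<lambda>t. \<Sum>j. ennreal (t powr - \<alpha>) * g (t / 2 ^ j)"
    let ?Y = "\<lambda>t. \<Sum>i. ennreal (((1/2) ^ i) ^ b) * (ennreal (t powr - \<alpha>) * g (2 ^ i * t))"
    let ?Z = "\<lambda>t. F * (ennreal (t powr (real b - \<alpha>)) * indicator {0<..1} t)"
    have X: "Lp_norm log_measure q ?X \<le> ennreal G1 * ?N"
    proof -
      have "Lp_norm log_measure q ?X \<le> (\<Sum>j. Lp_norm log_measure q (\<lambda>t. ennreal (t powr - \<alpha>) * g (t / 2 ^ j)))"
        using q by (intro Lp_norm_suminf) measurable
      also have "\<dots> = (\<Sum>j. ennreal (((1/2) powr \<alpha>) ^ j) * ?N)"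
      proof (intro suminf_cong)
        fix j
        have "((1/2::real) ^ j) powr \<alpha> = ((1/2) powr \<alpha>) ^ j"
          by (simp add: powr_realpow[symmetric] powr_powr mult.commute)
        then show "Lp_norm log_measure q (\<lambda>t. ennreal (t powr - \<alpha>) * g (t / 2 ^ j)) = ennreal (((1/2) powr \<alpha>) ^ j) * ?N"
          using Lp_norm_log_weighted_scale[OF g _ q, of "(1/2) ^ j" \<alpha>] by (simp add: power_one_over)
      qed
      also have "\<dots> = ennreal G1 * ?N" by (simp add: G1)
      finally show ?thesis .
    qed
    have Y: "Lp_norm log_measure q ?Y \<le> ennreal G2 * ?N"
    proof -
      have "Lp_norm log_measure q ?Y \<le> (\<Sum>i. Lp_norm log_measure q (\<lambda>t. ennreal (((1/2) ^ i) ^ b) * (ennreal (t powr - \<alpha>) * g (2 ^ i * t))))"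
        using q by (intro Lp_norm_suminf) measurable
      also have "\<dots> = (\<Sum>i. ennreal (((1/2) powr (real b - \<alpha>)) ^ i) * ?N)"
      proof (intro suminf_cong)
        fix i
        have "Lp_norm log_measure q (\<lambda>t. ennreal (((1/2) ^ i) ^ b) * (ennreal (t powr - \<alpha>) * g (2 ^ i * t)))
            = ennreal (((1/2) ^ i) ^ b) * (ennreal ((2 ^ i) powr \<alpha>) * ?N)"
          using q by (subst Lp_norm_cmult) (auto simp: Lp_norm_log_weighted_scale)
        also have "\<dots> = ennreal (((1/2) ^ i) ^ b * (2 ^ i) powr \<alpha>) * ?N"
          by (subst ennreal_mult) (auto simp: mult.assoc)
        also have "((1/2::real) ^ i) ^ b * (2 ^ i) powr \<alpha> = ((1/2) powr (real b - \<alpha>)) ^ i"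
        proof -
          have "((1/2::real) ^ i) ^ b = (1/2) powr (real i * real b)"
          proof -
            have "((1/2::real) ^ i) ^ b = (1/2) ^ (i * b)" by (simp only: power_mult)
            also have "\<dots> = (1/2) powr real (i * b)" by (rule powr_realpow[symmetric]) simp
            finally show ?thesis by (simp only: of_nat_mult)
          qed
          moreover have "((2::real) ^ i) powr \<alpha> = (1/2) powr (- (real i * \<alpha>))"
            by (simp add: powr_realpow[symmetric] powr_powr powr_minus powr_divide)
          moreover have "((1/2::real) powr (real b - \<alpha>)) ^ i = (1/2) powr (real i * real b + - (real i * \<alpha>))"
            by (simp add: powr_realpow[symmetric] powr_powr algebra_simps)
          ultimately show ?thesis by (simp only: powr_add)
        qed
        finally show "Lp_norm log_measure q (\<lambda>t. ennreal (((1/2) ^ i) ^ b) * (ennreal (t powr - \<alpha>) * g (2 ^ i * t)))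
            = ennreal (((1/2) powr (real b - \<alpha>)) ^ i) * ?N" .
      qed
      also have "\<dots> = ennreal G2 * ?N" by (simp add: G2)
      finally show ?thesis .
    qed
    have Z: "Lp_norm log_measure q ?Z = F * ennreal H"
      using q by (subst Lp_norm_cmult) (auto simp: H)
    have "Lp_norm log_measure q (\<lambda>t. ennreal (t powr - \<alpha>) * (dyadic_sum b g F t * indicator {0<..1} t)) \<le> Lp_norm log_measure q (\<lambda>t. (?X t + ?Y t) + ?Z t)"
    proof (rule Lp_norm_mono)
      fix t :: real
      show "ennreal (t powr - \<alpha>) * (dyadic_sum b g F t * indicator {0<..1} t) \<le> (?X t + ?Y t) + ?Z t"
      proof (cases "0 < t \<and> t \<le> 1")
        case True
        have "t powr - \<alpha> * t ^ b = t powr (real b - \<alpha>)"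
          using True by (simp add: powr_realpow[symmetric] powr_add[symmetric])
        then have tb: "ennreal (t powr - \<alpha>) * ennreal (t ^ b) = ennreal (t powr (real b - \<alpha>))"
          using True by (subst ennreal_mult[symmetric]) auto
        have Xe: "ennreal (t powr - \<alpha>) * (\<Sum>j. g (t / 2 ^ j)) = ?X t" by (rule ennreal_suminf_cmult[symmetric])
        have Ye: "ennreal (t powr - \<alpha>) * (\<Sum>i. ennreal (((1/2) ^ i) ^ b) * g (2 ^ i * t)) = ?Y t"
          by (subst ennreal_suminf_cmult[symmetric]) (simp only: mult.left_commute)
        have Ze: "ennreal (t powr - \<alpha>) * (ennreal (t ^ b) * F) = ?Z t"
          using True by (simp add: tb mult.assoc[symmetric]) (simp add: mult.commute)
        have "indicator {0<..1} t = (1 :: ennreal)" using True by simp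
        then have "ennreal (t powr - \<alpha>) * (dyadic_sum b g F t * indicator {0<..1} t)
          = ennreal (t powr - \<alpha>) * dyadic_sum b g F t"
          by (simp only: mult_1_right)
        also have "\<dots> = (?X t + ?Y t) + ?Z t" by (simp only: distrib_left Xe Ye Ze)
        finally show ?thesis by (rule eq_refl)
      qed auto
    qed (use q in auto)
    also have "\<dots> \<le> Lp_norm log_measure q (\<lambda>t. ?X t + ?Y t) + Lp_norm log_measure q ?Z"
      using q by (intro Lp_norm_add) measurable
    also have "\<dots> \<le> (Lp_norm log_measure q ?X + Lp_norm log_measure q ?Y) + Lp_norm log_measure q ?Z"
      using q by (intro add_right_mono Lp_norm_add) measurable
    also have "\<dots> \<le> (ennreal G1 * ?N + ennreal G2 * ?N) + F * ennreal H"
      unfolding Z by (intro add_right_mono add_mono X Y)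
    also have "\<dots> \<le> ennreal C * (?N + F)"
    proof -
      have "ennreal G1 * ?N + ennreal G2 * ?N = ennreal (G1 + G2) * ?N" using G1 G2 by (simp add: distrib_right)
      also have "\<dots> \<le> ennreal C * ?N" using H0 by (intro mult_right_mono ennreal_leI) (auto simp: C_def)
      finally have 1: "ennreal G1 * ?N + ennreal G2 * ?N \<le> ennreal C * ?N" .
      have "F * ennreal H \<le> ennreal C * F"
        unfolding mult.commute[of F] using G1 G2 by (intro mult_right_mono ennreal_leI) (auto simp: C_def)
      with 1 show ?thesis unfolding distrib_left by (rule add_mono)
    qed
    finally show "Lp_norm log_measure q (\<lambda>t. ennreal (t powr - \<alpha>) * (dyadic_sum b g F t * indicator {0<..1} t)) \<le> ennreal C * (?N + F)" .
  qed
qed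

section \<open>Besov norms\<close>

text \<open>The image under the identity map forgets all but the Borel sets and gives measure zero
  to the complement of a Borel \<open>S\<close>; this is the instance to which the locale is
  applied.\<close>

definition hausdorff_trace :: "real \<Rightarrow> 'a::metric_space set \<Rightarrow> 'a measure" where
  "hausdorff_trace d S = distr (restrict_space (hausdorff_measure d) S) borel (\<lambda>x. x)"

lemma sets_hausdorff_trace [simp]: "sets (hausdorff_trace d S) = sets borel"
  by (simp add: hausdorff_trace_def)

lemma id_measurable_hausdorff: "(\<lambda>x. x) \<in> restrict_space (hausdorff_measure d) S \<rightarrow>\<^sub>M borel"
  using sets_borel_le_hausdorff[of d]
  by (intro measurable_restrict_space1 measurableI) (auto simp: subset_eq)

lemma emeasure_hausdorff_trace:
  assumes "S \<in> sets borel" "B \<in> sets borel"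
  shows "emeasure (hausdorff_trace d S) B = emeasure (hausdorff_measure d) (B \<inter> S)"
proof -
  have S: "S \<in> sets (hausdorff_measure d)" using assms sets_borel_le_hausdorff by blast
  have "emeasure (hausdorff_trace d S) B = emeasure (restrict_space (hausdorff_measure d) S) (B \<inter> S)"
    unfolding hausdorff_trace_def using assms id_measurable_hausdorff
    by (subst emeasure_distr) (auto simp: space_restrict_space)
  also have "\<dots> = emeasure (hausdorff_measure d) (B \<inter> S)"
    using S by (intro emeasure_restrict_space) auto
  finally show ?thesis .
qed

lemma nn_integral_hausdorff_trace:
  "h \<in> borel_measurable borel \<Longrightarrow> (\<integral>\<^sup>+x. h x \<partial>hausdorff_trace d S) = (\<integral>\<^sup>+x. h x \<partial>restrict_space (hausdorff_measure d) S)"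
  unfolding hausdorff_trace_def by (rule nn_integral_distr[OF id_measurable_hausdorff]) simp

lemma Lp_norm_hausdorff_trace:
  "h \<in> borel_measurable borel \<Longrightarrow> Lp_norm (hausdorff_trace d S) p h = Lp_norm (restrict_space (hausdorff_measure d) S) p h"
  by (simp add: Lp_norm_def nn_integral_hausdorff_trace borel_measurable_epowr)

lemma d_set_regular:
  fixes S :: "(real^'n::finite) set"
  assumes "real CARD('n) - 1 < d" "d_set d S"
  shows "\<exists>c1 c2. ahlfors_regular (hausdorff_trace d S) S d c1 c2"
proof -
  have S: "closed S" "S \<in> sets borel" using assms by (auto simp: d_set_def intro: borel_closed)
  obtain c1 c2 where c: "c1 > 0" "c2 > 0" and bnd: "\<And>w r. w \<in> S \<Longrightarrow> 0 < r \<Longrightarrow> r \<le> 1 \<Longrightarrow>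
        ennreal (c1 * r powr d) \<le> emeasure (hausdorff_measure d) (cube w r \<inter> S) \<and>
        emeasure (hausdorff_measure d) (cube w r \<inter> S) \<le> ennreal (c2 * r powr d)"
    using assms(2) unfolding d_set_def by blast
  have "ahlfors_regular (hausdorff_trace d S) S d c1 c2"
  proof
    show "emeasure (hausdorff_trace d S) (- S) = 0"
      using S by (subst emeasure_hausdorff_trace) auto
  qed (use S c bnd assms in \<open>auto simp: emeasure_hausdorff_trace\<close>)
  then show ?thesis by blast
qed

text \<open>Caratheodory-measurable functions are replaced by Borel functions: a measurable set of finite
  measure has a Borel hull, and the difference has a Borel hull of measure zero.\<close>

lemma hausdorff_sets_completion:
  fixes S :: "(real^'n::finite) set"
  assumes reg: "ahlfors_regular (hausdorff_trace d S) S d c1 c2" and A: "A \<in> sets (hausdorff_measure d)"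
  shows "A \<in> sets (completion (hausdorff_trace d S))"
proof -
  interpret ahlfors_regular "hausdorff_trace d S" S d c1 c2 by (rule reg)
  let ?H = "hausdorff_measure d :: (real^'n) measure" and ?M = "hausdorff_trace d S"
  have SH: "S \<in> sets ?H" and cubeH: "cube x r \<in> sets ?H" for x :: "real^'n" and r
    using sets_borel_le_hausdorff S_borel cube_borel by blast+
  \<comment> \<open>Bounded pieces have finite measure, and this is what allows the measure of hull
    minus piece to be computed by subtraction.\<close>
  have piece: "A \<inter> S \<inter> cube 0 (real N) \<in> sets (completion ?M)" for N :: nat
  proof -
    define D where "D = A \<inter> S \<inter> cube 0 (real N)"
    have DH: "D \<in> sets ?H" unfolding D_def using A SH cubeH by auto
    have "emeasure ?H D \<le> emeasure ?H (cube 0 (real N) \<inter> S)"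
      using SH cubeH by (intro emeasure_mono) (auto simp: D_def)
    also have "\<dots> = emeasure ?M (cube 0 (real N))" by (rule emeasure_hausdorff_trace[symmetric]) auto
    also have "\<dots> < top" by (rule cube_origin_finite)
    finally have Dfin: "emeasure ?H D \<noteq> \<infinity>" by (simp add: less_top)
    obtain B where B: "B \<in> sets borel" "D \<subseteq> B" "hausdorff_outer d B \<le> hausdorff_outer d D"
      using hausdorff_borel_hull[of D d] by blast
    have BH: "B \<in> sets ?H" using B(1) sets_borel_le_hausdorff by blast
    have "emeasure ?H (B - D) = emeasure ?H B - emeasure ?H D"
      using B DH BH Dfin by (intro emeasure_Diff) auto
    moreover have "emeasure ?H B \<le> emeasure ?H D"
      using B(3) BH DH by (simp add: emeasure_hausdorff_measure)
    ultimately have "emeasure ?H (B - D) = 0" using Dfin by (simp add: diff_eq_0_iff_ennreal top.not_eq_extremum)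
    then have "hausdorff_outer d (B - D) = 0"
      using BH DH emeasure_hausdorff_measure[of "B - D" d] by auto
    then obtain Z where Z: "Z \<in> sets borel" "B - D \<subseteq> Z" "hausdorff_outer d Z = 0"
      using hausdorff_borel_hull[of "B - D" d] by auto
    have "emeasure ?M Z = emeasure ?H (Z \<inter> S)" using Z by (intro emeasure_hausdorff_trace) auto
    also have "\<dots> \<le> emeasure ?H Z"
      using Z(1) sets_borel_le_hausdorff by (intro emeasure_mono) blast+
    also have "\<dots> = 0" using Z sets_borel_le_hausdorff by (subst emeasure_hausdorff_measure) blast+
    finally have "Z \<in> null_sets ?M" using Z by auto
    moreover have "D = (B - Z) \<union> (D \<inter> Z)" using B Z by blast
    ultimately have "D \<in> sets (completion ?M)"
      using B Z by (intro sets_completionI[of D "B - Z" "D \<inter> Z" Z]) auto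
    then show ?thesis by (simp add: D_def)
  qed
  have "A = (\<Union>N::nat. A \<inter> S \<inter> cube 0 (real N)) \<union> (A - S)"
    using UN_cube_origin by blast
  moreover have "A - S \<in> sets (completion ?M)"
    using null_compl by (intro sets_completionI[of "A - S" "{}" "A - S" "- S"]) auto
  moreover have "(\<Union>N::nat. A \<inter> S \<inter> cube 0 (real N)) \<in> sets (completion ?M)"
    by (rule sets.countable_UN) (use piece in blast)
  ultimately show ?thesis by (metis sets.Un)
qed

lemma borel_representative:
  fixes S :: "(real^'n::finite) set" and f :: "real^'n \<Rightarrow> real"
  assumes reg: "ahlfors_regular (hausdorff_trace d S) S d c1 c2"
    and f: "f \<in> borel_measurable (restrict_space (hausdorff_measure d) S)"
  obtains g where "g \<in> borel_measurable borel" "AE x in restrict_space (hausdorff_measure d) S. f x = g x"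
proof -
  interpret ahlfors_regular "hausdorff_trace d S" S d c1 c2 by (rule reg)
  let ?H = "hausdorff_measure d :: (real^'n) measure" and ?M = "hausdorff_trace d S"
  have "S \<in> sets ?H" using sets_borel_le_hausdorff S_borel by blast
  then have f': "(\<lambda>x. f x * indicator S x) \<in> borel_measurable ?H"
    using f by (subst (asm) borel_measurable_restrict_space_iff) (auto simp: mult.commute)
  \<comment> \<open>\<open>f\<close> is measurable only on \<open>S\<close>, so it is first extended
    by zero; on \<open>S\<close> nothing changes.\<close>
  have "(\<lambda>x. f x * indicator S x) \<in> borel_measurable (completion ?M)"
  proof (rule measurableI)
    fix V :: "real set" assume "V \<in> sets borel"
    then have "(\<lambda>x. f x * indicator S x) -` V \<in> sets ?H"
      using measurable_sets[OF f'] by simp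
    then show "(\<lambda>x. f x * indicator S x) -` V \<inter> space (completion ?M) \<in> sets (completion ?M)"
      using hausdorff_sets_completion[OF reg] by simp
  qed simp
  from completion_ex_borel_measurable_real[OF this]
  obtain g where g: "g \<in> borel_measurable ?M" "AE x in ?M. f x * indicator S x = g x" by blast
  have "AE x in restrict_space ?H S. f x * indicator S x = g x"
    using AE_distrD[OF id_measurable_hausdorff g(2)[unfolded hausdorff_trace_def]] .
  moreover have "AE x in restrict_space ?H S. x \<in> S"
    by (rule AE_I2) (simp add: space_restrict_space)
  ultimately have "AE x in restrict_space ?H S. f x = g x" by eventually_elim simp
  moreover have "g \<in> borel_measurable borel" using g(1) by simp
  ultimately show ?thesis using that by blast
qed

section \<open>Comparison of the Besov norms, with the scale integral written as an
  \<open>L^q\<close> norm for dt/t\<close>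

definition besov_seminorm :: "real \<Rightarrow> real \<Rightarrow> (real \<Rightarrow> ennreal) \<Rightarrow> ennreal" where
  "besov_seminorm \<alpha> q X = (\<integral>\<^sup>+\<tau>\<in>{0<..1}. (X \<tau> / ennreal (\<tau> powr \<alpha>)) epowr q / ennreal \<tau> \<partial>lborel) epowr (1 / q)"

lemma besov_norm_eq_seminorm:
  "besov_norm d S \<alpha> p q k u f = Lp_norm (restrict_space (hausdorff_measure d) S) p (\<lambda>x. ennreal \<bar>f x\<bar>)
    + besov_seminorm \<alpha> q (\<lambda>\<tau>. Lp_norm (restrict_space (hausdorff_measure d) S) p (\<lambda>x. best_approx d S k u f (cube x \<tau>)))"
  by (simp add: besov_norm_def besov_seminorm_def)

lemma besov_seminorm_mono:
  assumes "1 \<le> q" "\<And>\<tau>. 0 < \<tau> \<Longrightarrow> \<tau> \<le> 1 \<Longrightarrow> X \<tau> \<le> Y \<tau>"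
  shows "besov_seminorm \<alpha> q X \<le> besov_seminorm \<alpha> q Y"
  unfolding besov_seminorm_def using assms
  by (intro epowr_mono nn_integral_mono)
    (auto simp: indicator_def intro!: divide_right_mono_ennreal epowr_mono)

lemma besov_seminorm_eq_log:
  assumes [measurable]: "X \<in> borel_measurable borel" and q: "1 \<le> q"
  shows "besov_seminorm \<alpha> q X = Lp_norm log_measure q (\<lambda>t. ennreal (t powr - \<alpha>) * (X t * indicator {0<..1} t))"
proof -
  have "(\<integral>\<^sup>+t. (ennreal (t powr - \<alpha>) * (X t * indicator {0<..1} t)) epowr q \<partial>log_measure)
      = (\<integral>\<^sup>+t\<in>{0<..}. ennreal (1 / t) * (ennreal (t powr - \<alpha>) * (X t * indicator {0<..1} t)) epowr q \<partial>lborel)"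
    by (intro nn_integral_log_measure) measurable
  also have "\<dots> = (\<integral>\<^sup>+\<tau>\<in>{0<..1}. (X \<tau> / ennreal (\<tau> powr \<alpha>)) epowr q / ennreal \<tau> \<partial>lborel)"
  proof (intro nn_integral_cong)
    fix t :: real
    show "ennreal (1 / t) * (ennreal (t powr - \<alpha>) * (X t * indicator {0<..1} t)) epowr q * indicator {0<..} t
        = (X t / ennreal (t powr \<alpha>)) epowr q / ennreal t * indicator {0<..1} t"
    proof (cases "0 < t \<and> t \<le> 1")
      case True
      have "a / ennreal s = ennreal (1 / s) * a" if "0 < s" for a s
        using that by (simp add: divide_ennreal_def inverse_ennreal mult.commute inverse_eq_divide)
      then show ?thesis using True by (simp add: powr_minus_divide)
    qed auto
  qed
  finally show ?thesis by (simp add: Lp_norm_def besov_seminorm_def)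
qed

text \<open>For each polynomial the integral depends only on the class of \<open>f\<close> modulo
  null sets of \<open>S\<close>. Hence the equality holds at every \<open>x\<close> and
  \<open>t\<close>, not merely almost everywhere.\<close>

lemma transfer_best_approx:
  fixes S :: "(real^'n::finite) set"
  assumes reg: "ahlfors_regular (hausdorff_trace d S) S d c1 c2"
    and g: "g \<in> borel_measurable borel" and fg: "AE x in restrict_space (hausdorff_measure d) S. f x = g x"
  shows "best_approx d S k u f (cube x t) = (INF P\<in>polys (k - 1).
    ahlfors_regular.avg (hausdorff_trace d S) x t (\<lambda>y. ennreal (\<bar>g y - P y\<bar> powr u)) epowr (1 / u))"
  unfolding best_approx_def
proof (intro INF_cong refl)
  interpret ahlfors_regular "hausdorff_trace d S" S d c1 c2 by (rule reg)
  let ?H = "hausdorff_measure d :: (real^'n) measure" and ?M = "hausdorff_trace d S"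
  fix P :: "real^'n \<Rightarrow> real" assume "P \<in> polys (k - 1)"
  note [measurable] = borel_measurable_polys[OF this] g
  have "S \<in> sets ?H" using sets_borel_le_hausdorff S_borel by blast
  then have SH: "S \<inter> space ?H \<in> sets ?H" by simp
  have "(\<integral>\<^sup>+y\<in>cube x t \<inter> S. ennreal (\<bar>f y - P y\<bar> powr u) \<partial>?H)
      = (\<integral>\<^sup>+y. ennreal (\<bar>f y - P y\<bar> powr u) * indicator (cube x t) y * indicator S y \<partial>?H)"
    by (intro nn_integral_cong) (simp split: split_indicator)
  also have "\<dots> = (\<integral>\<^sup>+y. ennreal (\<bar>f y - P y\<bar> powr u) * indicator (cube x t) y \<partial>restrict_space ?H S)"
    by (rule nn_integral_restrict_space[OF SH, symmetric])
  also have "\<dots> = (\<integral>\<^sup>+y. ennreal (\<bar>g y - P y\<bar> powr u) * indicator (cube x t) y \<partial>restrict_space ?H S)"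
    using fg by (intro nn_integral_cong_AE) (auto elim!: eventually_mono)
  also have "\<dots> = (\<integral>\<^sup>+y\<in>cube x t. ennreal (\<bar>g y - P y\<bar> powr u) \<partial>?M)"
    by (intro nn_integral_hausdorff_trace[symmetric]) measurable
  finally have "1 / emeasure ?H (cube x t \<inter> S) * (\<integral>\<^sup>+y\<in>cube x t \<inter> S. ennreal (\<bar>f y - P y\<bar> powr u) \<partial>?H)
      = (\<integral>\<^sup>+y\<in>cube x t. ennreal (\<bar>g y - P y\<bar> powr u) \<partial>?M) / emeasure ?M (cube x t)"
    by (simp add: emeasure_hausdorff_trace divide_ennreal_def mult.commute)
  also have "\<dots> = avg x t (\<lambda>y. ennreal (\<bar>g y - P y\<bar> powr u))"
    by (intro avg_eq[symmetric]) measurable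
  finally have eq: "1 / emeasure ?H (cube x t \<inter> S) * (\<integral>\<^sup>+y\<in>cube x t \<inter> S. ennreal (\<bar>f y - P y\<bar> powr u) \<partial>?H)
      = avg x t (\<lambda>y. ennreal (\<bar>g y - P y\<bar> powr u))" .
  show "(1 / emeasure ?H (cube x t \<inter> S) * (\<integral>\<^sup>+y\<in>cube x t \<inter> S. ennreal (\<bar>f y - P y\<bar> powr u) \<partial>?H)) epowr (1 / u)
      = avg x t (\<lambda>y. ennreal (\<bar>g y - P y\<bar> powr u)) epowr (1 / u)"
    unfolding eq ..
qed

text \<open>On each cube a larger order admits more polynomials, and Jensen's inequality with
  exponent \<open>u2 / u1\<close> compares the two means. The comparison is pointwise in the centre,
  so monotonicity of the integrals finishes the proof.\<close>

lemma besov_norm_mono: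
  fixes S :: "(real^'n::finite) set"
  assumes reg: "ahlfors_regular (hausdorff_trace d S) S d c1 c2"
    and k: "k1 \<le> k2" and u: "1 \<le> u1" "u1 \<le> u2" and p: "1 \<le> p" and q: "1 \<le> q"
    and f: "f \<in> Lp_on d S p"
  shows "besov_norm d S \<alpha> p q k2 u1 f \<le> besov_norm d S \<alpha> p q k1 u2 f"
  unfolding besov_norm_eq_seminorm
proof (intro add_left_mono besov_seminorm_mono Lp_norm_mono)
  interpret ahlfors_regular "hausdorff_trace d S" S d c1 c2 by (rule reg)
  have "f \<in> borel_measurable (restrict_space (hausdorff_measure d) S)" using f by (simp add: Lp_on_def)
  from borel_representative[OF reg this] obtain g where g: "g \<in> borel_measurable borel"
    and fg: "AE x in restrict_space (hausdorff_measure d) S. f x = g x" .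
  fix \<tau> :: real and x assume \<tau>: "0 < \<tau>" "\<tau> \<le> 1" and "x \<in> space (restrict_space (hausdorff_measure d) S)"
  then have x: "x \<in> S" by (simp add: space_restrict_space)
  show "best_approx d S k2 u1 f (cube x \<tau>) \<le> best_approx d S k1 u2 f (cube x \<tau>)"
    unfolding transfer_best_approx[OF reg g fg]
  proof (rule INF_mono)
    fix P :: "real^'n \<Rightarrow> real" assume P: "P \<in> polys (k1 - 1)"
    note [measurable] = borel_measurable_polys[OF P] g
    have "avg x \<tau> (\<lambda>y. ennreal (\<bar>g y - P y\<bar> powr u1)) epowr (u2 / u1)
        \<le> avg x \<tau> (\<lambda>y. ennreal (\<bar>g y - P y\<bar> powr u1) epowr (u2 / u1))"
      using u x \<tau> by (intro avg_Jensen) auto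
    also have "(\<lambda>y. ennreal (\<bar>g y - P y\<bar> powr u1) epowr (u2 / u1)) = (\<lambda>y. ennreal (\<bar>g y - P y\<bar> powr u2))"
      using u by (simp add: powr_powr)
    finally have "(avg x \<tau> (\<lambda>y. ennreal (\<bar>g y - P y\<bar> powr u1)) epowr (u2 / u1)) epowr (1 / u2)
        \<le> avg x \<tau> (\<lambda>y. ennreal (\<bar>g y - P y\<bar> powr u2)) epowr (1 / u2)"
      using u by (intro epowr_mono) auto
    then have "avg x \<tau> (\<lambda>y. ennreal (\<bar>g y - P y\<bar> powr u1)) epowr (1 / u1)
        \<le> avg x \<tau> (\<lambda>y. ennreal (\<bar>g y - P y\<bar> powr u2)) epowr (1 / u2)"
      using u by (simp add: epowr_epowr)
    moreover have "P \<in> polys (k2 - 1)" using P polys_mono[of "k1 - 1" "k2 - 1"] k by auto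
    ultimately show "\<exists>Q\<in>polys (k2 - 1). avg x \<tau> (\<lambda>y. ennreal (\<bar>g y - Q y\<bar> powr u1)) epowr (1 / u1)
        \<le> avg x \<tau> (\<lambda>y. ennreal (\<bar>g y - P y\<bar> powr u2)) epowr (1 / u2)" by blast
  qed
qed (use p q in auto)

lemma dyadic_sum_measurable:
  assumes [measurable]: "G \<in> borel_measurable borel"
  shows "(\<lambda>t. (\<Sum>j. G (t / 2 ^ j)) + (\<Sum>i. ennreal (((1/2) ^ i) ^ b) * G (2 ^ i * t)) + ennreal (t ^ b) * F)
    \<in> borel_measurable (borel :: real measure)"
  by measurable

text \<open>Positivity of \<open>\<alpha>\<close> forces \<open>k1 \<ge> 1\<close>, so the degrees
  \<open>k1 - 1\<close> and \<open>k2 - 1\<close> are natural numbers \<open>l\<close> and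
  \<open>m\<close>. Truncation at degree \<open>l\<close> yields the decay exponent
  \<open>Suc l = k1\<close>, and \<open>\<alpha> < k1\<close> is the condition for Hardy's
  inequality.\<close>

lemma besov_norm_Marchaud:
  fixes S :: "(real^'n::finite) set"
  assumes reg: "ahlfors_regular (hausdorff_trace d S) S d c1 c2"
    and k: "\<alpha> < of_int k1" "k1 \<le> k2" and \<alpha>: "0 < \<alpha>" and p: "1 \<le> p" and q: "1 \<le> q"
  shows "\<exists>C>0. \<forall>f\<in>Lp_on d S p. besov_norm d S \<alpha> p q k1 p f \<le> ennreal C * besov_norm d S \<alpha> p q k2 1 f"
proof -
  interpret ahlfors_regular "hausdorff_trace d S" S d c1 c2 by (rule reg)
  let ?M = "hausdorff_trace d S" and ?R = "restrict_space (hausdorff_measure d) S"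
  define l where "l = nat (k1 - 1)"
  define m where "m = nat (k2 - 1)"
  have "0 < real_of_int k1" using k(1) \<alpha> by linarith
  then have k1: "1 \<le> k1" by simp
  then have lm: "int l = k1 - 1" "int m = k2 - 1" "l \<le> m" using k by (auto simp: l_def m_def)
  have "real (Suc l) = of_int k1" using lm(1) k1 by (metis Suc_eq_plus1 diff_add_cancel of_int_of_nat_eq of_nat_1 of_nat_add)
  then have b: "\<alpha> < real (Suc l)" using k(1) by (simp only:)
  obtain C1 where C1: "C1 > 0" and est: "\<And>f t. f \<in> borel_measurable borel \<Longrightarrow> Lp_norm ?M p (\<lambda>x. ennreal \<bar>f x\<bar>) < \<infinity> \<Longrightarrow>
     0 < t \<Longrightarrow> t \<le> 1 \<Longrightarrow> \<exists>U\<in>borel_measurable borel.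
       (\<forall>x\<in>S. best_Lp l p f x t \<le> U x) \<and>
       Lp_norm ?M p U \<le> ennreal C1 * dyadic_sum (Suc l) (err_norm m p f) (Lp_norm ?M p (\<lambda>x. ennreal \<bar>f x\<bar>)) t"
    by (rule scale_estimate[OF lm(3) p]) blast
  obtain C2 where C2: "C2 > 0" and hardy: "\<And>g F. g \<in> borel_measurable borel \<Longrightarrow>
    Lp_norm log_measure q (\<lambda>t. ennreal (t powr - \<alpha>) * (dyadic_sum (Suc l) g F t * indicator {0<..1} t))
      \<le> ennreal C2 * (Lp_norm log_measure q (\<lambda>t. ennreal (t powr - \<alpha>) * g t) + F)"
    by (rule Hardy_dyadic[OF \<alpha> b q]) blast
  define C where "C = 1 + C1 * C2"
  have C: "0 < C" using C1 C2 by (simp add: C_def add_pos_pos)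
  show ?thesis
  proof (intro exI[of _ C] conjI C ballI)
    fix f assume f: "f \<in> Lp_on d S p"
    then have fm: "f \<in> borel_measurable ?R" and ffin: "Lp_norm ?R p (\<lambda>x. ennreal \<bar>f x\<bar>) < \<infinity>"
      by (auto simp: Lp_on_def)
    from borel_representative[OF reg fm] obtain g where g [measurable]: "g \<in> borel_measurable borel"
      and fg: "AE x in ?R. f x = g x" .
    define F where "F = Lp_norm ?M p (\<lambda>x. ennreal \<bar>g x\<bar>)"
    have F: "Lp_norm ?R p (\<lambda>x. ennreal \<bar>f x\<bar>) = F"
    proof -
      have "Lp_norm ?R p (\<lambda>x. ennreal \<bar>f x\<bar>) = Lp_norm ?R p (\<lambda>x. ennreal \<bar>g x\<bar>)"
        using fg p by (intro antisym Lp_norm_mono_AE) (auto elim!: eventually_mono)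
      then show ?thesis unfolding F_def by (subst Lp_norm_hausdorff_trace) auto
    qed
    define G where "G = err_norm m p g"
    have [measurable]: "G \<in> borel_measurable borel" unfolding G_def by (rule err_norm_measurable[OF g])
    \<comment> \<open>For exponent 1 the original quantity equals the infimum over rational
      polynomials at every point of \<open>S\<close>; this makes the right-hand side measurable in
      the scale, as Hardy's inequality requires.\<close>
    have E: "Lp_norm ?R p (\<lambda>x. best_approx d S k2 1 f (cube x t)) = G t" if t: "0 < t" "t \<le> 1" for t
    proof -
      have "best_approx d S k2 1 f (cube x t) = err m g x t" if x: "x \<in> S" for x
      proof -
        have "best_approx d S k2 1 f (cube x t) = (INF P\<in>polys (int m). dev x t g P)"
          by (simp only: transfer_best_approx[OF reg g fg] lm(2) powr_one abs_ge_zero div_by_1 epowr_one)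
        also have "\<dots> = err m g x t"
        proof (rule antisym)
          show "(INF P\<in>polys (int m). dev x t g P) \<le> err m g x t"
            unfolding err_def by (intro INF_superset_mono rat_polys_subset) auto
          show "err m g x t \<le> (INF P\<in>polys (int m). dev x t g P)"
            using g x t by (intro INF_greatest err_le) auto
        qed
        finally show ?thesis .
      qed
      then have "Lp_norm ?R p (\<lambda>x. best_approx d S k2 1 f (cube x t)) = Lp_norm ?R p (\<lambda>x. err m g x t)"
        using p by (intro antisym Lp_norm_mono) (auto simp: space_restrict_space)
      also have "\<dots> = Lp_norm ?M p (\<lambda>x. err m g x t)"
        by (intro Lp_norm_hausdorff_trace[symmetric]) measurable
      finally show ?thesis using t by (simp add: G_def err_norm_def)
    qed
    define Y where "Y t = (\<Sum>j. G (t / 2 ^ j)) + (\<Sum>i. ennreal (((1/2) ^ i) ^ Suc l) * G (2 ^ i * t)) + ennreal (t ^ Suc l) * F" for t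
    have le: "Lp_norm ?R p (\<lambda>x. best_approx d S k1 p f (cube x t)) \<le> ennreal C1 * Y t" if t: "0 < t" "t \<le> 1" for t
    proof -
      have "Lp_norm ?M p (\<lambda>x. ennreal \<bar>g x\<bar>) < \<infinity>" using ffin F by (simp add: F_def)
      from est[OF g this t] obtain U where U [measurable]: "U \<in> borel_measurable borel"
        and UB: "\<forall>x\<in>S. (INF T\<in>polys (int l). avg x t (\<lambda>y. ennreal (\<bar>g y - T y\<bar> powr p)) epowr (1 / p)) \<le> U x"
        and ULp: "Lp_norm ?M p U \<le> ennreal C1 * Y t"
        unfolding F_def G_def Y_def by (elim bexE conjE)
      have "Lp_norm ?R p (\<lambda>x. best_approx d S k1 p f (cube x t)) \<le> Lp_norm ?R p U"
        using p UB unfolding transfer_best_approx[OF reg g fg] lm(1)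
        by (intro Lp_norm_mono) (auto simp: space_restrict_space)
      also have "\<dots> = Lp_norm ?M p U" by (rule Lp_norm_hausdorff_trace[symmetric, OF U])
      finally show ?thesis using ULp by (rule order_trans)
    qed
    have Y [measurable]: "Y \<in> borel_measurable borel"
      unfolding Y_def by (rule dyadic_sum_measurable) fact
    \<comment> \<open>The indicator of (0, 1] may be dropped because \<open>err_norm\<close> already
      vanishes outside that interval.\<close>
    have semi: "besov_seminorm \<alpha> q G = Lp_norm log_measure q (\<lambda>t. ennreal (t powr - \<alpha>) * G t)"
      unfolding besov_seminorm_eq_log[OF \<open>G \<in> borel_measurable borel\<close> q]
      by (intro arg_cong[where f="Lp_norm log_measure q"] ext) (auto simp: G_def err_norm_def indicator_def)
    have "besov_seminorm \<alpha> q (\<lambda>t. Lp_norm ?R p (\<lambda>x. best_approx d S k1 p f (cube x t)))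
        \<le> besov_seminorm \<alpha> q (\<lambda>t. ennreal C1 * Y t)"
      using q le by (intro besov_seminorm_mono) auto
    also have "\<dots> = Lp_norm log_measure q (\<lambda>t. ennreal (t powr - \<alpha>) * ((ennreal C1 * Y t) * indicator {0<..1} t))"
      using q by (intro besov_seminorm_eq_log) measurable
    also have "\<dots> = Lp_norm log_measure q (\<lambda>t. ennreal C1 * (ennreal (t powr - \<alpha>) * (Y t * indicator {0<..1} t)))"
      by (intro arg_cong[where f="Lp_norm log_measure q"] ext) (simp only: mult_ac)
    also have "\<dots> = ennreal C1 * Lp_norm log_measure q (\<lambda>t. ennreal (t powr - \<alpha>) * (Y t * indicator {0<..1} t))"
      using q by (intro Lp_norm_cmult) measurable
    also have "\<dots> \<le> ennreal C1 * (ennreal C2 * (besov_seminorm \<alpha> q G + F))"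
      unfolding semi Y_def by (intro mult_left_mono hardy \<open>G \<in> borel_measurable borel\<close>) auto
    also have "besov_seminorm \<alpha> q G = besov_seminorm \<alpha> q (\<lambda>t. Lp_norm ?R p (\<lambda>x. best_approx d S k2 1 f (cube x t)))"
      using q E by (intro antisym besov_seminorm_mono) auto
    also have "ennreal C1 * (ennreal C2 * (\<dots> + F)) = ennreal (C1 * C2) * besov_norm d S \<alpha> p q k2 1 f"
      unfolding besov_norm_eq_seminorm F using C1 C2 by (simp add: ennreal_mult mult.assoc add.commute)
    finally have "besov_norm d S \<alpha> p q k1 p f \<le> F + ennreal (C1 * C2) * besov_norm d S \<alpha> p q k2 1 f"
      unfolding besov_norm_eq_seminorm[of d S \<alpha> p q k1] F by (rule add_left_mono)
    also have "\<dots> \<le> besov_norm d S \<alpha> p q k2 1 f + ennreal (C1 * C2) * besov_norm d S \<alpha> p q k2 1 f"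
      unfolding besov_norm_eq_seminorm F by (intro add_right_mono) simp
    also have "\<dots> = ennreal C * besov_norm d S \<alpha> p q k2 1 f"
      using C1 C2 by (simp add: C_def distrib_right)
    finally show "besov_norm d S \<alpha> p q k1 p f \<le> ennreal C * besov_norm d S \<alpha> p q k2 1 f" .
  qed
qed

theorem theorem3p6:
  fixes S :: "(real^'n::finite) set" and d \<alpha> p q :: real
  assumes "real CARD('n) - 1 < d" and "d \<le> real CARD('n)"
    and "d_set d S"
    and "0 < \<alpha>" and "1 \<le> p" and "1 \<le> q"
  shows "\<forall>(k::int) (k'::int) (u::real) (u'::real).
    \<alpha> < of_int k \<and> \<alpha> < of_int k' \<and> 1 \<le> u \<and> u \<le> p \<and> 1 \<le> u' \<and> u' \<le> p \<longrightarrow>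
      besov_space d S \<alpha> p q k u = besov_space d S \<alpha> p q k' u' \<and>
      (\<exists>C::real. C > 0 \<and> (\<forall>f \<in> Lp_on d S p.
         ennreal (1 / C) * besov_norm d S \<alpha> p q k' u' f \<le> besov_norm d S \<alpha> p q k u f \<and>
         besov_norm d S \<alpha> p q k u f \<le> ennreal C * besov_norm d S \<alpha> p q k' u' f))"
proof (intro allI impI)
  fix k k' :: int and u u' :: real
  assume ku: "\<alpha> < of_int k \<and> \<alpha> < of_int k' \<and> 1 \<le> u \<and> u \<le> p \<and> 1 \<le> u' \<and> u' \<le> p"
  obtain c1 c2 where reg: "ahlfors_regular (hausdorff_trace d S) S d c1 c2"
    using d_set_regular[OF assms(1,3)] by blast
  have "\<alpha> < of_int (min k k')" using ku by (simp add: min_def)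
  from besov_norm_Marchaud[OF reg this _ assms(4-6), of "max k k'"]
  obtain C where C: "C > 0" and mar: "\<And>f. f \<in> Lp_on d S p \<Longrightarrow>
      besov_norm d S \<alpha> p q (min k k') p f \<le> ennreal C * besov_norm d S \<alpha> p q (max k k') 1 f"
    by (auto simp: min_le_iff_disj)
  \<comment> \<open>Both given pairs of parameters lie between the extremes
    \<open>(min k k', p)\<close> and \<open>(max k k', 1)\<close>, so one constant serves both
    directions.\<close>
  have le: "besov_norm d S \<alpha> p q i v f \<le> ennreal C * besov_norm d S \<alpha> p q j w f"
    if f: "f \<in> Lp_on d S p" and i: "min k k' \<le> i" "1 \<le> v" "v \<le> p" and j: "j \<le> max k k'" "1 \<le> w" for i v j w f
  proof -
    have "besov_norm d S \<alpha> p q i v f \<le> besov_norm d S \<alpha> p q (min k k') p f"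
      using f i assms by (intro besov_norm_mono[OF reg])
    also have "\<dots> \<le> ennreal C * besov_norm d S \<alpha> p q (max k k') 1 f" by (rule mar[OF f])
    also have "\<dots> \<le> ennreal C * besov_norm d S \<alpha> p q j w f"
      using f j assms by (intro mult_left_mono besov_norm_mono[OF reg]) auto
    finally show ?thesis .
  qed
  have 1: "besov_norm d S \<alpha> p q k u f \<le> ennreal C * besov_norm d S \<alpha> p q k' u' f"
    and 2: "besov_norm d S \<alpha> p q k' u' f \<le> ennreal C * besov_norm d S \<alpha> p q k u f" if "f \<in> Lp_on d S p" for f
    using ku that by (auto intro!: le)
  have "besov_space d S \<alpha> p q k u = besov_space d S \<alpha> p q k' u'"
    unfolding besov_space_def
  proof (intro Collect_cong conj_cong refl iffI)
    fix f assume f: "f \<in> Lp_on d S p"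
    show "besov_norm d S \<alpha> p q k' u' f < \<infinity>" if "besov_norm d S \<alpha> p q k u f < \<infinity>"
      using 2[OF f] that by (auto intro: le_less_trans simp: ennreal_mult_less_top)
    show "besov_norm d S \<alpha> p q k u f < \<infinity>" if "besov_norm d S \<alpha> p q k' u' f < \<infinity>"
      using 1[OF f] that by (auto intro: le_less_trans simp: ennreal_mult_less_top)
  qed
  moreover have "ennreal (1 / C) * besov_norm d S \<alpha> p q k' u' f \<le> besov_norm d S \<alpha> p q k u f" if "f \<in> Lp_on d S p" for f
  proof -
    have "ennreal (1 / C) * besov_norm d S \<alpha> p q k' u' f \<le> ennreal (1 / C) * (ennreal C * besov_norm d S \<alpha> p q k u f)"
      by (intro mult_left_mono 2 that) auto
    also have "\<dots> = ennreal (1 / C * C) * besov_norm d S \<alpha> p q k u f"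
      using C by (subst ennreal_mult) (auto simp: mult.assoc)
    also have "1 / C * C = 1" using C by simp
    finally show ?thesis by (simp only: ennreal_1 mult_1)
  qed
  ultimately show "besov_space d S \<alpha> p q k u = besov_space d S \<alpha> p q k' u' \<and>
      (\<exists>C::real. C > 0 \<and> (\<forall>f \<in> Lp_on d S p.
         ennreal (1 / C) * besov_norm d S \<alpha> p q k' u' f \<le> besov_norm d S \<alpha> p q k u f \<and>
         besov_norm d S \<alpha> p q k u f \<le> ennreal C * besov_norm d S \<alpha> p q k' u' f))"
    using C 1 by (intro conjI exI[of _ C] ballI)
qed

end
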